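(* Let $N=3$, let $z_0=0$, and let $\Omega=\mathbb{C}_+$. Consider $A=(-\mathrm{i}\partial_x)^N$ in $L^2(\mathbb{R},\mathbb{C})$ with domain $\mathfrak{D}(A)=H^N(\mathbb{R},\mathbb{C})$. Let $s,s'>N-3/2$ and let $V$ be the operator of multiplication by a function $V\in C_{\mathrm{comp}}(\mathbb{R},\mathbb{C})$. Then: - either the resolvent $$(A+V-zI)^{-1}:\,L^2_s(\mathbb{R},\mathbb{C})\to L^2_{-s'}(\mathbb{R},\mathbb{C}),\qquad z\in\Omega,$$ converges in the uniform operator topology of $\mathscr{B}\big(L^2_s(\mathbb{R},\mathbb{C}),L^2_{-s'}(\mathbb{R},\mathbb{C})\big)$ as $z\to z_0$, $z\in\Omega$; - or there is a nontrivial solution $\Psi$ to $\big((-\mathrm{i}\partial_x)^3+V\big)\Psi=0$ with $\langle x\rangle^{-(N-2)}\Psi\in L^\infty(\mathbb{R},\mathbb{C})$; moreover, $N$ being odd, this solution is bounded by a constant multiple of $\langle x\rangle^{N-3}$ for $x\le0$ (that is, since $N=3$, $\Psi$ is bounded on $(-\infty,0]$).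
   Context: $\mathbb{C}_+=\{z\in\mathbb{C}:\operatorname{Im}z>0\}$; $\langle x\rangle=(1+x^2)^{1/2}$; $C_{\mathrm{comp}}(\mathbb{R},\mathbb{C})$ denotes compactly supported continuous functions. For $s\in\mathbb{R}$, $L^2_s(\mathbb{R},\mathbb{C})=\{u\in L^2_{\mathrm{loc}}(\mathbb{R},\mathbb{C}):\langle x\rangle^su\in L^2(\mathbb{R},\mathbb{C})\}$ with norm $\|u\|_{L^2_s}=\|\langle x\rangle^su\|_{L^2}$; there are continuous embeddings $L^2_s\hookrightarrow L^2\hookrightarrow L^2_{-s'}$ for $s,s'\ge 0$, through which the resolvent in $L^2$ is regarded as an operator $L^2_s\to L^2_{-s'}$. $\mathscr{B}(\mathbf{E},\mathbf{F})$ denotes bounded operators from $\mathbf{E}$ to $\mathbf{F}$. Convergence of the resolvent as $z\to z_0$, $z\in\Omega$, includes the requirement that $z$ belongs to the resolvent set of $A+V$ for all $z\in\Omega$ close enough to $z_0$. *)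

theory Defs
  imports "HOL-Analysis.Analysis"
begin

text \<open>
  Elements of the spaces \<open>L\<^sup>2\<^sub>s(\<real>, \<complex>)\<close> are represented by Borel measurable
  functions \<^typ>\<open>real \<Rightarrow> complex\<close>, with almost everywhere equality in the role of equality;
  operators act on representatives, and every operator identity is stated almost everywhere.
\<close>

definition japanese :: "real \<Rightarrow> real" where
  "japanese x = sqrt (1 + x\<^sup>2)"

definition upper_half_plane :: "complex set" where
  "upper_half_plane = {z. Im z > 0}"

definition compactly_supported :: "(real \<Rightarrow> complex) \<Rightarrow> bool" where
  "compactly_supported f \<longleftrightarrow> compact (closure {x. f x \<noteq> 0})"

definition C_comp :: "(real \<Rightarrow> complex) set" where
  "C_comp = {f. continuous_on UNIV f \<and> compactly_supported f}"


text \<open>Weighted Lebesgue spaces. Local square integrability is automatic,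
  since the weight is bounded below by a positive constant on bounded sets.\<close>

definition L2 :: "real \<Rightarrow> (real \<Rightarrow> complex) set" where
  "L2 s = {u \<in> borel_measurable lborel.
             integrable lborel (\<lambda>x. (japanese x powr s * norm (u x))\<^sup>2)}"

definition norm_L2 :: "real \<Rightarrow> (real \<Rightarrow> complex) \<Rightarrow> real" where
  "norm_L2 s u = sqrt (LINT x|lborel. (japanese x powr s * norm (u x))\<^sup>2)"

definition L_infinity :: "(real \<Rightarrow> complex) set" where
  "L_infinity = {u \<in> borel_measurable lborel. \<exists>C. AE x in lborel. norm (u x) \<le> C}"


definition vderiv :: "nat \<Rightarrow> (real \<Rightarrow> complex) \<Rightarrow> real \<Rightarrow> complex" where
  "vderiv k f = ((\<lambda>g x. vector_derivative g (at x)) ^^ k) f"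

definition times_differentiable :: "nat \<Rightarrow> (real \<Rightarrow> complex) \<Rightarrow> bool" where
  "times_differentiable k f \<longleftrightarrow> (\<forall>j<k. \<forall>x. vderiv j f differentiable (at x))"

definition test_function :: "(real \<Rightarrow> complex) \<Rightarrow> bool" where
  "test_function \<phi> \<longleftrightarrow> (\<forall>k. times_differentiable k \<phi>) \<and> compactly_supported \<phi>"

definition locally_integrable :: "(real \<Rightarrow> complex) \<Rightarrow> bool" where
  "locally_integrable u \<longleftrightarrow> (\<forall>K. compact K \<longrightarrow> set_integrable lborel K u)"

definition is_weak_deriv :: "nat \<Rightarrow> (real \<Rightarrow> complex) \<Rightarrow> (real \<Rightarrow> complex) \<Rightarrow> bool" where
  "is_weak_deriv k u v \<longleftrightarrow> locally_integrable u \<and> locally_integrable v \<and>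
     (\<forall>\<phi>. test_function \<phi> \<longrightarrow>
        (LINT x|lborel. u x * vderiv k \<phi> x) = (-1) ^ k * (LINT x|lborel. v x * \<phi> x))"

text \<open>A representative of the weak derivative, which is unique up to null sets where it exists.\<close>

definition weak_deriv :: "nat \<Rightarrow> (real \<Rightarrow> complex) \<Rightarrow> (real \<Rightarrow> complex)" where
  "weak_deriv k u = (SOME v. is_weak_deriv k u v)"

definition Sobolev_H :: "nat \<Rightarrow> (real \<Rightarrow> complex) set" where
  "Sobolev_H N = {u \<in> L2 0. \<forall>k\<le>N. \<exists>v \<in> L2 0. is_weak_deriv k u v}"


text \<open>The operator \<open>A + V\<close>, to be considered on the domain \<^term>\<open>Sobolev_H N\<close>.\<close>

definition op_AV :: "nat \<Rightarrow> (real \<Rightarrow> complex) \<Rightarrow> (real \<Rightarrow> complex) \<Rightarrow> (real \<Rightarrow> complex)" where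
  "op_AV N V u = (\<lambda>x. (- \<i>) ^ N * weak_deriv N u x + V x * u x)"


text \<open>Membership in \<open>\<B>(L\<^sup>2\<^sub>s, L\<^sup>2\<^sub>t)\<close>. Compatibility with almost everywhere equality
  follows from linearity together with boundedness.\<close>

definition bounded_op :: "real \<Rightarrow> real \<Rightarrow> ((real \<Rightarrow> complex) \<Rightarrow> (real \<Rightarrow> complex)) \<Rightarrow> bool" where
  "bounded_op s t T \<longleftrightarrow>
     (\<forall>f \<in> L2 s. T f \<in> L2 t) \<and>
     (\<forall>f \<in> L2 s. \<forall>g \<in> L2 s. \<forall>c. AE x in lborel. T (\<lambda>y. c * f y + g y) x = c * T f x + T g x) \<and>
     (\<exists>C. \<forall>f \<in> L2 s. norm_L2 t (T f) \<le> C * norm_L2 s f)"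

definition op_norm :: "real \<Rightarrow> real \<Rightarrow> ((real \<Rightarrow> complex) \<Rightarrow> (real \<Rightarrow> complex)) \<Rightarrow> ennreal" where
  "op_norm s t T = (SUP f \<in> {f \<in> L2 s. norm_L2 s f \<le> 1}. ennreal (norm_L2 t (T f)))"

text \<open>\<open>R\<close> is a bounded two-sided inverse in \<open>L\<^sup>2\<close> of \<open>A + V - z I\<close>.\<close>

definition is_resolvent ::
  "nat \<Rightarrow> (real \<Rightarrow> complex) \<Rightarrow> complex \<Rightarrow> ((real \<Rightarrow> complex) \<Rightarrow> (real \<Rightarrow> complex)) \<Rightarrow> bool" where
  "is_resolvent N V z R \<longleftrightarrow>
     bounded_op 0 0 R \<and>
     (\<forall>f \<in> L2 0. R f \<in> Sobolev_H N \<and>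
        (AE x in lborel. op_AV N V (R f) x - z * R f x = f x)) \<and>
     (\<forall>u \<in> Sobolev_H N. AE x in lborel. R (\<lambda>y. op_AV N V u y - z * u y) x = u x)"

definition resolvent_set :: "nat \<Rightarrow> (real \<Rightarrow> complex) \<Rightarrow> complex set" where
  "resolvent_set N V = {z. \<exists>R. is_resolvent N V z R}"

definition resolvent ::
  "nat \<Rightarrow> (real \<Rightarrow> complex) \<Rightarrow> complex \<Rightarrow> (real \<Rightarrow> complex) \<Rightarrow> (real \<Rightarrow> complex)" where
  "resolvent N V z = (SOME R. is_resolvent N V z R)"

text \<open>Convergence as \<open>z \<rightarrow> z\<^sub>0\<close>, \<open>z \<in> \<Omega>\<close>, in the uniform operator topology of
  \<open>\<B>(L\<^sup>2\<^sub>s, L\<^sup>2\<^sub>t)\<close>. It is meant for \<open>s \<ge> 0 \<ge> t\<close>, where \<open>L\<^sup>2\<^sub>s \<subseteq> L\<^sup>2 \<subseteq> L\<^sup>2\<^sub>t\<close> as sets of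
  functions, so that the embeddings are inclusions.\<close>

definition resolvent_converges ::
  "nat \<Rightarrow> (real \<Rightarrow> complex) \<Rightarrow> complex set \<Rightarrow> complex \<Rightarrow> real \<Rightarrow> real \<Rightarrow> bool" where
  "resolvent_converges N V \<Omega> z0 s t \<longleftrightarrow>
     (\<forall>\<^sub>F z in at z0 within \<Omega>. z \<in> resolvent_set N V) \<and>
     (\<exists>R0. bounded_op s t R0 \<and>
        ((\<lambda>z. op_norm s t (\<lambda>f x. resolvent N V z f x - R0 f x)) \<longlongrightarrow> 0) (at z0 within \<Omega>))"

text \<open>Classical solutions of \<open>((-i \<partial>\<^sub>x)\<^sup>N + V) \<Psi> = 0\<close>; since \<open>V\<close> is continuous, these are
  exactly the distributional solutions, up to the choice of a representative.\<close>

definition is_solution :: "nat \<Rightarrow> (real \<Rightarrow> complex) \<Rightarrow> (real \<Rightarrow> complex) \<Rightarrow> bool" where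
  "is_solution N V \<Psi> \<longleftrightarrow> times_differentiable N \<Psi> \<and>
     (\<forall>x. (- \<i>) ^ N * vderiv N \<Psi> x + V x * \<Psi> x = 0)"

end

theory Submission
  imports Defs
begin

text \<open>
  For \<open>N = 3\<close> the operator is \<open>\<i> \<partial>\<^sup>3 + V\<close>, and \<open>(A + V - z) u = f\<close> reads \<open>u''' = (\<i> V + \<mu>\<^sup>3) u - \<i> f\<close> with \<open>\<mu>\<^sup>3 = - \<i> z\<close>.
  If \<open>Im z > 0\<close>, let \<open>\<mu>\<close> be the principal cube root. Outside the support \<open>[-a, a]\<close> of \<open>V\<close> the solutions are
  combinations of exponentials with the exponents \<open>\<mu>\<close>, of positive real part, and \<open>\<mu> \<omega>\<close>, \<open>\<mu> \<omega>\<^sup>2\<close>, of negative real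
  part. Hence one solution \<open>\<gamma>\<close>, up to a factor, decays at \<open>-\<infinity>\<close>, and two decay at \<open>+\<infinity>\<close>. The quantity
  \<open>u'' + \<mu> u' + \<mu>\<^sup>2 u\<close>, taken to the right of the support, measures the growing component of \<open>u\<close>. Let \<open>W(\<mu>)\<close> be its value
  for \<open>u = \<gamma>\<close> at \<open>a\<close>. Both \<open>\<gamma>\<close> and \<open>W\<close> make sense at \<open>\<mu> = 0\<close> and are continuous there, and the
  alternative of the theorem is whether \<open>W(0)\<close> vanishes.

  If \<open>W(0) = 0\<close>, then \<open>\<Psi> = \<gamma>\<close> at \<open>\<mu> = 0\<close> is equal to \<open>1\<close> on the left and, as \<open>\<gamma>''\<close> is constant and equal to \<open>W(0)\<close> on
  the right, affine there (lemma \<open>resonance\<close>).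

  If \<open>W(0) \<noteq> 0\<close>, then for small \<open>\<mu>\<close> the Green kernel is \<open>K(x, t) = \<gamma>(x) \<delta>(t) / W - 1\<^bsub>t < x\<^esub> S(x, t)\<close>, where \<open>S(\<cdot>, t)\<close>
  is the Cauchy solution at \<open>t\<close> and \<open>\<delta>(t)\<close> its growing component. It converges pointwise as \<open>\<mu>\<close> tends to
  \<open>0\<close>, and the work lies in one estimate (lemma \<open>kernel_le\<close>),
  \<open>\<bar>K(x, t)\<bar> \<le> C p(\<bar>x\<bar>) p(\<bar>t\<bar>) e\<^bsup>-\<alpha> \<bar>x - t\<bar>\<^esup>\<close> with \<open>p(t) = 1 + \<integral>\<^sub>0\<^sup>t e\<^bsup>-\<alpha> s\<^esup> ds\<close>, in which \<open>C\<close> depends neither on \<open>\<mu>\<close> nor on \<open>\<alpha>\<close>. It is used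
  twice. For fixed \<open>z\<close> and a suitable \<open>\<alpha> > 0\<close> it gives exponential decay. Therefore \<open>\<i> K\<close> is the kernel of a
  bounded operator on \<open>L\<^sup>2\<close>, which maps into \<open>H\<^sup>3\<close> and inverts \<open>A + V - z\<close> from the right. It also
  inverts it from the left, since a square integrable solution of the homogeneous equation would be
  a multiple of \<open>\<gamma>\<close> without growing component (lemma \<open>equation_unique\<close>). For \<open>\<alpha> = 0\<close> it gives
  \<open>\<bar>K(x, t)\<bar> \<le> C (1 + \<bar>x\<bar>) (1 + \<bar>t\<bar>)\<close> uniformly in \<open>\<mu>\<close>. As \<open>s, s' > 3/2\<close>, the weighted kernels are dominated by a
  square integrable function of \<open>(x, t)\<close>, so they converge in the Hilbert-Schmidt norm and the
  resolvents converge in the operator norm (lemma \<open>regular_case\<close>).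
\<close>

section \<open>Linear differential equations of third order\<close>

lemma exists_antiderivative:
  fixes f :: "real \<Rightarrow> 'a::euclidean_space"
  assumes "continuous_on UNIV f"
  shows "\<exists>F. F b = 0 \<and> (\<forall>x. (F has_vector_derivative f x) (at x))"
proof -
  let ?F = "\<lambda>u::real. LBINT y=b..u. f y"
  have "(?F has_vector_derivative f x) (at x)" for x
  proof -
  define l r where "l = min b x - 1" and "r = max b x + 1"
  have "(?F has_vector_derivative f x) (at x within {l..r})"
    by (rule interval_integral_FTC2) (use assms in \<open>auto simp: l_def r_def intro: continuous_on_subset\<close>)
  moreover have "x \<in> interior {l..r}" by (auto simp: l_def r_def)
  ultimately show ?thesis
    using at_within_interior by metis
  qed
  then show ?thesis by (intro exI[of _ ?F]) auto
qed

lemma has_vector_derivative_reflect: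
  assumes "(F has_vector_derivative F') (at (- t))"
  shows "((\<lambda>t. F (- t)) has_vector_derivative - F') (at (t::real))"
proof -
  have "(uminus has_vector_derivative - 1) (at t)"
    unfolding has_real_derivative_iff_has_vector_derivative [symmetric]
    by (auto intro!: derivative_eq_intros)
  then show ?thesis
    using vector_diff_chain_at[of uminus "-1" t F F'] assms by (simp add: o_def)
qed

lemma antiderivative_power_bound:
  fixes F :: "real \<Rightarrow> 'a::euclidean_space"
  assumes F: "\<And>x. (F has_vector_derivative f x) (at x)" and "F b = 0"
    and f: "\<And>x. norm (f x) \<le> C * \<bar>x - b\<bar> ^ n"
  shows "norm (F x) \<le> C * \<bar>x - b\<bar> ^ Suc n / Suc n"
proof -
  have main: "norm (G x - G b) \<le> C * (x - b) ^ Suc n / Suc n"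
    if "b < x" and G: "\<And>x. (G has_vector_derivative g x) (at x)"
      and g: "\<And>x. b < x \<Longrightarrow> norm (g x) \<le> C * (x - b) ^ n" for G g :: "real \<Rightarrow> 'a" and b x :: real
  proof -
    let ?p = "\<lambda>t. C * (t - b) ^ Suc n / Suc n"
    have p: "(?p has_vector_derivative C * (t - b) ^ n) (at t)" for t
      unfolding has_real_derivative_iff_has_vector_derivative [symmetric]
      by (rule derivative_eq_intros refl | simp del: of_nat_Suc)+
    have "norm (G x - G b) \<le> ?p x - ?p b"
    proof (rule differentiable_bound_general [OF \<open>b < x\<close>])
      show "continuous_on {b..x} G"
        using G has_vector_derivative_continuous continuous_at_imp_continuous_on by blast
      show "continuous_on {b..x} ?p" by (intro continuous_intros) simp
    qed (use G p g in auto)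
    then show ?thesis by simp
  qed
  consider "x = b" | "b < x" | "x < b" by linarith
  then show ?thesis
  proof cases
    case 2
    then show ?thesis using main[of b x F f] F f \<open>F b = 0\<close>
      by (metis abs_of_pos diff_gt_0_iff_gt diff_zero)
  next
    case 3
    have "((\<lambda>t. F (- t)) has_vector_derivative - f (- t)) (at t)" for t
      by (rule has_vector_derivative_reflect[OF F])
    moreover have "norm (- f (- t)) \<le> C * (t - - b) ^ n" if "- b < t" for t
      using f[of "- t"] that by (simp add: abs_if add.commute)
    ultimately have "norm (F (- (- x)) - F (- (- b))) \<le> C * (- x - - b) ^ Suc n / Suc n"
      using 3 by (intro main[where g = "\<lambda>t. - f (- t)"]) auto
    then show ?thesis using 3 \<open>F b = 0\<close> by (simp add: abs_if)
  qed (use assms in auto)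
qed

text \<open>
  Picard iteration started at the constant \<open>c\<close>. The increments obey
  \<open>\<parallel>g\<^sub>n(x)\<parallel> \<le> \<parallel>c\<parallel> (K \<bar>x - b\<bar>)\<^sup>n / n!\<close>, so on bounded intervals their sum converges uniformly together
  with its derivative, and linearity turns the sum of the derivatives into \<open>A x (U x)\<close>.
\<close>

lemma linear_ode_exists:
  fixes A :: "real \<Rightarrow> 'a::euclidean_space \<Rightarrow> 'a"
  assumes lin: "\<And>x. bounded_linear (A x)"
    and bound: "\<And>x v. norm (A x v) \<le> K * norm v"
    and cont: "\<And>f. continuous_on UNIV f \<Longrightarrow> continuous_on UNIV (\<lambda>x. A x (f x))"
  shows "\<exists>U. U b = c \<and> (\<forall>x. (U has_vector_derivative A x (U x)) (at x))"
proof -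
  have "\<exists>J. \<forall>f::real \<Rightarrow> 'a. continuous_on UNIV f \<longrightarrow>
      J f b = 0 \<and> (\<forall>x. (J f has_vector_derivative f x) (at x))"
    using exists_antiderivative[of _ b] by (intro choice) blast
  then obtain J where J: "\<And>f::real \<Rightarrow> 'a. continuous_on UNIV f \<Longrightarrow> J f b = 0"
    "\<And>f::real \<Rightarrow> 'a. \<And>x. continuous_on UNIV f \<Longrightarrow> (J f has_vector_derivative f x) (at x)"
    by blast
  define g where "g = rec_nat (\<lambda>_. c) (\<lambda>n h. J (\<lambda>x. A x (h x)))"
  have g0: "g 0 = (\<lambda>_. c)" and gS: "\<And>n. g (Suc n) = J (\<lambda>x. A x (g n x))"
    by (simp_all add: g_def)
  have gc: "continuous_on UNIV (g n)" for n
  proof (induction n)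
    case (Suc n)
    show ?case unfolding gS
      using J(2)[OF cont[OF Suc]] has_vector_derivative_continuous continuous_at_imp_continuous_on
      by blast
  qed (simp add: g0)
  have gd: "(g (Suc n) has_vector_derivative A x (g n x)) (at x)" and gb: "g (Suc n) b = 0" for n x
    using J[OF cont[OF gc]] by (simp_all add: gS)
  have K: "0 \<le> K \<or> (\<forall>v::'a. v = 0)"
    by (metis bound linorder_not_le mult_neg_pos norm_not_less_zero zero_less_norm_iff order.strict_trans1)
  define K' where "K' = max K 0"
  have bound': "norm (A x v) \<le> K' * norm v" for x v
    using bound[of x v] mult_right_mono[of K K' "norm v"] by (simp add: K'_def) 
  have K': "0 \<le> K'" by (simp add: K'_def)
  have gbound: "norm (g n x) \<le> norm c * K' ^ n / fact n * \<bar>x - b\<bar> ^ n" for n x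
  proof (induction n arbitrary: x)
    case (Suc n)
    have "norm (g (Suc n) x) \<le> (K' * (norm c * K' ^ n / fact n)) * \<bar>x - b\<bar> ^ Suc n / Suc n"
    proof (rule antiderivative_power_bound[OF gd gb])
      fix x
      have "norm (A x (g n x)) \<le> K' * (norm c * K' ^ n / fact n * \<bar>x - b\<bar> ^ n)"
        using bound'[of x "g n x"] mult_left_mono[OF Suc[of x] K'] by linarith
      then show "norm (A x (g n x)) \<le> K' * (norm c * K' ^ n / fact n) * \<bar>x - b\<bar> ^ n"
        by (simp add: mult.assoc)
    qed
    then show ?case by (simp add: field_simps)
  qed (simp add: g0)
  have summ: "summable (\<lambda>n. norm c * (K' * L) ^ n / fact n)" for L
    using summable_mult[OF summable_exp[of "K' * L"], of "norm c"] by (simp add: field_simps)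
  have gL: "norm (g n x) \<le> norm c * (K' * L) ^ n / fact n" if "\<bar>x - b\<bar> \<le> L" for n x L
  proof -
    have "\<bar>x - b\<bar> ^ n \<le> L ^ n" by (rule power_mono) (use that in auto)
    then have "norm c * K' ^ n / fact n * \<bar>x - b\<bar> ^ n \<le> norm c * K' ^ n / fact n * L ^ n"
      by (intro mult_left_mono) (use K' in auto)
    then show ?thesis using gbound[of n x] by (simp add: power_mult_distrib)
  qed
  have gsum: "summable (\<lambda>n. g n x)" for x
    by (rule summable_comparison_test'[OF summ[of "\<bar>x - b\<bar>"], of 0]) (use gL in auto)
  define U where "U x = (\<Sum>n. g n x)" for x
  have Ud: "(U has_vector_derivative A x (U x)) (at x)" for x
  proof -
    define L where "L = \<bar>x - b\<bar> + 1"
    define S where "S = {b - L<..<b + L}"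
    have [simp]: "open S" "x \<in> S" "b \<in> S" "convex S" by (auto simp: S_def L_def)
    \<comment> \<open>the derivatives of the increments; the increment with index \<open>0\<close> is constant\<close>
    define g' where "g' n y = (case n of 0 \<Rightarrow> 0 | Suc m \<Rightarrow> A y (g m y))" for n y
    have g': "(g n has_vector_derivative g' n y) (at y)" for n y
      by (cases n) (auto simp: g'_def g0 gd)
    have unif: "uniform_limit S (\<lambda>n y. \<Sum>i<n. A y (g i y)) (\<lambda>y. \<Sum>i. A y (g i y)) sequentially"
    proof (rule Weierstrass_m_test)
      show "summable (\<lambda>n. K' * (norm c * (K' * L) ^ n / fact n))" by (intro summable_mult summ)
      fix n y assume "y \<in> S"
      then have "norm (g n y) \<le> norm c * (K' * L) ^ n / fact n"
        by (intro gL) (auto simp: S_def)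
      then show "norm (A y (g n y)) \<le> K' * (norm c * (K' * L) ^ n / fact n)"
        using bound'[of y "g n y"] K' mult_left_mono by fastforce
    qed
    have eq: "(\<Sum>i. A y (g i y)) = A y (U y)" for y
      unfolding U_def using bounded_linear.suminf[OF lin gsum, of y] by (simp add: U_def)
    have sum_g': "(\<Sum>i<Suc n. g' i y) = (\<Sum>i<n. A y (g i y))" for n y
      by (induction n) (auto simp: g'_def)
    have "\<exists>h. \<forall>y\<in>S. (\<lambda>n. g n y) sums h y \<and> (h has_derivative (\<lambda>k. k *\<^sub>R A y (U y))) (at y within S)"
    proof (rule has_derivative_series)
      show "(g n has_derivative (\<lambda>k. k *\<^sub>R g' n y)) (at y within S)" for n y
        using g'[of n y] has_derivative_at_withinI by (auto simp: has_vector_derivative_def)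
      fix e :: real assume "e > 0"
      then have "\<forall>\<^sub>F n in sequentially. \<forall>y\<in>S. dist (\<Sum>i<n. A y (g i y)) (A y (U y)) < e"
        using unif unfolding uniform_limit_iff eq by blast
      then have "\<forall>\<^sub>F n in sequentially. \<forall>y\<in>S. dist (\<Sum>i<Suc n. g' i y) (A y (U y)) < e"
        unfolding sum_g' .
      then have "\<forall>\<^sub>F n in sequentially. \<forall>y\<in>S. dist (\<Sum>i<n. g' i y) (A y (U y)) < e"
        by (subst (asm) eventually_sequentially_Suc)
      then show "\<forall>\<^sub>F n in sequentially. \<forall>y\<in>S. \<forall>k. norm ((\<Sum>i<n. k *\<^sub>R g' i y) - k *\<^sub>R A y (U y)) \<le> e * norm k"
      proof (rule eventually_mono, intro ballI allI)
        fix n y k assume "\<forall>y\<in>S. dist (\<Sum>i<n. g' i y) (A y (U y)) < e" "y \<in> S"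
        then have "norm ((\<Sum>i<n. g' i y) - A y (U y)) \<le> e" by (auto simp: dist_norm less_imp_le)
        then have "\<bar>k\<bar> * norm ((\<Sum>i<n. g' i y) - A y (U y)) \<le> \<bar>k\<bar> * e"
          by (intro mult_left_mono) auto
        then show "norm ((\<Sum>i<n. k *\<^sub>R g' i y) - k *\<^sub>R A y (U y)) \<le> e * norm k"
          by (simp flip: scaleR_sum_right scaleR_diff_right add: mult.commute)
      qed
    next
      show "(\<lambda>n. g n b) sums U b" unfolding U_def using gsum by (rule summable_sums)
    qed auto
    then obtain h where h: "\<And>y. y \<in> S \<Longrightarrow> (\<lambda>n. g n y) sums h y"
      "\<And>y. y \<in> S \<Longrightarrow> (h has_derivative (\<lambda>k. k *\<^sub>R A y (U y))) (at y within S)" by blast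
    have "h y = U y" if "y \<in> S" for y using h(1)[OF that] unfolding U_def by (simp add: sums_iff)
    moreover have "(h has_vector_derivative A x (U x)) (at x)"
      using h(2)[of x] at_within_open[of x S] by (simp add: has_vector_derivative_def)
    ultimately show ?thesis
      using has_vector_derivative_transform_within_open[of h _ x S U] by simp
  qed
  moreover have "U b = c"
  proof -
    have "(\<lambda>n. g n b) sums (\<Sum>n<Suc 0. g n b)"
    proof (rule sums_finite)
      fix n assume "n \<notin> {..<Suc 0}"
      then show "g n b = 0" using gb[of "n - 1"] by (cases n) auto
    qed auto
    then show ?thesis unfolding U_def by (simp add: sums_iff g0)
  qed
  ultimately show ?thesis by blast
qed

text \<open>
  A solution of \<open>u''' = q u\<close> is carried together with its first two derivatives, because every
  argument below (uniqueness, energy, boundary conditions) uses the whole jet.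
\<close>

definition jet_sol where
  "jet_sol q u u1 u2 \<longleftrightarrow>
     (\<forall>x. (u has_vector_derivative u1 x) (at x)) \<and> (\<forall>x. (u1 has_vector_derivative u2 x) (at x)) \<and>
     (\<forall>x::real. (u2 has_vector_derivative q x * (u x :: complex)) (at x))"

lemma jet_solD:
  assumes "jet_sol q u u1 u2"
  shows "(u has_vector_derivative u1 x) (at x)" "(u1 has_vector_derivative u2 x) (at x)"
    "(u2 has_vector_derivative q x * u x) (at x)"
  using assms by (auto simp: jet_sol_def)

lemma jet_sol_continuous:
  assumes "jet_sol q u u1 u2"
  shows "continuous_on S u" "continuous_on S u1" "continuous_on S u2"
  by (auto intro!: continuous_at_imp_continuous_on
      intro: has_vector_derivative_continuous jet_solD[OF assms])

lemma jet_sol_add: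
  assumes "jet_sol q u u1 u2" "jet_sol q v v1 v2"
  shows "jet_sol q (\<lambda>x. u x + v x) (\<lambda>x. u1 x + v1 x) (\<lambda>x. u2 x + v2 x)"
  using assms unfolding jet_sol_def
  by (auto intro!: derivative_eq_intros simp: algebra_simps)

lemma jet_sol_cmult:
  assumes "jet_sol q u u1 u2"
  shows "jet_sol q (\<lambda>x. c * u x) (\<lambda>x. c * u1 x) (\<lambda>x. c * u2 x)"
  using assms unfolding jet_sol_def
  by (auto intro!: derivative_eq_intros simp: algebra_simps)

lemma jet_sol_diff:
  assumes "jet_sol q u u1 u2" "jet_sol q v v1 v2"
  shows "jet_sol q (\<lambda>x. u x - v x) (\<lambda>x. u1 x - v1 x) (\<lambda>x. u2 x - v2 x)"
  using jet_sol_add[OF assms(1) jet_sol_cmult[OF assms(2), of "-1"]] by simp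

lemma jet_sol_exists:
  assumes "continuous_on UNIV q" and "\<And>x. norm (q x) \<le> M"
  shows "\<exists>u u1 u2. jet_sol q u u1 u2 \<and> u b = c0 \<and> u1 b = c1 \<and> u2 b = c2"
proof -
  define A :: "real \<Rightarrow> complex \<times> complex \<times> complex \<Rightarrow> complex \<times> complex \<times> complex"
    where "A x v = (fst (snd v), snd (snd v), q x * fst v)" for x v
  have M: "0 \<le> M" using assms(2)[of 0] norm_ge_zero order_trans by blast
  have "\<exists>U. U b = (c0, c1, c2) \<and> (\<forall>x. (U has_vector_derivative A x (U x)) (at x))"
  proof (rule linear_ode_exists[where K = "2 + M"])
    show "bounded_linear (A x)" for x unfolding A_def
      by (intro bounded_linear_Pair bounded_linear_intros bounded_linear_const_mult
          bounded_linear_compose[OF bounded_linear_fst] bounded_linear_compose[OF bounded_linear_snd])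
    fix x v
    have "norm (A x v) \<le> norm (fst (snd v)) + (norm (snd (snd v)) + norm (q x * fst v))"
      unfolding A_def by (rule order_trans[OF norm_Pair_le add_left_mono[OF norm_Pair_le]])
    also have "\<dots> \<le> norm v + (norm v + M * norm v)"
    proof (intro add_mono)
      have v: "norm (fst (snd v)) \<le> norm (snd v)" "norm (snd (snd v)) \<le> norm (snd v)"
        "norm (snd v) \<le> norm v" "norm (fst v) \<le> norm v"
        by (metis norm_fst_le norm_snd_le prod.collapse)+
      show "norm (fst (snd v)) \<le> norm v" "norm (snd (snd v)) \<le> norm v" using v by linarith+
      show "norm (q x * fst v) \<le> M * norm v"
        unfolding norm_mult by (intro mult_mono assms v M) auto
    qed
    finally show "norm (A x v) \<le> (2 + M) * norm v" by (simp add: algebra_simps)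
  next
    fix f :: "real \<Rightarrow> complex \<times> complex \<times> complex" assume "continuous_on UNIV f"
    then show "continuous_on UNIV (\<lambda>x. A x (f x))"
      unfolding A_def by (intro continuous_intros assms)
  qed
  then obtain U where U: "U b = (c0, c1, c2)" "\<And>x. (U has_vector_derivative A x (U x)) (at x)"
    by blast
  have "jet_sol q (\<lambda>x. fst (U x)) (\<lambda>x. fst (snd (U x))) (\<lambda>x. snd (snd (U x)))"
    unfolding jet_sol_def
  proof (intro conjI allI)
    fix x
    have 1: "((\<lambda>x. fst (U x)) has_vector_derivative fst (A x (U x))) (at x)"
      and 2: "((\<lambda>x. snd (U x)) has_vector_derivative snd (A x (U x))) (at x)"
      using bounded_linear.has_vector_derivative[OF bounded_linear_fst U(2)[of x]]
        bounded_linear.has_vector_derivative[OF bounded_linear_snd U(2)[of x]] by simp_all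
    show "((\<lambda>x. fst (U x)) has_vector_derivative fst (snd (U x))) (at x)"
      using 1 by (simp add: A_def)
    show "((\<lambda>x. fst (snd (U x))) has_vector_derivative snd (snd (U x))) (at x)"
      "((\<lambda>x. snd (snd (U x))) has_vector_derivative q x * fst (U x)) (at x)"
      using bounded_linear.has_vector_derivative[OF bounded_linear_fst 2]
        bounded_linear.has_vector_derivative[OF bounded_linear_snd 2] by (simp_all add: A_def)
  qed
  with U(1) show ?thesis by (intro exI[of _ "\<lambda>x. fst (U x)"] exI[of _ "\<lambda>x. fst (snd (U x))"]
      exI[of _ "\<lambda>x. snd (snd (U x))"]) simp
qed

definition energy where
  "energy u u1 u2 x = (norm (u x))\<^sup>2 + (norm (u1 x))\<^sup>2 + (norm (u2 (x::real) :: complex))\<^sup>2"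
  for u u1 :: "real \<Rightarrow> complex"

lemma has_real_derivative_norm_square:
  fixes u :: "real \<Rightarrow> complex"
  assumes "(u has_vector_derivative u') (at x)"
  shows "((\<lambda>x. (norm (u x))\<^sup>2) has_real_derivative 2 * (u x \<bullet> u')) (at x)"
proof -
  have "((\<lambda>x. u x \<bullet> u x) has_derivative (\<lambda>h. u x \<bullet> (h *\<^sub>R u') + (h *\<^sub>R u') \<bullet> u x)) (at x)"
    using assms unfolding has_vector_derivative_def by (intro has_derivative_inner)
  then show ?thesis
    unfolding has_field_derivative_def power2_norm_eq_inner
    by (rule has_derivative_eq_rhs) (simp add: fun_eq_iff inner_commute algebra_simps)
qed

lemma inner_le_half_squares: "2 * (x \<bullet> y) \<le> (norm x)\<^sup>2 + (norm y)\<^sup>2"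
  for x y :: "'a::real_inner"
proof -
  have "0 \<le> (norm (x - y))\<^sup>2" by simp
  then show ?thesis by (simp add: power2_norm_eq_inner algebra_simps inner_commute)
qed

text \<open>
  The energy has derivative at most \<open>(2 + M)\<close> times itself plus \<open>\<epsilon>\<^sup>2\<close>, by \<open>2 x \<bullet> y \<le> \<bar>x\<bar>\<^sup>2 + \<bar>y\<bar>\<^sup>2\<close>.
  The inhomogeneity \<open>r\<close> is there to compare solutions for two different coefficients.
\<close>

lemma energy_bound_forward:
  fixes u u1 u2 r :: "real \<Rightarrow> complex"
  assumes "b \<le> x" and M: "\<And>t. t \<in> {b..x} \<Longrightarrow> norm (q t) \<le> M"
    and e: "\<And>t. t \<in> {b..x} \<Longrightarrow> norm (r t) \<le> \<epsilon>"
    and d: "\<And>t. t \<in> {b..x} \<Longrightarrow> (u has_vector_derivative u1 t) (at t)"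
      "\<And>t. t \<in> {b..x} \<Longrightarrow> (u1 has_vector_derivative u2 t) (at t)"
      "\<And>t. t \<in> {b..x} \<Longrightarrow> (u2 has_vector_derivative q t * u t + r t) (at t)"
  shows "energy u u1 u2 x + \<epsilon>\<^sup>2 \<le> (energy u u1 u2 b + \<epsilon>\<^sup>2) * exp ((2 + M) * (x - b))"
proof -
  let ?E = "energy u u1 u2"
  let ?h = "\<lambda>t. (?E t + \<epsilon>\<^sup>2) * exp (- (2 + M) * (t - b))"
  let ?E' = "\<lambda>t. 2 * (u t \<bullet> u1 t) + 2 * (u1 t \<bullet> u2 t) + 2 * (u2 t \<bullet> (q t * u t + r t))"
  have M0: "0 \<le> M" using order_trans[OF norm_ge_zero M[of b]] \<open>b \<le> x\<close> by simp
  have "?h x \<le> ?h b"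
  proof (rule DERIV_nonpos_imp_nonincreasing[OF \<open>b \<le> x\<close>], intro exI conjI)
    fix t assume "b \<le> t" "t \<le> x"
    then have t: "t \<in> {b..x}" by simp
    have E: "(?E has_real_derivative ?E' t) (at t)"
      unfolding energy_def by (intro DERIV_add has_real_derivative_norm_square d t)
    show "(?h has_real_derivative
        (?E' t - (2 + M) * (?E t + \<epsilon>\<^sup>2)) * exp (- (2 + M) * (t - b))) (at t)"
      by (rule derivative_eq_intros E refl | simp add: algebra_simps)+
    have 1: "2 * (u t \<bullet> u1 t) \<le> (norm (u t))\<^sup>2 + (norm (u1 t))\<^sup>2"
      "2 * (u1 t \<bullet> u2 t) \<le> (norm (u1 t))\<^sup>2 + (norm (u2 t))\<^sup>2"
      "2 * (u2 t \<bullet> r t) \<le> (norm (u2 t))\<^sup>2 + (norm (r t))\<^sup>2"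
      by (rule inner_le_half_squares)+
    have r: "(norm (r t))\<^sup>2 \<le> \<epsilon>\<^sup>2" using e[OF t] by (intro power_mono) auto
    have "u2 t \<bullet> (q t * u t) \<le> norm (u2 t) * (norm (q t) * norm (u t))"
      using norm_cauchy_schwarz[of "u2 t" "q t * u t"] by (simp add: norm_mult)
    also have "\<dots> \<le> norm (u2 t) * (M * norm (u t))"
      by (intro mult_left_mono mult_right_mono M t) auto
    finally have "2 * (u2 t \<bullet> (q t * u t)) \<le> M * (2 * norm (u2 t) * norm (u t))" by (simp add: algebra_simps)
    also have "\<dots> \<le> M * ((norm (u2 t))\<^sup>2 + (norm (u t))\<^sup>2)"
      using sum_squares_bound[of "norm (u2 t)" "norm (u t)"] by (intro mult_left_mono M0) simp
    finally have "2 * (u2 t \<bullet> (q t * u t)) \<le> M * ((norm (u2 t))\<^sup>2 + (norm (u t))\<^sup>2)" .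
    moreover have "0 \<le> M * (norm (u1 t))\<^sup>2" "0 \<le> M * \<epsilon>\<^sup>2" using M0 by auto
    moreover have "0 \<le> (norm (u t))\<^sup>2" "0 \<le> \<epsilon>\<^sup>2" by auto
    ultimately have "?E' t \<le> (2 + M) * (?E t + \<epsilon>\<^sup>2)"
      using 1 r unfolding energy_def inner_add_right distrib_left distrib_right by linarith
    then show "(?E' t - (2 + M) * (?E t + \<epsilon>\<^sup>2)) * exp (- (2 + M) * (t - b)) \<le> 0"
      by (intro mult_nonpos_nonneg) auto
  qed
  then have "?h x * exp ((2 + M) * (x - b)) \<le> ?h b * exp ((2 + M) * (x - b))"
    by (rule mult_right_mono) simp
  moreover have "?h x * exp ((2 + M) * (x - b)) = ?E x + \<epsilon>\<^sup>2"
  proof -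
    have "exp (- (2 + M) * (x - b)) * exp ((2 + M) * (x - b)) = 1"
      by (simp flip: exp_add distrib_right)
    then show ?thesis by (simp only: mult.assoc mult_1_right)
  qed
  moreover have "?h b = ?E b + \<epsilon>\<^sup>2" by simp
  ultimately show ?thesis by metis
qed

text \<open>
  Towards the left, the reflected jet \<open>(u(-t), - u'(-t), u''(-t))\<close> has the same energy and solves an
  equation of the same type.
\<close>

lemma energy_bound:
  fixes u u1 u2 r :: "real \<Rightarrow> complex"
  assumes M: "\<And>t. t \<in> closed_segment b x \<Longrightarrow> norm (q t) \<le> M"
    and e: "\<And>t. t \<in> closed_segment b x \<Longrightarrow> norm (r t) \<le> \<epsilon>"
    and d: "\<And>t. t \<in> closed_segment b x \<Longrightarrow> (u has_vector_derivative u1 t) (at t)"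
      "\<And>t. t \<in> closed_segment b x \<Longrightarrow> (u1 has_vector_derivative u2 t) (at t)"
      "\<And>t. t \<in> closed_segment b x \<Longrightarrow> (u2 has_vector_derivative q t * u t + r t) (at t)"
  shows "energy u u1 u2 x + \<epsilon>\<^sup>2 \<le> (energy u u1 u2 b + \<epsilon>\<^sup>2) * exp ((2 + M) * \<bar>x - b\<bar>)"
proof (cases "b \<le> x")
  case True
  with assms energy_bound_forward[OF True, of q M r \<epsilon> u u1 u2] show ?thesis
    by (simp add: closed_segment_eq_real_ivl)
next
  case False
  have I: "closed_segment b x = {x..b}" using False by (simp add: closed_segment_eq_real_ivl)
  have "energy (\<lambda>t. u (- t)) (\<lambda>t. - u1 (- t)) (\<lambda>t. u2 (- t)) (- x) + \<epsilon>\<^sup>2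
    \<le> (energy (\<lambda>t. u (- t)) (\<lambda>t. - u1 (- t)) (\<lambda>t. u2 (- t)) (- b) + \<epsilon>\<^sup>2)
      * exp ((2 + M) * (- x - - b))"
  proof (rule energy_bound_forward)
    fix t assume "t \<in> {- b..- x}"
    then have t: "- t \<in> closed_segment b x" unfolding I by auto
    show "((\<lambda>t. u (- t)) has_vector_derivative - u1 (- t)) (at t)"
      by (rule has_vector_derivative_reflect[OF d(1)[OF t]])
    show "((\<lambda>t. - u1 (- t)) has_vector_derivative u2 (- t)) (at t)"
      using has_vector_derivative_minus[OF has_vector_derivative_reflect[OF d(2)[OF t]]] by simp
    show "((\<lambda>t. u2 (- t)) has_vector_derivative (- q (- t)) * u (- t) + (- r (- t))) (at t)"
      using has_vector_derivative_reflect[OF d(3)[OF t]] by simp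
    show "norm (- q (- t)) \<le> M" "norm (- r (- t)) \<le> \<epsilon>" using M[OF t] e[OF t] by simp_all
  qed (use False in auto)
  then show ?thesis using False by (simp add: energy_def)
qed

lemma norm_le_energy:
  assumes "energy u u1 u2 x \<le> J\<^sup>2" "0 \<le> J"
  shows "norm (u x) \<le> J" "norm (u1 x) \<le> J" "norm (u2 x) \<le> J"
proof -
  have "(norm (u x))\<^sup>2 \<le> J\<^sup>2" "(norm (u1 x))\<^sup>2 \<le> J\<^sup>2" "(norm (u2 x))\<^sup>2 \<le> J\<^sup>2"
    using assms(1) zero_le_power2[of "norm (u x)"] zero_le_power2[of "norm (u1 x)"]
      zero_le_power2[of "norm (u2 x)"] unfolding energy_def by linarith+
  then show "norm (u x) \<le> J" "norm (u1 x) \<le> J" "norm (u2 x) \<le> J"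
    using power2_le_imp_le[OF _ assms(2)] by blast+
qed

lemma jet_unique:
  fixes u u1 u2 :: "real \<Rightarrow> complex"
  assumes M: "\<And>t. t \<in> closed_segment b x \<Longrightarrow> norm (q t) \<le> M"
    and d: "\<And>t. t \<in> closed_segment b x \<Longrightarrow> (u has_vector_derivative u1 t) (at t)"
      "\<And>t. t \<in> closed_segment b x \<Longrightarrow> (u1 has_vector_derivative u2 t) (at t)"
      "\<And>t. t \<in> closed_segment b x \<Longrightarrow> (u2 has_vector_derivative q t * u t) (at t)"
    and 0: "u b = 0" "u1 b = 0" "u2 b = 0"
  shows "u x = 0" "u1 x = 0" "u2 x = 0"
proof -
  have "energy u u1 u2 x \<le> 0"
    using energy_bound[of b x q M "\<lambda>_. 0" 0 u u1 u2] M d 0 by (simp add: energy_def)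
  then show "u x = 0" "u1 x = 0" "u2 x = 0"
    using norm_le_energy[of u u1 u2 x 0] by auto
qed

section \<open>The free equation\<close>

text \<open>
  The free operator \<open>\<partial>\<^sup>3 - \<mu>\<^sup>3\<close> splits into three first-order factors, and all bounds for it come from
  this one-factor estimate: solve \<open>v' = l v + g\<close> by variation of constants and compare with
  \<open>\<integral> B'\<close>. Exponents \<open>\<rho> > Re l\<close> are needed for sources that decay more slowly than the solutions of
  \<open>v' = l v\<close>.
\<close>

lemma first_order_bound:
  fixes v g :: "real \<Rightarrow> complex" and B B' :: "real \<Rightarrow> real"
  assumes "b \<le> x" "Re l \<le> \<rho>"
    and v: "\<And>t. t \<in> {b..x} \<Longrightarrow> (v has_vector_derivative l * v t + g t) (at t)"
    and g: "\<And>t. t \<in> {b..x} \<Longrightarrow> norm (g t) \<le> exp (\<rho> * (t - b)) * B' t"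
    and B: "\<And>t. t \<in> {b..x} \<Longrightarrow> (B has_real_derivative B' t) (at t)"
  shows "norm (v x) \<le> exp (\<rho> * (x - b)) * (norm (v b) + (B x - B b))"
proof (cases "b = x")
  case False
  with \<open>b \<le> x\<close> have "b < x" by simp
  \<comment> \<open>the integrating factor removes the term \<open>l v\<close>\<close>
  define w where "w t = exp (- l * of_real (t - b)) * v t" for t
  define E where "E = exp ((\<rho> - Re l) * (x - b))"
  have e: "((\<lambda>t. exp (- l * of_real (t - b))) has_vector_derivative - l * exp (- l * of_real (t - b))) (at t)" for t
  proof -
    have "((\<lambda>z. exp (- l * (z - of_real b))) has_field_derivative - l * exp (- l * (of_real t - of_real b))) (at (of_real t))"
      by (auto intro!: derivative_eq_intros)
    from has_vector_derivative_real_field[OF this] show ?thesis by simp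
  qed
  have w: "(w has_vector_derivative exp (- l * of_real (t - b)) * g t) (at t)" if "t \<in> {b..x}" for t
    using has_vector_derivative_mult[OF e v[OF that]] unfolding w_def by (simp add: algebra_simps)
  have cont: "continuous_on {b..x} w"
    using has_vector_derivative_continuous[OF w] by (intro continuous_at_imp_continuous_on) blast
  have Bcont: "continuous_on {b..x} (\<lambda>t. E * B t)"
    using DERIV_isCont[OF B] by (intro continuous_on_mult_left continuous_at_imp_continuous_on) blast
  have "norm (w x - w b) \<le> E * B x - E * B b"
  proof (rule differentiable_bound_general[OF \<open>b < x\<close> cont Bcont])
    fix t assume "b < t" "t < x"
    then have t: "t \<in> {b..x}" by simp
    show "(w has_vector_derivative exp (- l * of_real (t - b)) * g t) (at t)" using w[OF t] .
    show "((\<lambda>t. E * B t) has_vector_derivative E * B' t) (at t)"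
      unfolding has_real_derivative_iff_has_vector_derivative[symmetric]
      by (intro DERIV_cmult B t)
    have "0 \<le> exp (\<rho> * (t - b)) * B' t" using g[OF t] norm_ge_zero order_trans by blast
    then have B'0: "0 \<le> B' t" by (simp add: zero_le_mult_iff)
    have "norm (exp (- l * of_real (t - b)) * g t) = exp (- Re l * (t - b)) * norm (g t)"
      by (simp add: norm_mult)
    also have "\<dots> \<le> exp (- Re l * (t - b)) * (exp (\<rho> * (t - b)) * B' t)"
      by (intro mult_left_mono g t) simp
    also have "\<dots> = exp ((\<rho> - Re l) * (t - b)) * B' t"
      by (simp add: algebra_simps flip: exp_add)
    also have "\<dots> \<le> E * B' t"
      unfolding E_def using \<open>t < x\<close> \<open>Re l \<le> \<rho>\<close> B'0 by (intro mult_right_mono) (auto intro!: mult_left_mono)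
    finally show "norm (exp (- l * of_real (t - b)) * g t) \<le> E * B' t" .
  qed
  then have wx: "norm (w x) \<le> norm (v b) + E * (B x - B b)"
    using norm_triangle_sub[of "w x" "w b"] by (simp add: w_def algebra_simps)
  have B_mono: "B b \<le> B x"
  proof (rule DERIV_nonneg_imp_nondecreasing[OF \<open>b \<le> x\<close>])
    fix t assume "b \<le> t" "t \<le> x"
    then have t: "t \<in> {b..x}" by simp
    have "0 \<le> exp (\<rho> * (t - b)) * B' t" using g[OF t] norm_ge_zero order_trans by blast
    then show "\<exists>y. (B has_real_derivative y) (at t) \<and> 0 \<le> y"
      using B[OF t] by (auto simp: zero_le_mult_iff)
  qed
  have "norm (v x) = exp (Re l * (x - b)) * norm (w x)"
    by (simp add: w_def norm_mult flip: mult.assoc exp_add)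
  also have "\<dots> \<le> exp (Re l * (x - b)) * norm (v b) + exp (Re l * (x - b)) * E * (B x - B b)"
    using mult_left_mono[OF wx, of "exp (Re l * (x - b))"] by (simp add: algebra_simps)
  also have "exp (Re l * (x - b)) * E = exp (\<rho> * (x - b))"
    by (simp add: E_def algebra_simps flip: exp_add)
  also have "exp (Re l * (x - b)) * norm (v b) \<le> exp (\<rho> * (x - b)) * norm (v b)"
    using \<open>b \<le> x\<close> \<open>Re l \<le> \<rho>\<close> by (intro mult_right_mono) (auto intro: mult_right_mono)
  finally show ?thesis by (simp add: algebra_simps)
qed simp

lemma first_order_homogeneous:
  fixes v :: "real \<Rightarrow> complex"
  assumes v: "\<And>t. t \<in> {b..x} \<Longrightarrow> (v has_vector_derivative l * v t) (at t)" and "b \<le> x"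
  shows "v x = exp (l * of_real (x - b)) * v b"
proof -
  have e: "((\<lambda>t. exp (l * of_real (t - b)) * v b) has_vector_derivative l * (exp (l * of_real (t - b)) * v b)) (at t)" for t
  proof -
    have "((\<lambda>z. exp (l * (z - of_real b)) * v b) has_field_derivative l * (exp (l * (of_real t - of_real b)) * v b)) (at (of_real t))"
      by (auto intro!: derivative_eq_intros)
    from has_vector_derivative_real_field[OF this] show ?thesis by simp
  qed
  have "norm (v x - exp (l * of_real (x - b)) * v b) \<le> exp (Re l * (x - b)) *
    (norm (v b - exp (l * of_real (b - b)) * v b) + (0 - 0))"
    by (rule first_order_bound[where B = "\<lambda>_. 0" and B' = "\<lambda>_. 0" and l = l and g = "\<lambda>_. 0"])
      (use has_vector_derivative_diff[OF v e] \<open>b \<le> x\<close> in \<open>auto simp: algebra_simps\<close>)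
  then show ?thesis by simp
qed

text \<open>
  This is \<open>1 + \<integral>\<^sub>0\<^sup>t e\<^bsup>-\<alpha> s\<^esup> ds\<close>. It allows one family of estimates to serve two purposes: for \<open>\<alpha> = 0\<close> it
  is \<open>1 + t\<close> and the estimates are uniform up to the threshold, while for \<open>\<alpha> > 0\<close> it is bounded and the
  estimates express exponential decay.
\<close>

definition moderate :: "real \<Rightarrow> real \<Rightarrow> real" where
  "moderate \<alpha> t = (if \<alpha> = 0 then 1 + t else 1 + (1 - exp (- \<alpha> * t)) / \<alpha>)"

lemma moderate_0 [simp]: "moderate \<alpha> 0 = 1"
  by (simp add: moderate_def)

lemma moderate_zero [simp]: "moderate 0 t = 1 + t"
  by (simp add: moderate_def)

lemma moderate_deriv: "(moderate \<alpha> has_real_derivative exp (- \<alpha> * t)) (at t)"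
proof -
  have "((\<lambda>t. if \<alpha> = 0 then 1 + t else 1 + (1 - exp (- \<alpha> * t)) / \<alpha>) has_real_derivative exp (- \<alpha> * t)) (at t)"
    by (cases "\<alpha> = 0") (auto intro!: derivative_eq_intros)
  then show ?thesis by (simp add: moderate_def[abs_def])
qed

lemma moderate_deriv_shift: "((\<lambda>t. moderate \<alpha> (t - b)) has_real_derivative exp (- \<alpha> * (t - b))) (at t)"
proof -
  have "((\<lambda>t. t - b) has_real_derivative 1) (at t)" by (auto intro!: derivative_eq_intros)
  from DERIV_chain2[OF moderate_deriv this] show ?thesis by simp
qed

lemma moderate_mono: "s \<le> t \<Longrightarrow> moderate \<alpha> s \<le> moderate \<alpha> t"
  by (rule DERIV_nonneg_imp_nondecreasing) (auto intro: moderate_deriv)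

lemma moderate_ge_1: "0 \<le> t \<Longrightarrow> 1 \<le> moderate \<alpha> t"
  using moderate_mono[of 0 t \<alpha>] by simp

lemma moderate_le_power2: "0 \<le> t \<Longrightarrow> moderate \<alpha> t \<le> (moderate \<alpha> t)\<^sup>2"
  using moderate_ge_1[of t \<alpha>] by (simp add: power2_eq_square)

lemma moderate_le:
  assumes "\<alpha> > 0" shows "moderate \<alpha> t \<le> 1 + 1 / \<alpha>"
  using assms by (simp add: moderate_def divide_right_mono)

lemma mult_exp_le_moderate:
  assumes "0 \<le> \<alpha>" "0 \<le> t"
  shows "t * exp (- \<alpha> * t) \<le> moderate \<alpha> t"
proof -
  have "moderate \<alpha> 0 - 0 * exp (- \<alpha> * 0) \<le> moderate \<alpha> t - t * exp (- \<alpha> * t)"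
  proof (rule DERIV_nonneg_imp_nondecreasing[OF \<open>0 \<le> t\<close>], intro exI conjI)
    fix s :: real assume "0 \<le> s"
    show "((\<lambda>s. moderate \<alpha> s - s * exp (- \<alpha> * s)) has_real_derivative \<alpha> * s * exp (- \<alpha> * s)) (at s)"
      by (rule derivative_eq_intros moderate_deriv refl | simp add: algebra_simps)+
    show "0 \<le> \<alpha> * s * exp (- \<alpha> * s)" using \<open>0 \<le> s\<close> \<open>0 \<le> \<alpha>\<close> by simp
  qed
  then show ?thesis by simp
qed

definition jet_le where
  "jet_le u u1 u2 x J \<longleftrightarrow> norm (u x) \<le> J \<and> norm (u1 x) \<le> J \<and> norm (u2 (x::real) :: complex) \<le> J"
  for u u1 :: "real \<Rightarrow> complex"

lemma jet_le_mono: "jet_le u u1 u2 x J \<Longrightarrow> J \<le> J' \<Longrightarrow> jet_le u u1 u2 x J'"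
  by (auto simp: jet_le_def)

lemma jet_le_cmult:
  assumes "jet_le u u1 u2 x J" "norm c \<le> C"
  shows "jet_le (\<lambda>x. c * u x) (\<lambda>x. c * u1 x) (\<lambda>x. c * u2 x) x (C * J)"
proof -
  have "0 \<le> C" using norm_ge_zero assms(2) by (rule order_trans)
  then show ?thesis using assms unfolding jet_le_def norm_mult by (auto intro!: mult_mono)
qed

lemma jet_le_diff:
  assumes "jet_le u u1 u2 x J" "jet_le v v1 v2 x J'"
  shows "jet_le (\<lambda>x. u x - v x) (\<lambda>x. u1 x - v1 x) (\<lambda>x. u2 x - v2 x) x (J + J')"
  using assms unfolding jet_le_def by (auto intro: order_trans[OF norm_triangle_ineq4] add_mono)

lemma jet_le_imp_norm_le:
  assumes "jet_le u u1 u2 x J" "norm c0 \<le> 1" "norm c1 \<le> 1"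
  shows "norm (u1 x - c0 * u x) \<le> 2 * J" "norm (u2 x + c1 * u1 x + c0 * u x) \<le> 3 * J"
proof -
  have 1: "norm (c * v) \<le> J" if "norm c \<le> 1" "norm v \<le> J" for c v :: complex
    using mult_mono[of "norm c" 1 "norm v" J] that by (simp add: norm_mult)
  show "norm (u1 x - c0 * u x) \<le> 2 * J"
    using norm_triangle_ineq4[of "u1 x" "c0 * u x"] 1[of c0 "u x"] assms by (auto simp: jet_le_def)
  show "norm (u2 x + c1 * u1 x + c0 * u x) \<le> 3 * J"
    using norm_triangle_ineq[of "u2 x + c1 * u1 x" "c0 * u x"] norm_triangle_ineq[of "u2 x" "c1 * u1 x"]
      1[of c0 "u x"] 1[of c1 "u1 x"] assms by (auto simp: jet_le_def)
qed

definition omega3 :: complex where "omega3 = cis (2 * pi / 3)"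

lemma omega3: "omega3 ^ 3 = 1" "norm omega3 = 1" "1 + omega3 + omega3\<^sup>2 = 0" "omega3 \<noteq> 1"
proof -
  show 3: "omega3 ^ 3 = 1" using Complex.DeMoivre[of "2 * pi / 3" 3] by (simp add: omega3_def)
  show "norm omega3 = 1" by (simp add: omega3_def)
  have "Re omega3 = - 1 / 2" by (simp add: omega3_def cos_120)
  then show ne: "omega3 \<noteq> 1" by auto
  have "(omega3 - 1) * (1 + omega3 + omega3\<^sup>2) = 0"
    using 3 by (simp add: algebra_simps power2_eq_square power3_eq_cube)
  with ne show "1 + omega3 + omega3\<^sup>2 = 0" by simp
qed

text \<open>
  With \<open>m, a, b\<close> the three cube roots of \<open>m\<^sup>3\<close>, this says that \<open>(\<partial> - a)(\<partial> - m) u\<close> is an eigenfunction of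
  \<open>\<partial>\<close> with eigenvalue \<open>b\<close> when \<open>u''' = m\<^sup>3 u\<close>.
\<close>

lemma factor_identity:
  fixes m a b u0 u1 u2 :: complex
  assumes "b = - m - a" "a * b = m\<^sup>2"
  shows "m ^ 3 * u0 - m * u2 - a * (u2 - m * u1) = b * (u2 - m * u1 - a * (u1 - m * u0))"
  using assms by algebra

text \<open>
  The exponents of \<open>u''' = \<mu>\<^sup>3 u\<close> are \<open>\<mu>\<close>, which grows to the right, and \<open>l1\<close>, \<open>l2\<close>, which decay
  at least at the rate \<open>2 \<alpha>\<close>. Half of this rate is given away to absorb the factor \<open>t\<close> that the nearly
  coinciding exponents \<open>l1\<close>, \<open>l2\<close> produce as \<open>\<mu>\<close> tends to zero.
\<close>

locale free_rates =
  fixes \<mu> :: complex and \<alpha> :: real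
  assumes alpha: "0 \<le> \<alpha>" and mu_le: "norm \<mu> \<le> 1"
    and rate1: "Re (\<mu> * omega3) \<le> - 2 * \<alpha>" and rate2: "Re (\<mu> * omega3\<^sup>2) \<le> - 2 * \<alpha>"
begin

abbreviation "l1 \<equiv> \<mu> * omega3"
abbreviation "l2 \<equiv> \<mu> * omega3\<^sup>2"
abbreviation "p \<equiv> moderate \<alpha>"

lemma roots: "\<mu> + l1 + l2 = 0" "l1 * l2 = \<mu>\<^sup>2" "l1 + l2 = - \<mu>"
proof -
  have "\<mu> + l1 + l2 = \<mu> * (1 + omega3 + omega3\<^sup>2)" by (simp add: algebra_simps)
  then show 1: "\<mu> + l1 + l2 = 0" by (simp add: omega3)
  have "l1 * l2 = \<mu>\<^sup>2 * omega3 ^ 3" by (simp add: power2_eq_square power3_eq_cube)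
  then show "l1 * l2 = \<mu>\<^sup>2" by (simp add: omega3)
  show "l1 + l2 = - \<mu>" using minus_unique[of \<mu> "l1 + l2"] 1 by (simp only: add.assoc)
qed

lemma norms: "norm l1 \<le> 1" "norm l2 \<le> 1" "norm (\<mu>\<^sup>2) \<le> 1" "norm (\<mu> ^ 3) \<le> 1"
  using mu_le by (auto simp: norm_mult norm_power omega3 power_le_one)

lemma kappa: "4 * \<alpha> \<le> Re \<mu>" "Re \<mu> \<le> 1" "\<alpha> \<le> 1" "0 \<le> Re \<mu>" "\<alpha> \<le> Re \<mu>"
proof -
  have "Re \<mu> = - Re l1 - Re l2" using arg_cong[OF roots(1), of Re] by simp
  then show 1: "4 * \<alpha> \<le> Re \<mu>" using rate1 rate2 by simp
  show 2: "Re \<mu> \<le> 1" using mu_le complex_Re_le_cmod order_trans by blast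
  show "\<alpha> \<le> 1" "0 \<le> Re \<mu>" "\<alpha> \<le> Re \<mu>" using 1 2 alpha by linarith+
qed

lemma exp_rate: "0 \<le> s \<Longrightarrow> exp (- \<alpha> * s) \<le> exp (Re \<mu> * s)"
  using mult_right_mono[of "- \<alpha>" "Re \<mu>" s] kappa alpha by simp

text \<open>
  Applying \<open>\<partial> - \<mu>\<close> removes the growing exponential, applying \<open>\<partial> - l1\<close> one of the decaying ones. The
  function \<open>h = (\<partial> - l1)(\<partial> - \<mu>) u\<close> is a multiple of a decaying exponential, and \<open>u' - \<mu> u\<close>, \<open>u' - l1 u\<close> and \<open>u\<close>
  are recovered from it by solving one first-order equation at a time. Each integration costs at
  most one factor \<open>p\<close>, with constants that do not depend on \<open>\<mu>\<close>.
\<close>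

lemma free_forward:
  fixes u u1 u2 :: "real \<Rightarrow> complex"
  assumes "b \<le> x"
    and d: "\<And>t. t \<in> {b..x} \<Longrightarrow> (u has_vector_derivative u1 t) (at t)"
      "\<And>t. t \<in> {b..x} \<Longrightarrow> (u1 has_vector_derivative u2 t) (at t)"
      "\<And>t. t \<in> {b..x} \<Longrightarrow> (u2 has_vector_derivative \<mu> ^ 3 * u t) (at t)"
    and J: "jet_le u u1 u2 b J"
  shows "norm (u1 x - \<mu> * u x) \<le> 8 * J * p (x - b) * exp (- \<alpha> * (x - b))"
    and "norm (u2 x - \<mu> * u1 x) \<le> 12 * J * p (x - b) * exp (- \<alpha> * (x - b))"
    and "norm (u1 x - l1 * u x) \<le> 4 * J * p (x - b) * exp (Re \<mu> * (x - b))"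
    and "jet_le u u1 u2 x (29 * J * (p (x - b))\<^sup>2 * exp (Re \<mu> * (x - b)))"
proof -
  have J0: "0 \<le> J" using J norm_ge_zero order_trans unfolding jet_le_def by blast
  define g where "g t = u1 t - \<mu> * u t" for t
  define g' where "g' t = u2 t - \<mu> * u1 t" for t
  define k where "k t = u1 t - l1 * u t" for t
  define h where "h t = g' t - l1 * g t" for t
  have l2: "l2 = - \<mu> - l1" using roots(3) by (simp add: algebra_simps eq_neg_iff_add_eq_0)
  have dg: "(g has_vector_derivative g' t) (at t)" if "t \<in> {b..x}" for t
    unfolding g_def g'_def by (intro has_vector_derivative_diff has_vector_derivative_mult_right d that)
  have dg': "(g' has_vector_derivative \<mu> ^ 3 * u t - \<mu> * u2 t) (at t)" if "t \<in> {b..x}" for t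
    unfolding g'_def by (intro has_vector_derivative_diff has_vector_derivative_mult_right d that)
  have dh: "(h has_vector_derivative l2 * h t) (at t)" if "t \<in> {b..x}" for t
  proof -
    have "(h has_vector_derivative \<mu> ^ 3 * u t - \<mu> * u2 t - l1 * g' t) (at t)"
      unfolding h_def by (intro has_vector_derivative_diff has_vector_derivative_mult_right dg dg' that)
    moreover have "\<mu> ^ 3 * u t - \<mu> * u2 t - l1 * g' t = l2 * h t"
      unfolding h_def g_def g'_def using factor_identity[OF l2 roots(2)] .
    ultimately show ?thesis by simp
  qed
  have dgh: "(g has_vector_derivative l1 * g t + h t) (at t)" if "t \<in> {b..x}" for t
    using dg[OF that] by (simp add: h_def)
  have du: "(u has_vector_derivative \<mu> * u t + g t) (at t)" if "t \<in> {b..x}" for t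
    using d(1)[OF that] by (simp add: g_def)
  have dk: "(k has_vector_derivative \<mu> * k t + h t) (at t)" if "t \<in> {b..x}" for t
  proof -
    have "(k has_vector_derivative u2 t - l1 * u1 t) (at t)"
      unfolding k_def by (intro has_vector_derivative_diff has_vector_derivative_mult_right d that)
    then show ?thesis by (simp add: h_def g_def g'_def k_def algebra_simps)
  qed
  have gb: "norm (g b) \<le> 2 * J" and g'b: "norm (g' b) \<le> 2 * J" and kb: "norm (k b) \<le> 2 * J"
  proof -
    show "norm (g b) \<le> 2 * J" "norm (k b) \<le> 2 * J"
      unfolding g_def k_def using jet_le_imp_norm_le(1)[OF J, of _ 0] mu_le norms by auto
    have "jet_le u1 u2 u2 b J" using J by (simp add: jet_le_def)
    from jet_le_imp_norm_le(1)[OF this, of \<mu> 0] show "norm (g' b) \<le> 2 * J"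
      unfolding g'_def using mu_le by auto
  qed
  have hb: "norm (h b) \<le> 4 * J"
  proof -
    have "norm (l1 * g b) \<le> 1 * (2 * J)"
      unfolding norm_mult[of l1] by (intro mult_mono norms gb) auto
    then show ?thesis using norm_triangle_ineq4[of "g' b" "l1 * g b"] g'b by (simp add: h_def)
  qed
  have h: "norm (h s) \<le> 4 * J * exp (- 2 * \<alpha> * (s - b))" if "s \<in> {b..x}" for s
  proof -
    have "norm (h s) \<le> exp (- 2 * \<alpha> * (s - b)) * (norm (h b) + (0 - 0))"
      by (rule first_order_bound[where l = l2 and g = "\<lambda>_. 0" and B = "\<lambda>_. 0" and B' = "\<lambda>_. 0"])
        (use that dh rate2 in auto)
    also have "\<dots> \<le> exp (- 2 * \<alpha> * (s - b)) * (4 * J)" using hb by (intro mult_left_mono) auto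
    finally show ?thesis by (simp add: mult.commute)
  qed
  have split: "exp (- 2 * \<alpha> * t) = exp (- \<alpha> * t) * exp (- \<alpha> * t)" for t
    by (simp flip: exp_add)
  have g: "norm (g s) \<le> 8 * J * p (s - b) * exp (- \<alpha> * (s - b))" if s: "s \<in> {b..x}" for s
  proof -
    have "norm (g s) \<le> exp (- 2 * \<alpha> * (s - b)) * (norm (g b) + (4 * J * s - 4 * J * b))"
    proof (rule first_order_bound[where l = l1 and g = h and B' = "\<lambda>_. 4 * J"])
      fix t assume "t \<in> {b..s}"
      then show "norm (h t) \<le> exp (- 2 * \<alpha> * (t - b)) * (4 * J)"
        "(g has_vector_derivative l1 * g t + h t) (at t)"
        using h[of t] dgh[of t] s by (auto simp: mult.commute)
    qed (use s rate1 in \<open>auto intro!: derivative_eq_intros\<close>)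
    also have "\<dots> \<le> exp (- 2 * \<alpha> * (s - b)) * (4 * J + 4 * J * (s - b))"
      using gb J0 by (intro mult_left_mono) (auto simp: algebra_simps)
    also have "\<dots> = 4 * J * (exp (- \<alpha> * (s - b)) + (s - b) * exp (- \<alpha> * (s - b))) * exp (- \<alpha> * (s - b))"
      unfolding split by (simp add: algebra_simps)
    also have "\<dots> \<le> 4 * J * (p (s - b) + p (s - b)) * exp (- \<alpha> * (s - b))"
    proof (intro mult_right_mono mult_left_mono add_mono)
      show "exp (- \<alpha> * (s - b)) \<le> p (s - b)"
        using s alpha by (intro order_trans[OF _ moderate_ge_1]) auto
      show "(s - b) * exp (- \<alpha> * (s - b)) \<le> p (s - b)"
        using s alpha by (intro mult_exp_le_moderate) auto
    qed (use J0 in auto)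
    finally show ?thesis by (simp add: algebra_simps)
  qed
  have px: "1 \<le> p (x - b)" using \<open>b \<le> x\<close> by (intro moderate_ge_1) auto
  have x: "x \<in> {b..x}" using \<open>b \<le> x\<close> by auto
  show 1: "norm (u1 x - \<mu> * u x) \<le> 8 * J * p (x - b) * exp (- \<alpha> * (x - b))"
    using g[OF x] by (simp add: g_def)
  show 2: "norm (u2 x - \<mu> * u1 x) \<le> 12 * J * p (x - b) * exp (- \<alpha> * (x - b))"
  proof -
    have "norm (g' x) \<le> norm (l1 * g x) + norm (h x)"
      using norm_triangle_ineq[of "l1 * g x" "h x"] by (simp add: h_def)
    also have "norm (l1 * g x) \<le> 1 * (8 * J * p (x - b) * exp (- \<alpha> * (x - b)))"
      unfolding norm_mult[of l1] by (intro mult_mono norms g x) auto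
    also have "norm (h x) \<le> 4 * J * exp (- 2 * \<alpha> * (x - b))" by (rule h[OF x])
    also have "\<dots> \<le> 4 * J * (p (x - b) * exp (- \<alpha> * (x - b)))"
    proof (intro mult_left_mono)
      show "exp (- 2 * \<alpha> * (x - b)) \<le> p (x - b) * exp (- \<alpha> * (x - b))"
        unfolding split using px alpha \<open>b \<le> x\<close> by (intro mult_right_mono order_trans[OF _ px]) auto
    qed (use J0 in auto)
    finally show ?thesis by (simp add: g'_def algebra_simps)
  qed
  show "norm (u1 x - l1 * u x) \<le> 4 * J * p (x - b) * exp (Re \<mu> * (x - b))"
  proof -
    have "norm (k x) \<le> exp (Re \<mu> * (x - b)) * (norm (k b) + (4 * J * p (x - b) - 4 * J * p (b - b)))"
    proof (rule first_order_bound[where l = \<mu> and g = h and B' = "\<lambda>t. 4 * J * exp (- \<alpha> * (t - b))"])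
      fix t assume t: "t \<in> {b..x}"
      show "(k has_vector_derivative \<mu> * k t + h t) (at t)" by (rule dk[OF t])
      show "((\<lambda>t. 4 * J * p (t - b)) has_real_derivative 4 * J * exp (- \<alpha> * (t - b))) (at t)"
        by (intro DERIV_cmult moderate_deriv_shift)
      have "exp (- \<alpha> * (t - b)) \<le> exp (Re \<mu> * (t - b))"
        using t by (intro exp_rate) auto
      then have "exp (- 2 * \<alpha> * (t - b)) \<le> exp (Re \<mu> * (t - b)) * exp (- \<alpha> * (t - b))"
        unfolding split by (intro mult_right_mono) auto
      then have "4 * J * exp (- 2 * \<alpha> * (t - b)) \<le> 4 * J * (exp (Re \<mu> * (t - b)) * exp (- \<alpha> * (t - b)))"
        using J0 by (intro mult_left_mono) auto
      then show "norm (h t) \<le> exp (Re \<mu> * (t - b)) * (4 * J * exp (- \<alpha> * (t - b)))"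
        using h[OF t] by (simp add: ac_simps)
    qed (use \<open>b \<le> x\<close> in auto)
    also have "\<dots> \<le> exp (Re \<mu> * (x - b)) * (4 * J * p (x - b))"
      using kb J0 by (intro mult_left_mono) auto
    finally show ?thesis by (simp add: k_def ac_simps)
  qed
  have u: "norm (u x) \<le> 9 * J * (p (x - b))\<^sup>2 * exp (Re \<mu> * (x - b))"
  proof -
    let ?P = "p (x - b)"
    have "norm (u x) \<le> exp (Re \<mu> * (x - b)) * (norm (u b) + (8 * J * ?P * p (x - b) - 8 * J * ?P * p (b - b)))"
    proof (rule first_order_bound[where l = \<mu> and g = g and B' = "\<lambda>t. 8 * J * ?P * exp (- \<alpha> * (t - b))"])
      fix t assume t: "t \<in> {b..x}"
      show "(u has_vector_derivative \<mu> * u t + g t) (at t)" by (rule du[OF t])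
      show "((\<lambda>t. 8 * J * ?P * p (t - b)) has_real_derivative 8 * J * ?P * exp (- \<alpha> * (t - b))) (at t)"
        by (intro DERIV_cmult moderate_deriv_shift)
      have "1 \<le> exp (Re \<mu> * (t - b))" using t kappa by simp
      moreover have "8 * J * p (t - b) * exp (- \<alpha> * (t - b)) \<le> 8 * J * ?P * exp (- \<alpha> * (t - b))"
        using t J0 by (intro mult_right_mono mult_left_mono moderate_mono) auto
      moreover have "0 \<le> 8 * J * ?P * exp (- \<alpha> * (t - b))" using J0 px by simp
      ultimately show "norm (g t) \<le> exp (Re \<mu> * (t - b)) * (8 * J * ?P * exp (- \<alpha> * (t - b)))"
        using g[OF t] by (smt (verit) mult_left_le_one_le mult_le_cancel_right1)
    qed (use \<open>b \<le> x\<close> in auto)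
    also have "\<dots> \<le> exp (Re \<mu> * (x - b)) * (J * ?P\<^sup>2 + 8 * J * ?P * ?P)"
    proof (intro mult_left_mono add_mono)
      have "J * 1 \<le> J * ?P\<^sup>2" using J0 px by (intro mult_left_mono) auto
      then show "norm (u b) \<le> J * ?P\<^sup>2" using J by (simp add: jet_le_def)
      show "8 * J * ?P * ?P - 8 * J * ?P * p (b - b) \<le> 8 * J * ?P * ?P" using J0 px by simp
    qed simp
    finally show ?thesis by (simp add: algebra_simps power2_eq_square)
  qed
  let ?Q = "(p (x - b))\<^sup>2 * exp (Re \<mu> * (x - b))"
  have Q: "p (x - b) * exp (- \<alpha> * (x - b)) \<le> ?Q"
  proof (intro mult_mono)
    show "p (x - b) \<le> (p (x - b))\<^sup>2" by (rule moderate_le_power2) (use \<open>b \<le> x\<close> in auto)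
    show "exp (- \<alpha> * (x - b)) \<le> exp (Re \<mu> * (x - b))"
      using \<open>b \<le> x\<close> by (intro exp_rate) auto
  qed auto
  have mul: "norm (\<mu> * v) \<le> norm v" for v
    using mult_right_mono[OF mu_le, of "norm v"] by (simp add: norm_mult)
  have JQ: "J * (p (x - b) * exp (- \<alpha> * (x - b))) \<le> J * ?Q" "0 \<le> J * ?Q"
    using mult_left_mono[OF Q J0] J0 by auto
  have u1: "norm (u1 x) \<le> 17 * (J * ?Q)"
  proof -
    have "norm (u1 x) \<le> norm (u1 x - \<mu> * u x) + norm (\<mu> * u x)" using norm_triangle_sub[of "u1 x" "\<mu> * u x"] by simp
    also have "\<dots> \<le> 8 * (J * ?Q) + 9 * (J * ?Q)"
      using 1 mul[of "u x"] u JQ by (intro add_mono) (simp_all add: mult.assoc)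
    finally show ?thesis by linarith
  qed
  have u2: "norm (u2 x) \<le> 29 * (J * ?Q)"
  proof -
    have "norm (u2 x) \<le> norm (u2 x - \<mu> * u1 x) + norm (\<mu> * u1 x)" using norm_triangle_sub[of "u2 x" "\<mu> * u1 x"] by simp
    also have "\<dots> \<le> 12 * (J * ?Q) + 17 * (J * ?Q)"
      using 2 mul[of "u1 x"] u1 JQ by (intro add_mono) (simp_all add: mult.assoc)
    finally show ?thesis by linarith
  qed
  show "jet_le u u1 u2 x (29 * J * (p (x - b))\<^sup>2 * exp (Re \<mu> * (x - b)))"
    unfolding jet_le_def using u u1 u2 JQ by (auto simp: mult.assoc)
qed

text \<open>
  The expression \<open>u'' + \<mu> u' + \<mu>\<^sup>2 u = (\<partial> - l1)(\<partial> - l2) u\<close> is the component of \<open>u\<close> along the growing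
  exponential. A solution is called outgoing where it vanishes.
\<close>

lemma free_outgoing_propagates:
  fixes u u1 u2 :: "real \<Rightarrow> complex"
  assumes "b \<le> x"
    and d: "\<And>t. t \<in> {b..x} \<Longrightarrow> (u has_vector_derivative u1 t) (at t)"
      "\<And>t. t \<in> {b..x} \<Longrightarrow> (u1 has_vector_derivative u2 t) (at t)"
      "\<And>t. t \<in> {b..x} \<Longrightarrow> (u2 has_vector_derivative \<mu> ^ 3 * u t) (at t)"
  shows "u2 x + \<mu> * u1 x + \<mu>\<^sup>2 * u x = exp (\<mu> * of_real (x - b)) * (u2 b + \<mu> * u1 b + \<mu>\<^sup>2 * u b)"
proof (rule first_order_homogeneous[of b x "\<lambda>t. u2 t + \<mu> * u1 t + \<mu>\<^sup>2 * u t", OF _ \<open>b \<le> x\<close>])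
  fix t assume t: "t \<in> {b..x}"
  have "((\<lambda>t. u2 t + \<mu> * u1 t + \<mu>\<^sup>2 * u t) has_vector_derivative \<mu> ^ 3 * u t + \<mu> * u2 t + \<mu>\<^sup>2 * u1 t) (at t)"
    by (intro has_vector_derivative_add has_vector_derivative_mult_right d t)
  then show "((\<lambda>t. u2 t + \<mu> * u1 t + \<mu>\<^sup>2 * u t) has_vector_derivative \<mu> * (u2 t + \<mu> * u1 t + \<mu>\<^sup>2 * u t)) (at t)"
    by (simp add: algebra_simps power2_eq_square power3_eq_cube)
qed

text \<open>
  Without the growing component the equation reduces to \<open>(\<partial> - l1)(\<partial> - l2) u = 0\<close>, and the bound is
  linear, rather than quadratic, in \<open>p\<close>.
\<close>

lemma free_outgoing_bound:
  fixes u u1 u2 :: "real \<Rightarrow> complex"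
  assumes "b \<le> x"
    and d: "\<And>t. t \<in> {b..x} \<Longrightarrow> (u has_vector_derivative u1 t) (at t)"
      "\<And>t. t \<in> {b..x} \<Longrightarrow> (u1 has_vector_derivative u2 t) (at t)"
      "\<And>t. t \<in> {b..x} \<Longrightarrow> (u2 has_vector_derivative \<mu> ^ 3 * u t) (at t)"
    and 0: "u2 b + \<mu> * u1 b + \<mu>\<^sup>2 * u b = 0"
    and J: "norm (u b) \<le> J0" "norm (u1 b - l1 * u b) \<le> J1"
  shows "jet_le u u1 u2 x (3 * (J0 + J1 * p (x - b)) * exp (- \<alpha> * (x - b)))"
proof -
  have J0: "0 \<le> J0" "0 \<le> J1" using J norm_ge_zero order_trans by blast+
  define k where "k t = u1 t - l1 * u t" for t
  have z: "u2 t = - \<mu> * u1 t - \<mu>\<^sup>2 * u t" if "t \<in> {b..x}" for t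
  proof -
    have "u2 t + \<mu> * u1 t + \<mu>\<^sup>2 * u t = 0"
      using free_outgoing_propagates[of b t u u1 u2] that d 0 by simp
    then show ?thesis by (simp add: add_eq_0_iff2 algebra_simps)
  qed
  have l2: "- \<mu> = l1 + l2" using roots(3) by simp
  have dk: "(k has_vector_derivative l2 * k t) (at t)" if t: "t \<in> {b..x}" for t
  proof -
    have "(k has_vector_derivative u2 t - l1 * u1 t) (at t)"
      unfolding k_def by (intro has_vector_derivative_diff has_vector_derivative_mult_right d t)
    also have "u2 t - l1 * u1 t = l2 * k t"
      unfolding z[OF t] k_def l2 roots(2)[symmetric] by (simp add: algebra_simps)
    finally show ?thesis .
  qed
  have k: "norm (k s) \<le> exp (- 2 * \<alpha> * (s - b)) * J1" if "s \<in> {b..x}" for s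
  proof -
    have "norm (k s) \<le> exp (- 2 * \<alpha> * (s - b)) * (norm (k b) + (0 - 0))"
      by (rule first_order_bound[where l = l2 and g = "\<lambda>_. 0" and B = "\<lambda>_. 0" and B' = "\<lambda>_. 0"])
        (use that dk rate2 in auto)
    also have "\<dots> \<le> exp (- 2 * \<alpha> * (s - b)) * J1" using J by (intro mult_left_mono) (auto simp: k_def)
    finally show ?thesis .
  qed
  let ?e = "exp (- \<alpha> * (x - b))"
  have split: "exp (- 2 * \<alpha> * t) = exp (- \<alpha> * t) * exp (- \<alpha> * t)" for t
    by (simp flip: exp_add)
  have px: "1 \<le> p (x - b)" using \<open>b \<le> x\<close> by (intro moderate_ge_1) auto
  have e1: "?e \<le> 1" using \<open>b \<le> x\<close> alpha by simp
  have x: "x \<in> {b..x}" using \<open>b \<le> x\<close> by auto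
  have u: "norm (u x) \<le> (J0 + J1 * p (x - b)) * ?e"
  proof -
    have "norm (u x) \<le> exp (- 2 * \<alpha> * (x - b)) * (norm (u b) + (J1 * x - J1 * b))"
      by (rule first_order_bound[where l = l1 and g = k and B' = "\<lambda>_. J1"])
        (use \<open>b \<le> x\<close> rate1 k d(1) in \<open>auto intro!: derivative_eq_intros simp: k_def\<close>)
    also have "\<dots> \<le> exp (- 2 * \<alpha> * (x - b)) * (J0 + J1 * (x - b))"
      using J by (intro mult_left_mono) (auto simp: algebra_simps)
    also have "\<dots> = (J0 * ?e + J1 * ((x - b) * ?e)) * ?e" unfolding split by (simp add: algebra_simps)
    also have "\<dots> \<le> (J0 * 1 + J1 * p (x - b)) * ?e"
      using \<open>b \<le> x\<close> alpha
      by (intro mult_right_mono add_mono mult_left_mono mult_exp_le_moderate e1 J0) auto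
    finally show ?thesis by simp
  qed
  have k': "norm (k x) \<le> (J1 * p (x - b)) * ?e"
  proof -
    have "norm (k x) \<le> (J1 * ?e) * ?e" using k[OF x] unfolding split by (simp add: ac_simps)
    also have "\<dots> \<le> (J1 * p (x - b)) * ?e" using J0 by (intro mult_right_mono mult_left_mono order_trans[OF e1 px]) auto
    finally show ?thesis .
  qed
  have mul: "norm (c * v) \<le> norm v" if "norm c \<le> 1" for c v :: complex
    using mult_right_mono[OF that, of "norm v"] by (simp add: norm_mult)
  have u1: "norm (u1 x) \<le> (J0 + J1 * p (x - b)) * ?e + (J1 * p (x - b)) * ?e"
    using norm_triangle_ineq[of "k x" "l1 * u x"] mul[OF norms(1), of "u x"] u k' by (simp add: k_def)
  have "norm (u2 x) \<le> norm (u1 x) + norm (u x)"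
    using norm_triangle_ineq4[of "- \<mu> * u1 x" "\<mu>\<^sup>2 * u x"] z[OF x] mul[of "- \<mu>" "u1 x"] mul[OF norms(3), of "u x"] mu_le
    by simp
  moreover have "0 \<le> J0 * ?e" "0 \<le> J1 * p (x - b) * ?e" using J0 px by auto
  ultimately show ?thesis unfolding jet_le_def using u u1 by (auto simp: algebra_simps)
qed

end

section \<open>The Green kernel\<close>

text \<open>
  The potential is supported in \<open>[-a, a]\<close>. For every \<open>\<mu>\<close> the functions \<open>y \<mu> 0\<close>, \<open>y \<mu> 1\<close>, \<open>y \<mu> 2\<close> with their first and
  second derivatives \<open>y'\<close>, \<open>y''\<close> form the fundamental system of \<open>u''' = (\<i> V + \<mu>\<^sup>3) u\<close> with unit data at
  \<open>-a\<close>. With \<open>\<mu>\<^sup>3 = - \<i> z\<close> this is the equation \<open>(\<i> \<partial>\<^sup>3 + V - z) u = 0\<close>.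
\<close>

locale cubic_problem =
  fixes V :: "real \<Rightarrow> complex" and a M :: real
    and y y' y'' :: "complex \<Rightarrow> nat \<Rightarrow> real \<Rightarrow> complex"
  assumes a: "a > 0"
    and V_cont: "continuous_on UNIV V"
    and V_supp: "\<And>x. a \<le> \<bar>x\<bar> \<Longrightarrow> V x = 0"
    and V_le: "\<And>x. norm (V x) \<le> M"
    and fundamental: "\<And>\<mu> j. jet_sol (\<lambda>x. \<i> * V x + \<mu> ^ 3) (y \<mu> j) (y' \<mu> j) (y'' \<mu> j)"
    and initial: "\<And>\<mu> j. y \<mu> j (- a) = of_bool (j = 0)" "\<And>\<mu> j. y' \<mu> j (- a) = of_bool (j = 1)"
      "\<And>\<mu> j. y'' \<mu> j (- a) = of_bool (j = 2)"
begin

definition q :: "complex \<Rightarrow> real \<Rightarrow> complex" where "q \<mu> x = \<i> * V x + \<mu> ^ 3"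

lemma fund: "jet_sol (q \<mu>) (y \<mu> j) (y' \<mu> j) (y'' \<mu> j)"
  using fundamental by (simp add: q_def[abs_def])

lemma q_outside: "a \<le> \<bar>x\<bar> \<Longrightarrow> q \<mu> x = \<mu> ^ 3"
  by (simp add: q_def V_supp)

lemma q_cont: "continuous_on S (q \<mu>)"
  unfolding q_def[abs_def] by (intro continuous_intros continuous_on_subset[OF V_cont]) auto

lemma M: "0 \<le> M" using V_le[of 0] norm_ge_zero order_trans by blast

lemma q_le: "norm \<mu> \<le> 1 \<Longrightarrow> norm (q \<mu> x) \<le> M + 1"
  unfolding q_def
  by (rule order_trans[OF norm_triangle_ineq]) (auto simp: norm_mult norm_power V_le power_le_one intro!: add_mono)

text \<open>
  The cofactors of the second derivatives in the Wronskian determinant of the fundamental system.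
\<close>

definition cof :: "complex \<Rightarrow> nat \<Rightarrow> real \<Rightarrow> complex" where
  "cof \<mu> j t = (let k = (j + 1) mod 3; l = (j + 2) mod 3 in y \<mu> k t * y' \<mu> l t - y \<mu> l t * y' \<mu> k t)"

lemma cof_simps:
  "cof \<mu> 0 t = y \<mu> 1 t * y' \<mu> 2 t - y \<mu> 2 t * y' \<mu> 1 t"
  "cof \<mu> 1 t = y \<mu> 2 t * y' \<mu> 0 t - y \<mu> 0 t * y' \<mu> 2 t"
  "cof \<mu> 2 t = y \<mu> 0 t * y' \<mu> 1 t - y \<mu> 1 t * y' \<mu> 0 t"
  by (simp_all add: cof_def Let_def numeral_2_eq_2)

definition comb :: "(nat \<Rightarrow> complex) \<Rightarrow> (nat \<Rightarrow> real \<Rightarrow> complex) \<Rightarrow> real \<Rightarrow> complex" where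
  "comb c f x = c 0 * f 0 x + c 1 * f 1 x + c 2 * f 2 x"

lemma comb_sol: "jet_sol (q \<mu>) (comb c (y \<mu>)) (comb c (y' \<mu>)) (comb c (y'' \<mu>))"
  unfolding comb_def[abs_def] by (intro jet_sol_add jet_sol_cmult fund)

lemma comb_initial: "comb c (y \<mu>) (- a) = c 0" "comb c (y' \<mu>) (- a) = c 1" "comb c (y'' \<mu>) (- a) = c 2"
  by (simp_all add: comb_def initial)

text \<open>
  The Wronskian is constant since the equation has no term with \<open>u''\<close>.
\<close>

lemma wronskian: "comb (\<lambda>j. cof \<mu> j x) (y'' \<mu>) x = 1"
proof -
  let ?w = "\<lambda>x. comb (\<lambda>j. cof \<mu> j x) (y'' \<mu>) x"
  note d = jet_solD[OF fund]
  have "(?w has_vector_derivative 0) (at t)" for t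
    unfolding comb_def cof_simps
    by (rule has_vector_derivative_eq_rhs,
        (rule has_vector_derivative_add has_vector_derivative_diff has_vector_derivative_mult d)+)
      (simp add: algebra_simps)
  then have "?w x = ?w (- a)"
    using has_vector_derivative_zero_constant[of UNIV ?w] by (metis UNIV_I convex_UNIV)
  also have "\<dots> = 1" by (simp add: comb_def cof_simps initial)
  finally show ?thesis .
qed

lemma sol_eq_comb:
  assumes u: "jet_sol (q \<mu>) u u1 u2"
  defines "c \<equiv> (\<lambda>j::nat. if j = 0 then u (- a) else if j = 1 then u1 (- a) else u2 (- a))"
  shows "u x = comb c (y \<mu>) x" "u1 x = comb c (y' \<mu>) x" "u2 x = comb c (y'' \<mu>) x"
proof -
  have q: "norm (q \<mu> t) \<le> M + norm (\<mu> ^ 3)" for t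
    unfolding q_def by (rule order_trans[OF norm_triangle_ineq]) (auto simp: norm_mult V_le)
  note d = jet_sol_diff[OF u comb_sol[of \<mu> c]]
  show "u x = comb c (y \<mu>) x" "u1 x = comb c (y' \<mu>) x" "u2 x = comb c (y'' \<mu>) x"
    using jet_unique[of "- a" x "q \<mu>", OF q jet_solD[OF d]] by (simp_all add: comb_initial c_def)
qed

text \<open>
  \<open>S \<mu> t\<close> is the Cauchy solution with data \<open>(0, 0, 1)\<close> at \<open>t\<close>. Writing it through cofactors shows
  at once that it depends measurably on \<open>t\<close> and continuously on \<open>\<mu>\<close>.
\<close>

definition S where "S \<mu> t = comb (\<lambda>j. cof \<mu> j t) (y \<mu>)"
definition S' where "S' \<mu> t = comb (\<lambda>j. cof \<mu> j t) (y' \<mu>)"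
definition S'' where "S'' \<mu> t = comb (\<lambda>j. cof \<mu> j t) (y'' \<mu>)"

lemma S_sol: "jet_sol (q \<mu>) (S \<mu> t) (S' \<mu> t) (S'' \<mu> t)"
  unfolding S_def S'_def S''_def by (rule comb_sol)

lemma S_diag [simp]: "S \<mu> t t = 0" "S' \<mu> t t = 0" "S'' \<mu> t t = 1"
  using wronskian by (simp_all add: S_def S'_def S''_def comb_def cof_simps algebra_simps del: One_nat_def)

text \<open>
  The solution that decays at \<open>-\<infinity>\<close>, unique up to a factor when the other two cube roots of \<open>\<mu>\<^sup>3\<close> have
  negative real part; it is
  normalised by \<open>\<gamma> = e\<^bsup>\<mu> (x + a)\<^esup>\<close> to the left of the support.
\<close>

definition \<gamma> where "\<gamma> \<mu> = comb (\<lambda>j. \<mu> ^ j) (y \<mu>)"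
definition \<gamma>' where "\<gamma>' \<mu> = comb (\<lambda>j. \<mu> ^ j) (y' \<mu>)"
definition \<gamma>'' where "\<gamma>'' \<mu> = comb (\<lambda>j. \<mu> ^ j) (y'' \<mu>)"

lemma gamma_sol: "jet_sol (q \<mu>) (\<gamma> \<mu>) (\<gamma>' \<mu>) (\<gamma>'' \<mu>)"
  unfolding \<gamma>_def \<gamma>'_def \<gamma>''_def by (rule comb_sol)

lemma gamma_initial [simp]: "\<gamma> \<mu> (- a) = 1" "\<gamma>' \<mu> (- a) = \<mu>" "\<gamma>'' \<mu> (- a) = \<mu>\<^sup>2"
  by (simp_all add: \<gamma>_def \<gamma>'_def \<gamma>''_def comb_initial)

lemma gamma_left:
  assumes "x \<le> - a"
  shows "\<gamma> \<mu> x = exp (\<mu> * of_real (x + a))" "\<gamma>' \<mu> x = \<mu> * exp (\<mu> * of_real (x + a))"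
    "\<gamma>'' \<mu> x = \<mu>\<^sup>2 * exp (\<mu> * of_real (x + a))"
proof -
  have e: "((\<lambda>t. c * exp (\<mu> * of_real (t + a))) has_vector_derivative c * \<mu> * exp (\<mu> * of_real (t + a))) (at t)" for c t
  proof -
    have "((\<lambda>z. c * exp (\<mu> * (z + of_real a))) has_field_derivative c * \<mu> * exp (\<mu> * (of_real t + of_real a))) (at (of_real t))"
      by (auto intro!: derivative_eq_intros)
    from has_vector_derivative_real_field[OF this] show ?thesis by simp
  qed
  let ?e = "\<lambda>c t. c * exp (\<mu> * of_real (t + a))"
  have seg: "q \<mu> t = \<mu> ^ 3" if "t \<in> closed_segment (- a) x" for t
    using that assms a by (intro q_outside) (auto simp: closed_segment_eq_real_ivl split: if_splits)
  note d = has_vector_derivative_diff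
  have d3: "((\<lambda>t. \<gamma>'' \<mu> t - ?e (\<mu>\<^sup>2) t) has_vector_derivative q \<mu> t * (\<gamma> \<mu> t - ?e 1 t)) (at t)"
    if "t \<in> closed_segment (- a) x" for t
    using d[OF jet_solD(3)[OF gamma_sol] e[of "\<mu>\<^sup>2" t], of \<mu>] seg[OF that]
    by (simp add: algebra_simps power2_eq_square power3_eq_cube)
  have d2: "((\<lambda>t. \<gamma>' \<mu> t - ?e \<mu> t) has_vector_derivative \<gamma>'' \<mu> t - ?e (\<mu>\<^sup>2) t) (at t)" for t
    using d[OF jet_solD(2)[OF gamma_sol] e[of \<mu> t], of \<mu>] by (simp add: power2_eq_square)
  have d1: "((\<lambda>t. \<gamma> \<mu> t - ?e 1 t) has_vector_derivative \<gamma>' \<mu> t - ?e \<mu> t) (at t)" for t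
    using d[OF jet_solD(1)[OF gamma_sol] e[of 1 t], of \<mu>] by simp
  have "norm (q \<mu> t) \<le> norm (\<mu> ^ 3)" if "t \<in> closed_segment (- a) x" for t using seg[OF that] by simp
  from jet_unique[of "- a" x "q \<mu>", OF this d1 d2 d3]
  show "\<gamma> \<mu> x = exp (\<mu> * of_real (x + a))" "\<gamma>' \<mu> x = \<mu> * exp (\<mu> * of_real (x + a))"
    "\<gamma>'' \<mu> x = \<mu>\<^sup>2 * exp (\<mu> * of_real (x + a))" by simp_all
qed

text \<open>
  \<open>W\<close> is the growing component of \<open>\<gamma>\<close> to the right of the support, and \<open>\<delta> t\<close> that of the Cauchy solution
  \<open>S t\<close>. In \<open>K(\<cdot>, t)\<close> the jump at \<open>t\<close> comes from \<open>S\<close>, and the multiple of \<open>\<gamma>\<close>, which alone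
  remains for \<open>x \<le> t\<close>, is chosen so that the growing components cancel for large \<open>x\<close>. The functions \<open>K'\<close> and
  \<open>K''\<close> are its derivatives in \<open>x\<close>.
\<close>

definition W where "W \<mu> = \<gamma>'' \<mu> a + \<mu> * \<gamma>' \<mu> a + \<mu>\<^sup>2 * \<gamma> \<mu> a"
definition \<delta> where "\<delta> \<mu> t = S'' \<mu> t a + \<mu> * S' \<mu> t a + \<mu>\<^sup>2 * S \<mu> t a"

definition K where "K \<mu> x t = \<gamma> \<mu> x * (\<delta> \<mu> t / W \<mu>) - (if t < x then S \<mu> t x else 0)"
definition K' where "K' \<mu> x t = \<gamma>' \<mu> x * (\<delta> \<mu> t / W \<mu>) - (if t < x then S' \<mu> t x else 0)"
definition K'' where "K'' \<mu> x t = \<gamma>'' \<mu> x * (\<delta> \<mu> t / W \<mu>) - (if t < x then S'' \<mu> t x else 0)"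

text \<open>
  The difference of the solutions for \<open>\<mu>\<close> and \<open>0\<close> solves the equation for \<open>\<mu>\<close> with inhomogeneity
  \<open>\<mu>\<^sup>3\<close> times the fixed solution for \<open>0\<close>, and has zero data.
\<close>

lemma jets_tendsto:
  shows "((\<lambda>\<mu>. y \<mu> j x) \<longlongrightarrow> y 0 j x) (at 0)" "((\<lambda>\<mu>. y' \<mu> j x) \<longlongrightarrow> y' 0 j x) (at 0)"
    "((\<lambda>\<mu>. y'' \<mu> j x) \<longlongrightarrow> y'' 0 j x) (at 0)"
proof -
  have "bounded (y 0 j ` closed_segment (- a) x)"
    by (intro compact_imp_bounded compact_continuous_image jet_sol_continuous(1)[OF fund] compact_segment)
  then obtain B where B: "\<And>t. t \<in> closed_segment (- a) x \<Longrightarrow> norm (y 0 j t) \<le> B"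
    unfolding bounded_iff by blast
  have B0: "0 \<le> B" using order_trans[OF norm_ge_zero B[of x]] by simp
  define C where "C = exp ((2 + (M + 1)) * \<bar>x + a\<bar> / 2)"
  have main: "norm (y \<mu> j x - y 0 j x) \<le> norm \<mu> ^ 3 * B * C \<and> norm (y' \<mu> j x - y' 0 j x) \<le> norm \<mu> ^ 3 * B * C
      \<and> norm (y'' \<mu> j x - y'' 0 j x) \<le> norm \<mu> ^ 3 * B * C" if "norm \<mu> \<le> 1" for \<mu>
  proof -
    let ?D = "\<lambda>t. y \<mu> j t - y 0 j t" and ?D1 = "\<lambda>t. y' \<mu> j t - y' 0 j t" and ?D2 = "\<lambda>t. y'' \<mu> j t - y'' 0 j t"
    let ?eps = "norm \<mu> ^ 3 * B"
    have "energy ?D ?D1 ?D2 x + ?eps\<^sup>2 \<le> (energy ?D ?D1 ?D2 (- a) + ?eps\<^sup>2) * exp ((2 + (M + 1)) * \<bar>x - - a\<bar>)"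
    proof (rule energy_bound[where q = "q \<mu>" and r = "\<lambda>t. \<mu> ^ 3 * y 0 j t"])
      fix t assume t: "t \<in> closed_segment (- a) x"
      show "norm (q \<mu> t) \<le> M + 1" by (rule q_le[OF that])
      show "norm (\<mu> ^ 3 * y 0 j t) \<le> ?eps"
        unfolding norm_mult norm_power by (intro mult_left_mono B t) auto
      show "(?D has_vector_derivative ?D1 t) (at t)" "(?D1 has_vector_derivative ?D2 t) (at t)"
        by (intro has_vector_derivative_diff jet_solD[OF fund])+
      show "(?D2 has_vector_derivative q \<mu> t * ?D t + \<mu> ^ 3 * y 0 j t) (at t)"
        by (rule has_vector_derivative_eq_rhs, (rule has_vector_derivative_diff jet_solD(3)[OF fund])+)
          (simp add: q_def algebra_simps)
    qed
    also have "energy ?D ?D1 ?D2 (- a) = 0" by (simp add: energy_def initial)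
    also have "(0 + ?eps\<^sup>2) * exp ((2 + (M + 1)) * \<bar>x - - a\<bar>) = (?eps * C)\<^sup>2"
      by (simp add: C_def power_mult_distrib flip: exp_double)
    finally have "energy ?D ?D1 ?D2 x \<le> (?eps * C)\<^sup>2"
      using zero_le_power2[of ?eps] by linarith
    moreover have "0 \<le> ?eps * C" using B0 by (simp add: C_def)
    ultimately show ?thesis using norm_le_energy[of ?D ?D1 ?D2 x "?eps * C"] by simp
  qed
  have lim: "((\<lambda>\<mu>::complex. norm \<mu> ^ 3 * B * C) \<longlongrightarrow> 0) (at 0)"
    by (auto intro!: tendsto_eq_intros)
  have ev1: "\<forall>\<^sub>F \<mu>::complex in at 0. norm \<mu> \<le> 1"
    using eventually_at_ball[of 1 "0::complex" UNIV] by (auto elim!: eventually_mono)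
  have "((\<lambda>\<mu>. y \<mu> j x - y 0 j x) \<longlongrightarrow> 0) (at 0)" "((\<lambda>\<mu>. y' \<mu> j x - y' 0 j x) \<longlongrightarrow> 0) (at 0)"
    "((\<lambda>\<mu>. y'' \<mu> j x - y'' 0 j x) \<longlongrightarrow> 0) (at 0)"
    by (rule Lim_null_comparison[OF _ lim], rule eventually_mono[OF ev1], use main in blast)+
  then show "((\<lambda>\<mu>. y \<mu> j x) \<longlongrightarrow> y 0 j x) (at 0)" "((\<lambda>\<mu>. y' \<mu> j x) \<longlongrightarrow> y' 0 j x) (at 0)"
    "((\<lambda>\<mu>. y'' \<mu> j x) \<longlongrightarrow> y'' 0 j x) (at 0)"
    by (simp_all only: LIM_zero_iff)
qed

lemma kernel_tendsto:
  assumes "W 0 \<noteq> 0"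
  shows "(W \<longlongrightarrow> W 0) (at 0)" "((\<lambda>\<mu>. K \<mu> x t) \<longlongrightarrow> K 0 x t) (at 0)"
proof -
  note lims = jets_tendsto
  have g: "((\<lambda>\<mu>. \<gamma> \<mu> x) \<longlongrightarrow> \<gamma> 0 x) (at 0)" "((\<lambda>\<mu>. \<gamma>' \<mu> x) \<longlongrightarrow> \<gamma>' 0 x) (at 0)"
    "((\<lambda>\<mu>. \<gamma>'' \<mu> x) \<longlongrightarrow> \<gamma>'' 0 x) (at 0)" for x
    unfolding \<gamma>_def \<gamma>'_def \<gamma>''_def comb_def by (intro tendsto_intros lims)+
  have s: "((\<lambda>\<mu>. S \<mu> t x) \<longlongrightarrow> S 0 t x) (at 0)" "((\<lambda>\<mu>. S' \<mu> t x) \<longlongrightarrow> S' 0 t x) (at 0)"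
    "((\<lambda>\<mu>. S'' \<mu> t x) \<longlongrightarrow> S'' 0 t x) (at 0)" for x
    unfolding S_def S'_def S''_def comb_def cof_simps by (intro tendsto_intros lims)+
  show W: "(W \<longlongrightarrow> W 0) (at 0)" unfolding W_def[abs_def] by (intro tendsto_intros g)
  have gh: "((\<lambda>\<mu>. \<delta> \<mu> t) \<longlongrightarrow> \<delta> 0 t) (at 0)" unfolding \<delta>_def by (intro tendsto_intros s)
  show "((\<lambda>\<mu>. K \<mu> x t) \<longlongrightarrow> K 0 x t) (at 0)" unfolding K_def
    by (cases "t < x") (auto intro!: tendsto_intros g gh W s assms)
qed

lemma kernel_measurable:
  shows "(\<lambda>(x, t). K \<mu> x t) \<in> borel_measurable (lborel \<Otimes>\<^sub>M lborel)"
    "(\<lambda>(x, t). K' \<mu> x t) \<in> borel_measurable (lborel \<Otimes>\<^sub>M lborel)"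
    "(\<lambda>(x, t). K'' \<mu> x t) \<in> borel_measurable (lborel \<Otimes>\<^sub>M lborel)"
proof -
  have [measurable]: "y \<mu> j \<in> borel_measurable borel" "y' \<mu> j \<in> borel_measurable borel"
    "y'' \<mu> j \<in> borel_measurable borel" for j
    by (intro borel_measurable_continuous_onI jet_sol_continuous[OF fund])+
  show "(\<lambda>(x, t). K \<mu> x t) \<in> borel_measurable (lborel \<Otimes>\<^sub>M lborel)"
    "(\<lambda>(x, t). K' \<mu> x t) \<in> borel_measurable (lborel \<Otimes>\<^sub>M lborel)"
    "(\<lambda>(x, t). K'' \<mu> x t) \<in> borel_measurable (lborel \<Otimes>\<^sub>M lborel)"
    unfolding K_def K'_def K''_def \<gamma>_def \<gamma>'_def \<gamma>''_def \<delta>_def S_def S'_def S''_def comb_def cof_simps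
    by measurable
qed

section \<open>Bounds for the Green kernel\<close>

text \<open>
  Bounds the transfer of jets across the support of the potential.
\<close>

definition CM where "CM = 2 * exp ((3 + M) * a)"

lemma CM_ge: "2 \<le> CM"
  using M a by (simp add: CM_def)

lemma middle_bound:
  assumes u: "jet_sol (q \<mu>) u u1 u2" and mu: "norm \<mu> \<le> 1"
    and s: "\<bar>s\<bar> \<le> a" and x: "\<bar>x\<bar> \<le> a" and J: "jet_le u u1 u2 s J"
  shows "jet_le u u1 u2 x (CM * J)"
proof -
  have J0: "0 \<le> J" using J norm_ge_zero order_trans unfolding jet_le_def by blast
  have "energy u u1 u2 x + 0\<^sup>2 \<le> (energy u u1 u2 s + 0\<^sup>2) * exp ((2 + (M + 1)) * \<bar>x - s\<bar>)"
    by (rule energy_bound[where q = "q \<mu>" and r = "\<lambda>_. 0"]) (use jet_solD[OF u] q_le[OF mu] in auto)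
  also have "\<dots> \<le> (J\<^sup>2 + J\<^sup>2 + J\<^sup>2) * exp ((2 + (M + 1)) * (2 * a))"
  proof (intro mult_mono)
    show "energy u u1 u2 s + 0\<^sup>2 \<le> J\<^sup>2 + J\<^sup>2 + J\<^sup>2"
        using J power_mono[of "norm (u s)" J 2] power_mono[of "norm (u1 s)" J 2]
        power_mono[of "norm (u2 s)" J 2] by (simp add: jet_le_def energy_def)
    show "exp ((2 + (M + 1)) * \<bar>x - s\<bar>) \<le> exp ((2 + (M + 1)) * (2 * a))"
      using s x M by (auto intro!: mult_left_mono)
  qed auto
  also have "\<dots> \<le> 4 * J\<^sup>2 * exp ((2 + (M + 1)) * (2 * a))" by (intro mult_right_mono) auto
  also have "\<dots> = (CM * J)\<^sup>2"
  proof -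
    have "exp ((2 + (M + 1)) * (2 * a)) = (exp ((3 + M) * a))\<^sup>2"
      by (simp add: algebra_simps flip: exp_double)
    then show ?thesis by (simp add: CM_def power_mult_distrib)
  qed
  finally have "energy u u1 u2 x \<le> (CM * J)\<^sup>2" by simp
  moreover have "0 \<le> CM * J" using J0 CM_ge by simp
  ultimately show ?thesis using norm_le_energy[of u u1 u2 x "CM * J"] by (simp add: jet_le_def)
qed

lemma free_derivs:
  assumes "jet_sol (q \<mu>) u u1 u2" "a \<le> \<bar>t\<bar>"
  shows "(u has_vector_derivative u1 t) (at t)" "(u1 has_vector_derivative u2 t) (at t)"
    "(u2 has_vector_derivative \<mu> ^ 3 * u t) (at t)"
  using jet_solD[OF assms(1), of t] q_outside[of t \<mu>] assms(2) by auto

text \<open>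
  The branch \<open>t < x\<close> of the kernel, extended to a solution on the whole line.
\<close>

definition T where "T \<mu> t x = \<gamma> \<mu> x * (\<delta> \<mu> t / W \<mu>) - S \<mu> t x"
definition T' where "T' \<mu> t x = \<gamma>' \<mu> x * (\<delta> \<mu> t / W \<mu>) - S' \<mu> t x"
definition T'' where "T'' \<mu> t x = \<gamma>'' \<mu> x * (\<delta> \<mu> t / W \<mu>) - S'' \<mu> t x"

lemma T_sol: "jet_sol (q \<mu>) (T \<mu> t) (T' \<mu> t) (T'' \<mu> t)"
  using jet_sol_diff[OF jet_sol_cmult[OF gamma_sol, of _ "\<delta> \<mu> t / W \<mu>"] S_sol[of \<mu> t]]
  unfolding T_def[abs_def] T'_def[abs_def] T''_def[abs_def] by (simp only: mult.commute)

text \<open>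
  The Cauchy solution modulo \<open>\<gamma>\<close>, normalised to vanish at \<open>-a\<close>. For \<open>t \<le> -a\<close> the solution \<open>S t\<close> grows
  like \<open>e\<^bsup>\<mu> (x - t)\<^esup>\<close>, but this part is a multiple of \<open>\<gamma>\<close> and drops out of \<open>T\<close>, which depends on \<open>S\<close> only
  modulo \<open>\<gamma>\<close>. What remains is moderate; \<open>\<rho>\<close> is its growing component.
\<close>

definition P where "P \<mu> t x = S \<mu> t x - S \<mu> t (- a) * \<gamma> \<mu> x"
definition P' where "P' \<mu> t x = S' \<mu> t x - S \<mu> t (- a) * \<gamma>' \<mu> x"
definition P'' where "P'' \<mu> t x = S'' \<mu> t x - S \<mu> t (- a) * \<gamma>'' \<mu> x"

lemma P_sol: "jet_sol (q \<mu>) (P \<mu> t) (P' \<mu> t) (P'' \<mu> t)"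
  unfolding P_def[abs_def] P'_def[abs_def] P''_def[abs_def]
  by (rule jet_sol_diff[OF S_sol jet_sol_cmult[OF gamma_sol]])

definition \<rho> where "\<rho> \<mu> t = P'' \<mu> t a + \<mu> * P' \<mu> t a + \<mu>\<^sup>2 * P \<mu> t a"

lemma delta_split: "\<delta> \<mu> t = S \<mu> t (- a) * W \<mu> + \<rho> \<mu> t"
  by (simp add: \<rho>_def P_def P'_def P''_def \<delta>_def W_def algebra_simps)

lemma T_split:
  assumes "W \<mu> \<noteq> 0"
  shows "T \<mu> t x = \<rho> \<mu> t / W \<mu> * \<gamma> \<mu> x - P \<mu> t x" "T' \<mu> t x = \<rho> \<mu> t / W \<mu> * \<gamma>' \<mu> x - P' \<mu> t x"
    "T'' \<mu> t x = \<rho> \<mu> t / W \<mu> * \<gamma>'' \<mu> x - P'' \<mu> t x"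
  using assms by (simp_all add: T_def T'_def T''_def P_def P'_def P''_def delta_split add_divide_distrib algebra_simps)

lemma T_outgoing: "W \<mu> \<noteq> 0 \<Longrightarrow> T'' \<mu> t a + \<mu> * T' \<mu> t a + \<mu>\<^sup>2 * T \<mu> t a = 0"
proof -
  assume "W \<mu> \<noteq> 0"
  have "T'' \<mu> t a + \<mu> * T' \<mu> t a + \<mu>\<^sup>2 * T \<mu> t a = W \<mu> * (\<delta> \<mu> t / W \<mu>) - \<delta> \<mu> t"
    unfolding T_def T'_def T''_def by (simp only: W_def[of \<mu>] \<delta>_def[of \<mu> t] algebra_simps)
  then show ?thesis using \<open>W \<mu> \<noteq> 0\<close> by simp
qed

text \<open>
  Constants for the estimates of \<open>T\<close> and of the kernel, given a lower bound \<open>w\<close> for \<open>\<bar>W\<bar>\<close>.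
  What matters is that they do not involve \<open>\<mu>\<close> and \<open>\<alpha>\<close>; \<open>CK w\<close> adds up what the various positions of
  \<open>x\<close> and \<open>t\<close> relative to the support require.
\<close>

definition C3 where "C3 w = 3 * CM\<^sup>2 / w + CM"

definition CK where
  "CK w = (29 * CM * exp a) * (147 * CM * exp a) / w + 99 * CM / w + 180 * C3 w * exp (2 * a) + (60 * CM / w + 28)"

end

locale kernel_bounds = cubic_problem V a M y y' y'' + free_rates \<mu> \<alpha>
  for V a M y y' y'' \<mu> \<alpha> +
  fixes w :: real
  assumes w: "w > 0" and W_ge: "w \<le> norm (W \<mu>)"
begin

lemma W_ne: "W \<mu> \<noteq> 0" using w W_ge by auto

lemma inverse_W: "norm (c / W \<mu>) \<le> norm c / w"
  unfolding norm_divide using w W_ge W_ne by (intro divide_left_mono mult_pos_pos) auto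

lemma free_bounds:
  assumes "jet_sol (q \<mu>) u u1 u2" "b \<le> x" "jet_le u u1 u2 b J" and out: "a \<le> b \<or> x \<le> - a"
  shows "norm (u1 x - \<mu> * u x) \<le> 8 * J * p (x - b) * exp (- \<alpha> * (x - b))"
    and "norm (u2 x - \<mu> * u1 x) \<le> 12 * J * p (x - b) * exp (- \<alpha> * (x - b))"
    and "norm (u1 x - l1 * u x) \<le> 4 * J * p (x - b) * exp (Re \<mu> * (x - b))"
    and "jet_le u u1 u2 x (29 * J * (p (x - b))\<^sup>2 * exp (Re \<mu> * (x - b)))"
proof -
  have "a \<le> \<bar>t\<bar>" if "t \<in> {b..x}" for t using that out by auto
  note d = free_derivs[OF assms(1) this]
  show "norm (u1 x - \<mu> * u x) \<le> 8 * J * p (x - b) * exp (- \<alpha> * (x - b))"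
    "norm (u2 x - \<mu> * u1 x) \<le> 12 * J * p (x - b) * exp (- \<alpha> * (x - b))"
    "norm (u1 x - l1 * u x) \<le> 4 * J * p (x - b) * exp (Re \<mu> * (x - b))"
    "jet_le u u1 u2 x (29 * J * (p (x - b))\<^sup>2 * exp (Re \<mu> * (x - b)))"
    using free_forward[of b x u u1 u2 J, OF assms(2) d assms(3)] by blast+
qed

lemma outgoing_propagates:
  assumes "jet_sol (q \<mu>) u u1 u2" "a \<le> b" "b \<le> x"
  shows "u2 x + \<mu> * u1 x + \<mu>\<^sup>2 * u x = exp (\<mu> * of_real (x - b)) * (u2 b + \<mu> * u1 b + \<mu>\<^sup>2 * u b)"
proof -
  have "a \<le> \<bar>t\<bar>" if "t \<in> {b..x}" for t using that assms by auto
  note d = free_derivs[OF assms(1) this]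
  show ?thesis by (rule free_outgoing_propagates[OF assms(3) d])
qed

lemma outgoing_bound:
  assumes "jet_sol (q \<mu>) u u1 u2" "a \<le> b" "b \<le> x" and 0: "u2 b + \<mu> * u1 b + \<mu>\<^sup>2 * u b = 0"
    and J: "norm (u b) \<le> J0" "norm (u1 b - l1 * u b) \<le> J1"
  shows "jet_le u u1 u2 x (3 * (J0 + J1 * p (x - b)) * exp (- \<alpha> * (x - b)))"
proof -
  have "a \<le> \<bar>t\<bar>" if "t \<in> {b..x}" for t using that assms by auto
  note d = free_derivs[OF assms(1) this]
  show ?thesis by (rule free_outgoing_bound[OF assms(3) d 0 J])
qed

lemma p_ge: "0 \<le> s \<Longrightarrow> 1 \<le> p s" by (rule moderate_ge_1)

lemma p_nonneg: "0 \<le> s \<Longrightarrow> 0 \<le> p s" using p_ge[of s] by simp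

lemma mu_mult_le: "norm (\<mu> * v) \<le> norm v"
  using mult_right_mono[OF mu_le, of "norm v"] by (simp add: norm_mult)

lemma C3_pos: "0 < C3 w" using CM_ge w by (simp add: C3_def add_nonneg_pos)

lemma gamma_unit: "jet_le (\<gamma> \<mu>) (\<gamma>' \<mu>) (\<gamma>'' \<mu>) (- a) 1"
  using mu_le norms by (simp add: jet_le_def)

lemma S_unit: "jet_le (S \<mu> t) (S' \<mu> t) (S'' \<mu> t) t 1"
  by (simp add: jet_le_def)

lemma gamma_left_le: "x \<le> - a \<Longrightarrow> jet_le (\<gamma> \<mu>) (\<gamma>' \<mu>) (\<gamma>'' \<mu>) x (exp (Re \<mu> * (x + a)))"
  using norms mu_le by (auto simp: jet_le_def gamma_left norm_mult intro!: mult_left_le_one_le)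

lemma gamma_middle_le: "\<bar>x\<bar> \<le> a \<Longrightarrow> jet_le (\<gamma> \<mu>) (\<gamma>' \<mu>) (\<gamma>'' \<mu>) x CM"
  using middle_bound[OF gamma_sol mu_le _ _ gamma_unit] a by simp

lemma gamma_right_le:
  assumes "a \<le> x"
  shows "jet_le (\<gamma> \<mu>) (\<gamma>' \<mu>) (\<gamma>'' \<mu>) x (29 * CM * (p (x - a))\<^sup>2 * exp (Re \<mu> * (x - a)))"
    "norm (\<gamma>' \<mu> x - l1 * \<gamma> \<mu> x) \<le> 4 * CM * p (x - a) * exp (Re \<mu> * (x - a))"
  using free_bounds(3,4)[OF gamma_sol assms gamma_middle_le] a by auto

text \<open>
  The largest of the bounds in the three regions, with one exponential factor for all of them.
\<close>

lemma gamma_le: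
  "jet_le (\<gamma> \<mu>) (\<gamma>' \<mu>) (\<gamma>'' \<mu>) x (29 * CM * exp a * (p (max 0 (x - a)))\<^sup>2 * exp (Re \<mu> * x))"
proof -
  have ea: "1 \<le> exp a" using a by simp
  have ka: "Re \<mu> * a \<le> a" "0 \<le> Re \<mu> * a" using kappa a by (simp_all add: mult_left_le_one_le)
  consider "x \<le> - a" | "\<bar>x\<bar> \<le> a" | "a \<le> x" by linarith
  then show ?thesis
  proof cases
    case 1
    have "exp (Re \<mu> * (x + a)) \<le> exp (a + Re \<mu> * x)" using ka by (simp add: algebra_simps)
    also have "\<dots> \<le> (29 * CM) * exp (a + Re \<mu> * x)" using CM_ge by simp
    finally show ?thesis using jet_le_mono[OF gamma_left_le[OF 1]] 1 a by (simp add: exp_add)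
  next
    case 2
    have "- a \<le> Re \<mu> * x"
      using mult_left_mono[of "- a" x "Re \<mu>"] 2 kappa ka by linarith
    then have "1 \<le> exp (a + Re \<mu> * x)" by simp
    then have "CM * 1 \<le> (29 * CM) * exp (a + Re \<mu> * x)" using CM_ge by (intro mult_mono) auto
    then show ?thesis using jet_le_mono[OF gamma_middle_le[OF 2]] 2 by (simp add: exp_add)
  next
    case 3
    have "exp (Re \<mu> * (x - a)) \<le> exp (a + Re \<mu> * x)" using ka a by (simp add: algebra_simps)
    then have "29 * CM * (p (x - a))\<^sup>2 * exp (Re \<mu> * (x - a)) \<le> 29 * CM * (p (x - a))\<^sup>2 * exp (a + Re \<mu> * x)"
      using CM_ge by (intro mult_left_mono) auto
    then show ?thesis using jet_le_mono[OF gamma_right_le(1)[OF 3]] 3 by (simp add: exp_add ac_simps)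
  qed
qed

text \<open>
  At \<open>-a\<close> the jet of \<open>P\<close> is \<open>(0, u' - \<mu> u, u'' - \<mu>\<^sup>2 u)\<close> with \<open>u = S t\<close>, a combination of the quantities
  from which the growing exponential has been removed.
\<close>

lemma P_initial_le:
  assumes "t \<le> - a"
  shows "jet_le (P \<mu> t) (P' \<mu> t) (P'' \<mu> t) (- a) (20 * p (- a - t) * exp (- \<alpha> * (- a - t)))"
    and "norm (S \<mu> t (- a)) \<le> 29 * (p (- a - t))\<^sup>2 * exp (Re \<mu> * (- a - t))"
proof -
  note F = free_bounds[OF S_sol assms S_unit, OF disjI2, OF order_refl]
  show "norm (S \<mu> t (- a)) \<le> 29 * (p (- a - t))\<^sup>2 * exp (Re \<mu> * (- a - t))"
    using F(4) by (simp add: jet_le_def)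
  let ?B = "p (- a - t) * exp (- \<alpha> * (- a - t))"
  have B: "0 \<le> ?B" using p_ge[of "- a - t"] assms by simp
  have "P'' \<mu> t (- a) = (S'' \<mu> t (- a) - \<mu> * S' \<mu> t (- a)) + \<mu> * (S' \<mu> t (- a) - \<mu> * S \<mu> t (- a))"
    by (simp add: P''_def algebra_simps power2_eq_square)
  also have "norm \<dots> \<le> 12 * ?B + 8 * ?B"
    using F(1,2) order_trans[OF mu_mult_le, of "S' \<mu> t (- a) - \<mu> * S \<mu> t (- a)" "8 * ?B"]
    by (intro order_trans[OF norm_triangle_ineq] add_mono) (simp_all add: mult.assoc)
  finally have P'': "norm (P'' \<mu> t (- a)) \<le> 20 * ?B" by simp
  have "norm (P' \<mu> t (- a)) \<le> 8 * ?B"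
    using F(1) by (simp add: P'_def mult.assoc mult.commute[of _ \<mu>])
  then show "jet_le (P \<mu> t) (P' \<mu> t) (P'' \<mu> t) (- a) (20 * p (- a - t) * exp (- \<alpha> * (- a - t)))"
    using P'' B by (simp add: jet_le_def P_def mult.assoc)
qed

lemma rho_le:
  assumes "t \<le> - a"
  shows "norm (\<rho> \<mu> t) \<le> 60 * CM * p (- a - t) * exp (- \<alpha> * (- a - t))"
  using jet_le_imp_norm_le(2)[OF middle_bound[OF P_sol mu_le _ _ P_initial_le(1)[OF assms], of a], of "\<mu>\<^sup>2" \<mu>]
    norms mu_le a by (simp add: \<rho>_def mult.assoc)

lemma W_le: "norm (W \<mu>) \<le> 3 * CM"
  using jet_le_imp_norm_le(2)[OF gamma_middle_le, of a "\<mu>\<^sup>2" \<mu>] norms mu_le a by (simp add: W_def)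

lemma delta_right:
  assumes "a \<le> t" shows "norm (\<delta> \<mu> t) = exp (- Re \<mu> * (t - a))"
proof -
  have "S'' \<mu> t t + \<mu> * S' \<mu> t t + \<mu>\<^sup>2 * S \<mu> t t = exp (\<mu> * of_real (t - a)) * \<delta> \<mu> t"
    unfolding \<delta>_def by (rule outgoing_propagates[OF S_sol order_refl assms])
  then have "norm (exp (\<mu> * of_real (t - a)) * \<delta> \<mu> t) = 1" by simp
  then have "exp (Re \<mu> * (t - a)) * norm (\<delta> \<mu> t) = 1" by (simp add: norm_mult)
  then show ?thesis by (simp add: exp_minus inverse_eq_divide eq_divide_eq mult.commute)
qed

lemma delta_middle: "\<bar>t\<bar> \<le> a \<Longrightarrow> norm (\<delta> \<mu> t) \<le> 3 * CM"
  using jet_le_imp_norm_le(2)[OF middle_bound[OF S_sol mu_le _ _ S_unit], of t a "\<mu>\<^sup>2" \<mu>] norms mu_le a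
  by (simp add: \<delta>_def)

lemma delta_le:
  "norm (\<delta> \<mu> t) \<le> 147 * CM * exp a * (p (max 0 (- a - t)))\<^sup>2 * exp (- Re \<mu> * t)"
proof -
  have ea: "1 \<le> exp a" using a by simp
  have ka: "Re \<mu> * a \<le> a" "0 \<le> Re \<mu> * a" using kappa a by (simp_all add: mult_left_le_one_le)
  consider "t \<le> - a" | "\<bar>t\<bar> \<le> a" | "a \<le> t" by linarith
  then show ?thesis
  proof cases
    case 1
    let ?s = "- a - t"
    have s: "0 \<le> ?s" using 1 by simp
    have "norm (\<delta> \<mu> t) \<le> norm (S \<mu> t (- a)) * norm (W \<mu>) + norm (\<rho> \<mu> t)"
      unfolding delta_split by (rule order_trans[OF norm_triangle_ineq]) (simp add: norm_mult)
    also have "\<dots> \<le> (29 * (p ?s)\<^sup>2 * exp (Re \<mu> * ?s)) * (3 * CM) + 60 * CM * p ?s * exp (- \<alpha> * ?s)"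
      using P_initial_le(2)[OF 1] W_le rho_le[OF 1] by (intro add_mono mult_mono) auto
    also have "60 * CM * p ?s * exp (- \<alpha> * ?s) \<le> 60 * CM * (p ?s)\<^sup>2 * exp (Re \<mu> * ?s)"
      using CM_ge moderate_le_power2[OF s] exp_rate[OF s] p_nonneg[OF s] by (intro mult_mono) auto
    also have "(29 * (p ?s)\<^sup>2 * exp (Re \<mu> * ?s)) * (3 * CM) + 60 * CM * (p ?s)\<^sup>2 * exp (Re \<mu> * ?s)
      = 147 * CM * (p ?s)\<^sup>2 * exp (Re \<mu> * ?s)" by (simp add: algebra_simps)
    also have "147 * CM * (p ?s)\<^sup>2 * exp (Re \<mu> * ?s) \<le> 147 * CM * (p ?s)\<^sup>2 * exp (a + - Re \<mu> * t)"
      using ka a CM_ge by (intro mult_left_mono) (auto simp: algebra_simps)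
    also have "exp (a + - Re \<mu> * t) = exp a * exp (- Re \<mu> * t)" by (rule exp_add)
    finally show ?thesis using 1 by (simp add: ac_simps)
  next
    case 2
    have "Re \<mu> * t \<le> a"
      using mult_left_mono[of t a "Re \<mu>"] 2 kappa ka by linarith
    then have "1 \<le> exp (a + - Re \<mu> * t)" by simp
    then have "(3 * CM) * 1 \<le> (147 * CM) * exp (a + - Re \<mu> * t)" using CM_ge by (intro mult_mono) auto
    also have "exp (a + - Re \<mu> * t) = exp a * exp (- Re \<mu> * t)" by (rule exp_add)
    finally have "3 * CM \<le> 147 * CM * (exp a * exp (- Re \<mu> * t))" by (simp only: mult_1_right)
    with delta_middle[OF 2] have "norm (\<delta> \<mu> t) \<le> 147 * CM * (exp a * exp (- Re \<mu> * t))" by (rule order_trans)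
    then show ?thesis using 2 by (simp add: mult.assoc)
  next
    case 3
    have "exp (- Re \<mu> * (t - a)) \<le> 1 * exp (a + - Re \<mu> * t)" using ka by (simp add: algebra_simps)
    also have "\<dots> \<le> (147 * CM) * exp (a + - Re \<mu> * t)" using CM_ge by (intro mult_right_mono) auto
    also have "exp (a + - Re \<mu> * t) = exp a * exp (- Re \<mu> * t)" by (rule exp_add)
    finally have "norm (\<delta> \<mu> t) \<le> 147 * CM * (exp a * exp (- Re \<mu> * t))"
      unfolding delta_right[OF 3] .
    then show ?thesis using 3 a by (simp add: mult.assoc)
  qed
qed

text \<open>
  If \<open>t\<close> lies in the support interval, \<open>S t\<close> has a unit jet there. If \<open>t\<close> lies to the left of it, \<open>S t\<close>
  is replaced by \<open>P t\<close>.
\<close>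

lemma T_middle_le:
  assumes "t \<le> a" "\<bar>x\<bar> \<le> a"
  shows "jet_le (T \<mu> t) (T' \<mu> t) (T'' \<mu> t) x (20 * C3 w * p (max 0 (- a - t)) * exp (- \<alpha> * max 0 (- a - t)))"
proof (cases "t \<le> - a")
  case True
  let ?B = "p (- a - t) * exp (- \<alpha> * (- a - t))"
  have "norm (\<rho> \<mu> t / W \<mu>) \<le> 60 * CM * ?B / w"
    by (rule order_trans[OF inverse_W]) (use rho_le[OF True] w in \<open>simp add: divide_right_mono mult.assoc\<close>)
  from jet_le_diff[OF jet_le_cmult[OF gamma_middle_le[OF assms(2)] this]
      middle_bound[OF P_sol mu_le _ assms(2) P_initial_le(1)[OF True]]]
  have "jet_le (T \<mu> t) (T' \<mu> t) (T'' \<mu> t) x (60 * CM * ?B / w * CM + CM * (20 * ?B))"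
    using a by (simp add: T_split[OF W_ne, abs_def] mult.assoc)
  moreover have "60 * CM * ?B / w * CM + CM * (20 * ?B) = 20 * C3 w * ?B"
    by (simp add: C3_def field_simps power2_eq_square)
  ultimately show ?thesis using True by (simp add: mult.assoc)
next
  case False
  then have t: "\<bar>t\<bar> \<le> a" using assms by simp
  have "norm (\<delta> \<mu> t / W \<mu>) \<le> 3 * CM / w"
    by (rule order_trans[OF inverse_W]) (use delta_middle[OF t] w in \<open>simp add: divide_right_mono\<close>)
  from jet_le_diff[OF jet_le_cmult[OF gamma_middle_le[OF assms(2)] this]
      middle_bound[OF S_sol mu_le t assms(2) S_unit]]
  have "jet_le (T \<mu> t) (T' \<mu> t) (T'' \<mu> t) x (3 * CM / w * CM + CM * 1)"
    by (simp add: T_def[abs_def] T'_def[abs_def] T''_def[abs_def] mult.commute)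
  moreover have "3 * CM / w * CM + CM * 1 \<le> 20 * C3 w"
    using C3_pos by (simp add: C3_def power2_eq_square)
  ultimately show ?thesis using False by (auto intro: jet_le_mono)
qed

lemma T_right_le:
  assumes "t \<le> a" "- a \<le> x"
  shows "jet_le (T \<mu> t) (T' \<mu> t) (T'' \<mu> t) x
    (180 * C3 w * p (max 0 (- a - t)) * p (max 0 (x - a)) * exp (- \<alpha> * (max 0 (- a - t) + max 0 (x - a))))"
proof -
  let ?s = "max 0 (- a - t)"
  let ?c = "20 * C3 w * p ?s * exp (- \<alpha> * ?s)"
  have c: "0 \<le> ?c" using C3_pos p_ge[of ?s] by simp
  show ?thesis
  proof (cases "x \<le> a")
    case True
    have le: "?c \<le> 180 * C3 w * p ?s * p (max 0 (x - a)) * exp (- \<alpha> * (?s + max 0 (x - a)))"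
      using True C3_pos p_ge[of ?s] by simp
    have "\<bar>x\<bar> \<le> a" using True assms(2) by simp
    from jet_le_mono[OF T_middle_le[OF assms(1) this] le] show ?thesis .
  next
    case False
    then have x: "a \<le> x" by simp
    have m: "jet_le (T \<mu> t) (T' \<mu> t) (T'' \<mu> t) a ?c" using T_middle_le[OF assms(1), of a] a by simp
    have "jet_le (T \<mu> t) (T' \<mu> t) (T'' \<mu> t) x (3 * (?c + 2 * ?c * p (x - a)) * exp (- \<alpha> * (x - a)))"
      by (rule outgoing_bound[OF T_sol order_refl x T_outgoing[OF W_ne]])
        (use m jet_le_imp_norm_le(1)[OF m, of l1 0] norms in \<open>auto simp: jet_le_def\<close>)
    moreover have "3 * (?c + 2 * ?c * p (x - a)) * exp (- \<alpha> * (x - a))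
      \<le> 180 * C3 w * p ?s * p (max 0 (x - a)) * exp (- \<alpha> * (?s + max 0 (x - a)))"
    proof -
      have "?c * 1 \<le> ?c * p (x - a)" using p_ge[of "x - a"] x c by (intro mult_left_mono) auto
      then have "?c \<le> ?c * p (x - a)" by (simp only: mult_1_right)
      then have "3 * (?c + 2 * ?c * p (x - a)) * exp (- \<alpha> * (x - a))
        \<le> 3 * (?c * p (x - a) + 2 * ?c * p (x - a)) * exp (- \<alpha> * (x - a))"
        by (intro mult_right_mono[OF mult_left_mono[OF add_right_mono]]) simp_all
      also have "\<dots> = 180 * C3 w * p ?s * p (x - a) * (exp (- \<alpha> * ?s) * exp (- \<alpha> * (x - a)))"
      proof -
        have "3 * (20 * C * P * e * P' + 2 * (20 * C * P * e) * P') * e' = 180 * C * P * P' * (e * e')"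
          for C P e P' e' :: real by (simp add: algebra_simps)
        then show ?thesis .
      qed
      also have "exp (- \<alpha> * ?s) * exp (- \<alpha> * (x - a)) = exp (- \<alpha> * (?s + (x - a)))"
        by (simp add: algebra_simps flip: exp_add)
      finally show ?thesis using x by (simp only: max_absorb2[of 0 "x - a"] diff_ge_0_iff_ge)
    qed
    ultimately show ?thesis by (rule jet_le_mono)
  qed
qed

text \<open>
  To the left of the support, \<open>P' = \<mu> P + G\<close> with a decaying \<open>G\<close> and \<open>P(-a) = 0\<close>. Integrating from \<open>-a\<close> to the
  left, where the factor \<open>e\<^bsup>\<mu> x\<^esup>\<close> is harmless, gives a bound that is linear in both distances to the
  support.
\<close>

lemma P_left_le:
  assumes "t \<le> x" "x \<le> - a"
  shows "jet_le (P \<mu> t) (P' \<mu> t) (P'' \<mu> t) x (28 * p (- a - t) * p (- a - x) * exp (- \<alpha> * (x - t)))"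
proof -
  define G where "G s = S' \<mu> t s - \<mu> * S \<mu> t s" for s
  define G' where "G' s = S'' \<mu> t s - \<mu> * S' \<mu> t s" for s
  let ?\<tau> = "- a - t" and ?\<sigma> = "- a - x"
  have pos: "0 \<le> ?\<tau>" "0 \<le> ?\<sigma>" using assms by auto
  have G: "norm (G s) \<le> 8 * p ?\<tau> * exp (- \<alpha> * (s - t))" "norm (G' s) \<le> 12 * p ?\<tau> * exp (- \<alpha> * (s - t))"
    if "t \<le> s" "s \<le> - a" for s
  proof -
    have m: "p (s - t) \<le> p ?\<tau>" using that by (intro moderate_mono) auto
    have "norm (G s) \<le> 8 * p (s - t) * exp (- \<alpha> * (s - t))" "norm (G' s) \<le> 12 * p (s - t) * exp (- \<alpha> * (s - t))"
      unfolding G_def G'_def using free_bounds(1,2)[OF S_sol that(1) S_unit, OF disjI2, OF that(2)] by simp_all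
    moreover have "8 * p (s - t) * exp (- \<alpha> * (s - t)) \<le> 8 * p ?\<tau> * exp (- \<alpha> * (s - t))"
      "12 * p (s - t) * exp (- \<alpha> * (s - t)) \<le> 12 * p ?\<tau> * exp (- \<alpha> * (s - t))"
      using m by (auto intro!: mult_right_mono)
    ultimately show "norm (G s) \<le> 8 * p ?\<tau> * exp (- \<alpha> * (s - t))" "norm (G' s) \<le> 12 * p ?\<tau> * exp (- \<alpha> * (s - t))"
      by linarith+
  qed
  have P': "P' \<mu> t s = \<mu> * P \<mu> t s + G s" and P'': "P'' \<mu> t s = \<mu> * P' \<mu> t s + G' s" if "s \<le> - a" for s
    using gamma_left[OF that, of \<mu>]
    by (simp_all add: P_def P'_def P''_def G_def G'_def algebra_simps power2_eq_square)
  \<comment> \<open>A primitive of the bound for \<open>G\<close> in reversed time; its increment over \<open>[0, \<sigma>]\<close> is linear in \<open>\<sigma>\<close> at worst.\<close>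
  define B where "B r = - (8 * p ?\<tau> * exp (- \<alpha> * (x - t)) * p (?\<sigma> - r))" for r
  have "norm (P \<mu> t (- a - ?\<sigma>)) \<le> exp (0 * (?\<sigma> - 0)) * (norm (P \<mu> t (- a - 0)) + (B ?\<sigma> - B 0))"
  proof (rule first_order_bound[where l = "- \<mu>" and g = "\<lambda>r. - G (- a - r)"
        and B' = "\<lambda>r. 8 * p ?\<tau> * exp (- \<alpha> * (- a - r - t))"])
    fix r assume r: "r \<in> {0..?\<sigma>}"
    have "((\<lambda>r. P \<mu> t (- a - r)) has_vector_derivative - P' \<mu> t (- a - r)) (at r)"
    proof -
      have "((\<lambda>r. - a - r) has_vector_derivative - 1) (at r)"
        by (auto intro!: derivative_eq_intros simp: has_real_derivative_iff_has_vector_derivative[symmetric])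
      from vector_diff_chain_at[OF this jet_solD(1)[OF P_sol]] show ?thesis by (simp add: o_def)
    qed
    then show "((\<lambda>r. P \<mu> t (- a - r)) has_vector_derivative - \<mu> * P \<mu> t (- a - r) + - G (- a - r)) (at r)"
      using P'[of "- a - r"] r by simp
    show "norm (- G (- a - r)) \<le> exp (0 * (r - 0)) * (8 * p ?\<tau> * exp (- \<alpha> * (- a - r - t)))"
      using G(1)[of "- a - r"] r assms by simp
    have "((\<lambda>r. p (?\<sigma> - r)) has_real_derivative - exp (- \<alpha> * (?\<sigma> - r))) (at r)"
    proof -
      have "((\<lambda>r. ?\<sigma> - r) has_real_derivative - 1) (at r)" by (auto intro!: derivative_eq_intros)
      from DERIV_chain2[OF moderate_deriv this] show ?thesis by simp
    qed
    from DERIV_minus[OF DERIV_cmult[OF this, of "8 * p ?\<tau> * exp (- \<alpha> * (x - t))"]]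
    show "(B has_real_derivative 8 * p ?\<tau> * exp (- \<alpha> * (- a - r - t))) (at r)"
      unfolding B_def[abs_def] by (simp add: algebra_simps flip: exp_add)
  qed (use pos kappa in auto)
  also have "\<dots> = 8 * p ?\<tau> * exp (- \<alpha> * (x - t)) * (p ?\<sigma> - 1)"
    by (simp add: B_def P_def algebra_simps)
  also have "\<dots> \<le> 8 * p ?\<tau> * exp (- \<alpha> * (x - t)) * p ?\<sigma>"
    using p_ge[OF pos(1)] by (intro mult_left_mono) auto
  finally have P: "norm (P \<mu> t x) \<le> 8 * (p ?\<tau> * p ?\<sigma> * exp (- \<alpha> * (x - t)))" by (simp add: ac_simps)
  let ?E = "p ?\<tau> * p ?\<sigma> * exp (- \<alpha> * (x - t))"
  have E0: "0 \<le> ?E" using p_nonneg[OF pos(1)] p_nonneg[OF pos(2)] by simp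
  have GE: "norm (G x) \<le> 8 * ?E" "norm (G' x) \<le> 12 * ?E"
  proof -
    have "p ?\<tau> * exp (- \<alpha> * (x - t)) * 1 \<le> p ?\<tau> * exp (- \<alpha> * (x - t)) * p ?\<sigma>"
      using p_ge[OF pos(1)] p_ge[OF pos(2)] by (intro mult_left_mono) auto
    then show "norm (G x) \<le> 8 * ?E" "norm (G' x) \<le> 12 * ?E" using G[OF assms] by (simp_all add: ac_simps)
  qed
  note mul = mu_mult_le
  have P1: "norm (P' \<mu> t x) \<le> 16 * ?E"
    using norm_triangle_ineq[of "\<mu> * P \<mu> t x" "G x"] mul[of "P \<mu> t x"] P GE unfolding P'[OF assms(2)] by linarith
  have "norm (P'' \<mu> t x) \<le> 28 * ?E"
    using norm_triangle_ineq[of "\<mu> * P' \<mu> t x" "G' x"] mul[of "P' \<mu> t x"] P1 GE unfolding P''[OF assms(2)] by linarith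
  then show ?thesis using P P1 E0 unfolding jet_le_def by (simp add: mult.assoc)
qed

lemma CK_ge:
  "(29 * CM * exp a) * (147 * CM * exp a) / w \<le> CK w" "99 * CM / w \<le> CK w"
  "180 * C3 w * exp (2 * a) \<le> CK w" "60 * CM / w + 28 \<le> CK w"
proof -
  have "0 \<le> (29 * CM * exp a) * (147 * CM * exp a) / w" "0 \<le> 99 * CM / w"
    "0 \<le> 180 * C3 w * exp (2 * a)" "0 \<le> 60 * CM / w + 28"
    using CM_ge w C3_pos by auto
  then show "(29 * CM * exp a) * (147 * CM * exp a) / w \<le> CK w" "99 * CM / w \<le> CK w"
    "180 * C3 w * exp (2 * a) \<le> CK w" "60 * CM / w + 28 \<le> CK w"
    unfolding CK_def by linarith+
qed

lemma CK_nonneg: "0 \<le> CK w"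
proof -
  have "0 \<le> 99 * CM / w" using CM_ge w by simp
  then show ?thesis using CK_ge(2) by (rule order_trans)
qed

text \<open>
  For \<open>x \<le> t\<close> the kernel is the product \<open>\<gamma>(x) \<delta>(t) / W\<close>. Each factor can contribute \<open>p\<^sup>2\<close>, but only one of them
  does: if \<open>x\<close> is to the right of the support then so is \<open>t\<close>, where \<open>\<delta>\<close> is a pure exponential, and
  \<open>p(x)\<^sup>2 \<le> p(x) p(t)\<close> since \<open>x \<le> t\<close>; the left side is symmetric. For \<open>t < x\<close> the outgoing condition, which
  holds to the right of the support, replaces quadratic by linear growth. For \<open>\<alpha> = 0\<close> the outcome is the bound
  \<open>(1 + \<bar>x\<bar>) (1 + \<bar>t\<bar>)\<close>, which is the reason for the exponent \<open>3/2\<close> in the weights.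
\<close>

lemma kernel_le:
  "jet_le (\<lambda>x. K \<mu> x t) (\<lambda>x. K' \<mu> x t) (\<lambda>x. K'' \<mu> x t) x (CK w * (p \<bar>x\<bar> * p \<bar>t\<bar>) * exp (- \<alpha> * \<bar>x - t\<bar>))"
proof -
  let ?Q = "p \<bar>x\<bar> * p \<bar>t\<bar>"
  have Q: "1 \<le> ?Q" using mult_mono[of 1 "p \<bar>x\<bar>" 1 "p \<bar>t\<bar>"] p_ge[of "\<bar>x\<bar>"] p_ge[of "\<bar>t\<bar>"] by simp
  have final: ?thesis if J: "jet_le (\<lambda>x. K \<mu> x t) (\<lambda>x. K' \<mu> x t) (\<lambda>x. K'' \<mu> x t) x (C * (P * E))"
    and "C \<le> CK w" "P \<le> ?Q" "E \<le> exp (- \<alpha> * \<bar>x - t\<bar>)" "0 \<le> C" "0 \<le> P" "0 \<le> E" for C P E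
  proof (rule jet_le_mono[OF J])
    have "C * (P * E) \<le> CK w * (?Q * exp (- \<alpha> * \<bar>x - t\<bar>))"
      using that Q by (intro mult_mono) auto
    then show "C * (P * E) \<le> CK w * ?Q * exp (- \<alpha> * \<bar>x - t\<bar>)" by (simp add: mult.assoc)
  qed
  have KT: "jet_le (\<lambda>x. K \<mu> x t) (\<lambda>x. K' \<mu> x t) (\<lambda>x. K'' \<mu> x t) x J"
    if "t < x" "jet_le (T \<mu> t) (T' \<mu> t) (T'' \<mu> t) x J" for J
    using that by (simp add: jet_le_def K_def K'_def K''_def T_def T'_def T''_def)
  consider (1) "x \<le> t" | (2) "a \<le> t" "t < x" | (3) "t \<le> a" "- a \<le> x" "t < x" | (4) "t < x" "x \<le> - a"
    by linarith
  then show ?thesis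
  proof cases
    case 1
    let ?X = "p (max 0 (x - a))" and ?Y = "p (max 0 (- a - t))"
    have XY: "1 \<le> ?X" "1 \<le> ?Y" by (auto intro!: p_ge)
    have c: "norm (\<delta> \<mu> t / W \<mu>) \<le> 147 * CM * exp a * ?Y\<^sup>2 * exp (- Re \<mu> * t) / w"
      by (rule order_trans[OF inverse_W]) (use delta_le[of t] w in \<open>intro divide_right_mono, auto\<close>)
    have "jet_le (\<lambda>x. K \<mu> x t) (\<lambda>x. K' \<mu> x t) (\<lambda>x. K'' \<mu> x t) x
      ((147 * CM * exp a * ?Y\<^sup>2 * exp (- Re \<mu> * t) / w) * (29 * CM * exp a * ?X\<^sup>2 * exp (Re \<mu> * x)))"
      using jet_le_cmult[OF gamma_le[of x] c] 1 by (simp add: jet_le_def K_def K'_def K''_def mult.commute)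
    also have "(147 * CM * exp a * ?Y\<^sup>2 * exp (- Re \<mu> * t) / w) * (29 * CM * exp a * ?X\<^sup>2 * exp (Re \<mu> * x))
      = ((29 * CM * exp a) * (147 * CM * exp a) / w) * ((?X\<^sup>2 * ?Y\<^sup>2) * (exp (Re \<mu> * x) * exp (- Re \<mu> * t)))"
      by (simp add: divide_inverse ac_simps)
    also have "exp (Re \<mu> * x) * exp (- Re \<mu> * t) = exp (- Re \<mu> * (t - x))"
      by (simp add: algebra_simps flip: exp_add)
    finally have J: "jet_le (\<lambda>x. K \<mu> x t) (\<lambda>x. K' \<mu> x t) (\<lambda>x. K'' \<mu> x t) x
      (((29 * CM * exp a) * (147 * CM * exp a) / w) * ((?X\<^sup>2 * ?Y\<^sup>2) * exp (- Re \<mu> * (t - x))))" .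
    show ?thesis
    proof (rule final[OF J CK_ge(1)])
      show "exp (- Re \<mu> * (t - x)) \<le> exp (- \<alpha> * \<bar>x - t\<bar>)"
        using 1 kappa(5) mult_right_mono[of \<alpha> "Re \<mu>" "t - x"] by (simp add: abs_if)
      consider "a < x" | "x \<le> a" "t < - a" | "x \<le> a" "- a \<le> t" by linarith
      then show "?X\<^sup>2 * ?Y\<^sup>2 \<le> ?Q"
      proof cases
        case i: 1
        then have "?X \<le> p \<bar>x\<bar>" "?X \<le> p \<bar>t\<bar>" "?Y = 1" using 1 a by (auto intro!: moderate_mono)
        then show ?thesis using XY by (simp add: power2_eq_square mult_mono)
      next
        case i: 2
        then have "?Y \<le> p \<bar>x\<bar>" "?Y \<le> p \<bar>t\<bar>" "?X = 1" using 1 a by (auto intro!: moderate_mono)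
        then show ?thesis using XY by (simp add: power2_eq_square mult_mono)
      next
        case 3
        then show ?thesis using Q by simp
      qed
    qed (use CM_ge w in auto)
  next
    case 2
    let ?Y = "p (t - a)"
    have Y: "1 \<le> ?Y" "1 \<le> p (x - t)" using 2 by (auto intro!: p_ge)
    have "norm (\<delta> \<mu> t / W \<mu>) \<le> exp (- Re \<mu> * (t - a)) / w"
      using inverse_W[of "\<delta> \<mu> t"] unfolding delta_right[OF 2(1)] .
    then have c: "norm (v * (\<delta> \<mu> t / W \<mu>)) \<le> B / w" if "norm v \<le> B * exp (Re \<mu> * (t - a))" for v B
    proof -
      have B: "0 \<le> B * exp (Re \<mu> * (t - a))" using norm_ge_zero that by (rule order_trans)
      assume "norm (\<delta> \<mu> t / W \<mu>) \<le> exp (- Re \<mu> * (t - a)) / w"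
      then have "norm v * norm (\<delta> \<mu> t / W \<mu>) \<le> (B * exp (Re \<mu> * (t - a))) * (exp (- Re \<mu> * (t - a)) / w)"
        using that B by (intro mult_mono) auto
      also have "\<dots> = B / w" by (simp add: exp_minus)
      finally show ?thesis by (simp add: norm_mult norm_divide)
    qed
    have T0: "norm (T \<mu> t t) \<le> 29 * CM * ?Y\<^sup>2 / w"
      using c[of "\<gamma> \<mu> t" "29 * CM * ?Y\<^sup>2"] gamma_right_le(1)[OF 2(1)] by (simp add: T_def jet_le_def)
    have "T' \<mu> t t - l1 * T \<mu> t t = (\<gamma>' \<mu> t - l1 * \<gamma> \<mu> t) * (\<delta> \<mu> t / W \<mu>)"
      by (simp only: T_def T'_def S_diag diff_zero left_diff_distrib mult.assoc)
    then have T1: "norm (T' \<mu> t t - l1 * T \<mu> t t) \<le> 4 * CM * ?Y / w"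
      using c[OF gamma_right_le(2)[OF 2(1)]] by simp
    have out: "T'' \<mu> t t + \<mu> * T' \<mu> t t + \<mu>\<^sup>2 * T \<mu> t t = 0"
      using outgoing_propagates[OF T_sol order_refl 2(1)] T_outgoing[OF W_ne] by simp
    have "jet_le (T \<mu> t) (T' \<mu> t) (T'' \<mu> t) x
        (3 * (29 * CM * ?Y\<^sup>2 / w + 4 * CM * ?Y / w * p (x - t)) * exp (- \<alpha> * (x - t)))"
      using outgoing_bound[OF T_sol 2(1) _ out T0 T1] 2(2) by simp
    moreover have "3 * (29 * CM * ?Y\<^sup>2 / w + 4 * CM * ?Y / w * p (x - t)) * exp (- \<alpha> * (x - t))
        \<le> 99 * CM / w * (?Q * exp (- \<alpha> * (x - t)))"
    proof -
      have "?Y \<le> p \<bar>x\<bar>" "?Y \<le> p \<bar>t\<bar>" "p (x - t) \<le> p \<bar>x\<bar>" using 2 a by (auto intro!: moderate_mono)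
      then have "?Y\<^sup>2 \<le> ?Q" "?Y * p (x - t) \<le> ?Q"
        using Y mult_mono[of ?Y "p \<bar>t\<bar>" "p (x - t)" "p \<bar>x\<bar>"] by (simp_all add: power2_eq_square mult_mono mult.commute)
      then have "3 * (29 * CM / w * ?Y\<^sup>2 + 4 * CM / w * (?Y * p (x - t))) \<le> 3 * (29 * CM / w * ?Q + 4 * CM / w * ?Q)"
        using CM_ge w by (intro mult_left_mono add_mono) auto
      also have "\<dots> = 99 * CM / w * ?Q" by (simp add: algebra_simps)
      finally have "3 * (29 * CM / w * ?Y\<^sup>2 + 4 * CM / w * (?Y * p (x - t))) * exp (- \<alpha> * (x - t))
        \<le> 99 * CM / w * ?Q * exp (- \<alpha> * (x - t))" by (rule mult_right_mono) simp
      then show ?thesis by (simp add: mult.assoc)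
    qed
    ultimately have "jet_le (T \<mu> t) (T' \<mu> t) (T'' \<mu> t) x (99 * CM / w * (?Q * exp (- \<alpha> * (x - t))))"
      by (rule jet_le_mono)
    from final[OF KT[OF 2(2) this] CK_ge(2)] show ?thesis using 2 Q CM_ge w by (auto simp: abs_if)
  next
    case 3
    let ?X = "p (max 0 (x - a))" and ?Y = "p (max 0 (- a - t))"
    have "?X \<le> p \<bar>x\<bar>" "?Y \<le> p \<bar>t\<bar>" using a by (auto intro!: moderate_mono)
    moreover have XY: "0 \<le> ?X" "0 \<le> ?Y" by (auto intro!: p_nonneg)
    ultimately have "?Y * ?X \<le> ?Q" using mult_mono[of ?X "p \<bar>x\<bar>" ?Y "p \<bar>t\<bar>"] by (simp add: mult.commute)
    moreover have "exp (- \<alpha> * (max 0 (- a - t) + max 0 (x - a))) \<le> exp (2 * a) * exp (- \<alpha> * \<bar>x - t\<bar>)"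
    proof -
      have "\<alpha> * (x - t) \<le> \<alpha> * (max 0 (- a - t) + max 0 (x - a) + 2 * a)"
        using alpha by (intro mult_left_mono) auto
      moreover have "\<alpha> * (2 * a) \<le> 1 * (2 * a)" using kappa a by (intro mult_right_mono) auto
      ultimately show ?thesis using 3 by (simp add: abs_if distrib_left flip: exp_add)
    qed
    moreover have "0 \<le> ?Y * ?X" using XY by simp
    ultimately have "180 * C3 w * ((?Y * ?X) * exp (- \<alpha> * (max 0 (- a - t) + max 0 (x - a))))
      \<le> 180 * C3 w * (?Q * (exp (2 * a) * exp (- \<alpha> * \<bar>x - t\<bar>)))"
      using C3_pos Q by (intro mult_left_mono mult_mono[of "?Y * ?X" ?Q]) auto
    then have "jet_le (T \<mu> t) (T' \<mu> t) (T'' \<mu> t) x (180 * C3 w * exp (2 * a) * (?Q * exp (- \<alpha> * \<bar>x - t\<bar>)))"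
      using T_right_le[OF 3(1,2)] by (elim jet_le_mono) (simp add: ac_simps)
    from final[OF KT[OF 3(3) this] CK_ge(3)] show ?thesis using Q C3_pos by auto
  next
    case 4
    let ?X = "p (- a - x)" and ?Y = "p (- a - t)"
    have XY: "1 \<le> ?X" "1 \<le> ?Y" using 4 by (auto intro!: p_ge)
    have "?X \<le> p \<bar>x\<bar>" "?Y \<le> p \<bar>t\<bar>" using a 4 by (auto intro!: moderate_mono)
    then have YX: "?Y * ?X \<le> ?Q" using XY mult_mono[of ?X "p \<bar>x\<bar>" ?Y "p \<bar>t\<bar>"] by (simp add: mult.commute)
    have r: "norm (\<rho> \<mu> t / W \<mu>) \<le> 60 * CM * ?Y * exp (- \<alpha> * (- a - t)) / w"
      by (rule order_trans[OF inverse_W]) (use rho_le[of t] 4 w in \<open>intro divide_right_mono, auto\<close>)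
    have "jet_le (\<gamma> \<mu>) (\<gamma>' \<mu>) (\<gamma>'' \<mu>) x 1"
      by (rule jet_le_mono[OF gamma_left_le[OF 4(2)]]) (use 4 kappa in \<open>auto intro!: mult_nonneg_nonpos\<close>)
    from jet_le_diff[OF jet_le_cmult[OF this r] P_left_le[OF _ 4(2), of t]]
    have "jet_le (T \<mu> t) (T' \<mu> t) (T'' \<mu> t) x (60 * CM * ?Y * exp (- \<alpha> * (- a - t)) / w * 1
       + 28 * ?Y * ?X * exp (- \<alpha> * (x - t)))"
      using 4(1) by (simp add: T_split[OF W_ne, abs_def])
    moreover have "60 * CM * ?Y * exp (- \<alpha> * (- a - t)) / w * 1 \<le> 60 * CM * (?Y * ?X) * exp (- \<alpha> * (x - t)) / w * 1"
    proof -
      have "?Y * 1 \<le> ?Y * ?X" using XY by (intro mult_left_mono) auto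
      moreover have "exp (- \<alpha> * (- a - t)) \<le> exp (- \<alpha> * (x - t))" using 4 alpha by (auto intro!: mult_left_mono)
      ultimately show ?thesis using CM_ge w XY by (intro mult_right_mono divide_right_mono mult_mono) auto
    qed
    ultimately have "jet_le (T \<mu> t) (T' \<mu> t) (T'' \<mu> t) x ((60 * CM / w + 28) * ((?Y * ?X) * exp (- \<alpha> * (x - t))))"
      by (elim jet_le_mono) (simp add: algebra_simps add_divide_distrib)
    from final[OF KT[OF 4(1) this] CK_ge(4) YX] show ?thesis using 4 XY CM_ge w by (auto simp: abs_if)
  qed
qed

end

section \<open>Integral operators on weighted spaces\<close>

lemma japanese_ge: "1 \<le> japanese x" "0 < japanese x" "\<bar>x\<bar> \<le> japanese x"
proof -
  have "sqrt 1 \<le> japanese x" unfolding japanese_def by (rule real_sqrt_le_mono) simp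
  then show "1 \<le> japanese x" by simp
  then show "0 < japanese x" by simp
  have "sqrt (x\<^sup>2) \<le> japanese x" unfolding japanese_def by (rule real_sqrt_le_mono) simp
  then show "\<bar>x\<bar> \<le> japanese x" by simp
qed

lemma japanese_ne_0 [simp]: "japanese x \<noteq> 0"
  using japanese_ge(2)[of x] by simp

lemma japanese_measurable [measurable]: "japanese \<in> borel_measurable borel"
  unfolding japanese_def[abs_def] by measurable

lemma integrable_powr_half_line:
  fixes r :: real
  assumes "r < - 1"
  shows "integrable lborel (\<lambda>x. indicator {1..} x * x powr r)"
proof -
  have "(\<lambda>x. x powr r) integrable_on {1..}"
    using has_integral_powr_to_inf[of r 1] assms by (auto simp: integrable_on_def)
  then have "(\<lambda>x. x powr r) absolutely_integrable_on {1..}"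
    by (rule nonnegative_absolutely_integrable_1) simp
  then have "integrable lebesgue (\<lambda>x. indicator {1..} x * x powr r)"
    by (simp add: set_integrable_def)
  then show ?thesis by (subst (asm) integrable_completion) auto
qed

lemma integrable_japanese_powr:
  fixes r :: real
  assumes "r < - 1"
  shows "integrable lborel (\<lambda>x. japanese x powr r)"
proof -
  let ?F = "\<lambda>x::real. indicator {1..} x * x powr r"
  have "integrable lborel (\<lambda>x. ?F (1 + 1 * x))" "integrable lborel (\<lambda>x. ?F (1 + (-1) * x))"
    using lborel_integrable_real_affine[OF integrable_powr_half_line[OF assms], of 1 1]
      lborel_integrable_real_affine[OF integrable_powr_half_line[OF assms], of "-1" 1] by simp_all
  then have "integrable lborel (\<lambda>x. (1/2) powr r * (?F (1 + 1 * x) + ?F (1 + (-1) * x)))"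
    by (intro integrable_mult_right Bochner_Integration.integrable_add)
  then show ?thesis
  proof (rule Bochner_Integration.integrable_bound)
    show "AE x in lborel. norm (japanese x powr r) \<le> norm ((1/2) powr r * (?F (1 + 1 * x) + ?F (1 + (-1) * x)))"
    proof (rule AE_I2)
      fix x :: real
      have "(1 / 2) * (1 + \<bar>x\<bar>) \<le> japanese x" using japanese_ge(1,3)[of x] by (simp add: field_simps)
      then have "japanese x powr r \<le> ((1 / 2) * (1 + \<bar>x\<bar>)) powr r"
        using assms by (intro powr_mono2') auto
      also have "\<dots> = (1 / 2) powr r * (1 + \<bar>x\<bar>) powr r" by (rule powr_mult) 
      also have "(1 + \<bar>x\<bar>) powr r \<le> ?F (1 + 1 * x) + ?F (1 + (-1) * x)"
        by (cases "0 \<le> x") (auto simp: indicator_def)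
      finally show "norm (japanese x powr r) \<le> norm ((1/2) powr r * (?F (1 + 1 * x) + ?F (1 + (-1) * x)))"
        by simp
    qed
  qed simp
qed

text \<open>
  The quadratic polynomial \<open>t \<mapsto> \<integral> (f + t g)\<^sup>2\<close> is nonnegative.
\<close>

lemma Cauchy_Schwarz_integral:
  fixes f g :: "'a \<Rightarrow> real"
  assumes [measurable]: "f \<in> borel_measurable M" "g \<in> borel_measurable M"
    and f: "integrable M (\<lambda>x. (f x)\<^sup>2)" and g: "integrable M (\<lambda>x. (g x)\<^sup>2)"
  shows "integrable M (\<lambda>x. f x * g x)"
    and "(LINT x|M. f x * g x)\<^sup>2 \<le> (LINT x|M. (f x)\<^sup>2) * (LINT x|M. (g x)\<^sup>2)"
proof -
  show fg: "integrable M (\<lambda>x. f x * g x)"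
  proof (rule Bochner_Integration.integrable_bound)
    show "integrable M (\<lambda>x. (f x)\<^sup>2 + (g x)\<^sup>2)" using f g by simp
    show "AE x in M. norm (f x * g x) \<le> norm ((f x)\<^sup>2 + (g x)\<^sup>2)"
    proof (rule AE_I2)
      fix x
      have "2 * (\<bar>f x\<bar> * \<bar>g x\<bar>) \<le> (f x)\<^sup>2 + (g x)\<^sup>2"
        using sum_squares_bound[of "\<bar>f x\<bar>" "\<bar>g x\<bar>"] by simp
      moreover have "0 \<le> \<bar>f x\<bar> * \<bar>g x\<bar>" by simp
      ultimately have "\<bar>f x\<bar> * \<bar>g x\<bar> \<le> (f x)\<^sup>2 + (g x)\<^sup>2" by linarith
      then show "norm (f x * g x) \<le> norm ((f x)\<^sup>2 + (g x)\<^sup>2)" by (simp add: abs_mult)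
    qed
  qed simp
  define A B C where "A = (LINT x|M. (f x)\<^sup>2)" and "B = (LINT x|M. (g x)\<^sup>2)" and "C = (LINT x|M. f x * g x)"
  have quad: "0 \<le> A + 2 * t * C + t\<^sup>2 * B" for t
  proof -
    have "0 \<le> (LINT x|M. (f x + t * g x)\<^sup>2)" by simp
    also have "(LINT x|M. (f x + t * g x)\<^sup>2) = (LINT x|M. (f x)\<^sup>2 + 2 * t * (f x * g x) + t\<^sup>2 * (g x)\<^sup>2)"
      by (intro Bochner_Integration.integral_cong refl) (simp add: power2_eq_square algebra_simps)
    also have "\<dots> = A + 2 * t * C + t\<^sup>2 * B"
      using f g fg by (simp add: A_def B_def C_def)
    finally show ?thesis .
  qed
  have "C\<^sup>2 \<le> A * B"
  proof (cases "B = 0")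
    case True
    have "C = 0"
    proof (rule ccontr)
      assume "C \<noteq> 0"
      then show False using quad[of "- (A + 1) / (2 * C)"] True \<open>C \<noteq> 0\<close> by (simp add: field_simps)
    qed
    then show ?thesis using True by simp
  next
    case False
    have "0 \<le> B" by (simp add: B_def)
    with False have "B > 0" by simp
    have "0 \<le> (A + 2 * (- C / B) * C + (- C / B)\<^sup>2 * B) * B"
      using quad[of "- C / B"] \<open>B > 0\<close> by (intro mult_nonneg_nonneg) auto
    also have "\<dots> = A * B - C\<^sup>2" using \<open>B > 0\<close> by (simp add: field_simps power2_eq_square)
    finally show ?thesis by simp
  qed
  then show "(LINT x|M. f x * g x)\<^sup>2 \<le> (LINT x|M. (f x)\<^sup>2) * (LINT x|M. (g x)\<^sup>2)"
    by (simp add: A_def B_def C_def)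
qed

definition kernel_op :: "(real \<Rightarrow> real \<Rightarrow> complex) \<Rightarrow> (real \<Rightarrow> complex) \<Rightarrow> real \<Rightarrow> complex" where
  "kernel_op k f x = (LINT y|lborel. k x y * f y)"

lemma L2_measurable: "f \<in> L2 s \<Longrightarrow> f \<in> borel_measurable borel"
  by (simp add: L2_def)

lemma L2_0: "f \<in> L2 0 \<longleftrightarrow> f \<in> borel_measurable borel \<and> integrable lborel (\<lambda>x. (norm (f x))\<^sup>2)"
  by (simp add: L2_def)

lemma norm_L2_0: "norm_L2 0 f = sqrt (LINT x|lborel. (norm (f x))\<^sup>2)"
  by (simp add: norm_L2_def)

lemma norm_L2_nonneg [simp]: "0 \<le> norm_L2 s f"
  by (simp add: norm_L2_def)

lemma norm_L2_power2: "(norm_L2 s f)\<^sup>2 = (LINT x|lborel. (japanese x powr s * norm (f x))\<^sup>2)"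
  by (simp add: norm_L2_def)

lemma integrable_norm_le:
  fixes f :: "'a \<Rightarrow> complex"
  assumes "f \<in> borel_measurable M" "integrable M g" "\<And>x. norm (f x) \<le> g x"
  shows "integrable M f"
  by (rule Bochner_Integration.integrable_bound[OF assms(2)])
    (use assms in \<open>auto intro!: AE_I2 order_trans[OF assms(3)]\<close>)

locale measurable_kernel =
  fixes k :: "real \<Rightarrow> real \<Rightarrow> complex"
  assumes k_meas: "(\<lambda>(x, y). k x y) \<in> borel_measurable (lborel \<Otimes>\<^sub>M lborel)"
begin

lemma k_meas_borel [measurable]: "(\<lambda>(x, y). k x y) \<in> borel_measurable (borel \<Otimes>\<^sub>M borel)"
  using k_meas by (simp cong: measurable_cong_sets sets_pair_measure_cong)

lemma k_section [measurable]: "k x \<in> borel_measurable borel"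
  using measurable_compose[OF measurable_Pair1' k_meas_borel, of x] by (simp add: space_pair_measure)

lemma kernel_op_measurable [measurable]:
  assumes [measurable]: "f \<in> borel_measurable borel"
  shows "kernel_op k f \<in> borel_measurable borel"
proof -
  have "(\<lambda>x. LINT y|lborel. (case (x, y) of (x, y) \<Rightarrow> k x y * f y)) \<in> borel_measurable borel"
    by (rule lborel.borel_measurable_lebesgue_integral) measurable
  then show ?thesis by (simp add: kernel_op_def[abs_def])
qed

end

text \<open>
  The weights turn such a kernel into a Hilbert-Schmidt kernel, since
  \<open>\<langle>x\<rangle>\<^bsup>1 - s\<^esup>\<close> is square integrable for \<open>s > 3/2\<close>.
\<close>

locale moderate_kernel = measurable_kernel +
  fixes C s s' :: real
  assumes k_le: "\<And>x y. norm (k x y) \<le> C * japanese x * japanese y"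
    and s: "s > 3 / 2" and s': "s' > 3 / 2"
begin

lemma C_nonneg: "0 \<le> C"
  using order_trans[OF norm_ge_zero k_le[of 0 0]] by (simp add: japanese_def)

definition w2 where "w2 x y = (japanese x powr (- s') * norm (k x y) * japanese y powr (- s))\<^sup>2"

lemma w2_le: "w2 x y \<le> C\<^sup>2 * (japanese x powr (2 - 2 * s') * japanese y powr (2 - 2 * s))"
proof -
  have "japanese x powr (- s') * norm (k x y) * japanese y powr (- s)
    \<le> japanese x powr (- s') * (C * japanese x * japanese y) * japanese y powr (- s)"
    by (intro mult_right_mono mult_left_mono k_le) auto
  also have "\<dots> = C * (japanese x powr (1 - s') * japanese y powr (1 - s))"
  proof -
    have "japanese x powr (1 - s') = japanese x * japanese x powr (- s')"
      "japanese y powr (1 - s) = japanese y * japanese y powr (- s)"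
      using powr_mult_base[of "japanese x" "- s'"] powr_mult_base[of "japanese y" "- s"]
        japanese_ge(2)[of x] japanese_ge(2)[of y] by simp_all
    then show ?thesis by (simp only: ac_simps)
  qed
  finally have "w2 x y \<le> (C * (japanese x powr (1 - s') * japanese y powr (1 - s)))\<^sup>2"
    unfolding w2_def by (intro power_mono) auto
  also have "\<dots> = C\<^sup>2 * (japanese x powr (2 - 2 * s') * japanese y powr (2 - 2 * s))"
    by (simp add: power_mult_distrib powr_power left_diff_distrib mult.commute)
  finally show ?thesis .
qed

lemma weight_integrable:
  "integrable lborel (\<lambda>x. japanese x powr (2 - 2 * s'))" "integrable lborel (\<lambda>x. japanese x powr (2 - 2 * s))"
  using s s' by (auto intro!: integrable_japanese_powr)

lemma w2_measurable [measurable]: "(\<lambda>(x, y). w2 x y) \<in> borel_measurable (borel \<Otimes>\<^sub>M borel)"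
  unfolding w2_def by measurable

lemma dominating_integrable:
  "integrable (lborel \<Otimes>\<^sub>M lborel) (\<lambda>(x, y). C\<^sup>2 * (japanese x powr (2 - 2 * s') * japanese y powr (2 - 2 * s)))"
proof -
  show ?thesis
  proof (rule lborel_pair.Fubini_integrable)
    show "(\<lambda>(x, y). C\<^sup>2 * (japanese x powr (2 - 2 * s') * japanese y powr (2 - 2 * s)))
      \<in> borel_measurable (lborel \<Otimes>\<^sub>M lborel)" by measurable
  qed (use weight_integrable in auto)
qed

lemma w2_integrable: "integrable (lborel \<Otimes>\<^sub>M lborel) (\<lambda>(x, y). w2 x y)"
  by (rule Bochner_Integration.integrable_bound[OF dominating_integrable])
    (use w2_le in \<open>auto intro!: AE_I2 simp: w2_def\<close>)

text \<open>
  The square of the Hilbert-Schmidt norm of the weighted kernel.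
\<close>

definition HS where "HS = (LINT z|(lborel \<Otimes>\<^sub>M lborel). (case z of (x, y) \<Rightarrow> w2 x y))"

lemma HS_nonneg: "0 \<le> HS"
  unfolding HS_def by (rule Bochner_Integration.integral_nonneg) (auto simp: w2_def)

lemma kernel_op_pointwise:
  assumes f: "f \<in> L2 s"
  shows "integrable lborel (\<lambda>y. k x y * f y)"
    and "(japanese x powr (- s') * norm (kernel_op k f x))\<^sup>2 \<le> (LINT y|lborel. w2 x y) * (norm_L2 s f)\<^sup>2"
proof -
  have [measurable]: "f \<in> borel_measurable borel" using f by (rule L2_measurable)
  let ?a = "\<lambda>y. japanese x powr (- s') * norm (k x y) * japanese y powr (- s)"
  let ?b = "\<lambda>y. japanese y powr s * norm (f y)"
  have jx: "0 < japanese x powr (- s')" using japanese_ge(2)[of x] by simp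
  have ab: "?a y * ?b y = japanese x powr (- s') * norm (k x y * f y)" for y
    using japanese_ge(2)[of y] by (simp add: powr_minus norm_mult field_simps)
  have b2: "integrable lborel (\<lambda>y. (?b y)\<^sup>2)" using f by (simp add: L2_def)
  have a2: "integrable lborel (\<lambda>y. (?a y)\<^sup>2)"
  proof (rule Bochner_Integration.integrable_bound)
    show "integrable lborel (\<lambda>y. C\<^sup>2 * (japanese x powr (2 - 2 * s') * japanese y powr (2 - 2 * s)))"
      using weight_integrable by simp
  qed (use w2_le[of x] in \<open>auto intro!: AE_I2 simp: w2_def\<close>)
  have "integrable lborel (\<lambda>y. ?a y * ?b y)"
    and cs: "(LINT y|lborel. ?a y * ?b y)\<^sup>2 \<le> (LINT y|lborel. (?a y)\<^sup>2) * (LINT y|lborel. (?b y)\<^sup>2)"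
    by (rule Cauchy_Schwarz_integral[OF _ _ a2 b2]; measurable)+
  then have "integrable lborel (\<lambda>y. norm (k x y * f y))" unfolding ab using jx by simp
  then show I: "integrable lborel (\<lambda>y. k x y * f y)"
    by (subst (asm) integrable_norm_iff) auto
  have "japanese x powr (- s') * norm (kernel_op k f x) \<le> (LINT y|lborel. ?a y * ?b y)"
    unfolding kernel_op_def ab using jx integral_norm_bound[of lborel "\<lambda>y. k x y * f y"] by simp
  then have "(japanese x powr (- s') * norm (kernel_op k f x))\<^sup>2 \<le> (LINT y|lborel. ?a y * ?b y)\<^sup>2"
    by (intro power_mono) auto
  also note cs
  finally show "(japanese x powr (- s') * norm (kernel_op k f x))\<^sup>2 \<le> (LINT y|lborel. w2 x y) * (norm_L2 s f)\<^sup>2"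
    by (simp add: w2_def norm_L2_power2)
qed

lemma kernel_op_bound:
  assumes f: "f \<in> L2 s"
  shows "kernel_op k f \<in> L2 (- s')" and "norm_L2 (- s') (kernel_op k f) \<le> sqrt HS * norm_L2 s f"
proof -
  have [measurable]: "f \<in> borel_measurable borel" using f by (rule L2_measurable)
  have w: "integrable lborel (\<lambda>x. (LINT y|lborel. w2 x y) * (norm_L2 s f)\<^sup>2)"
    using lborel_pair.integrable_fst'[OF w2_integrable] by simp
  have I: "integrable lborel (\<lambda>x. (japanese x powr (- s') * norm (kernel_op k f x))\<^sup>2)"
    by (rule Bochner_Integration.integrable_bound[OF w])
      (use kernel_op_pointwise(2)[OF f] in \<open>auto intro!: AE_I2 order_trans[OF kernel_op_pointwise(2)[OF f] abs_ge_self]\<close>)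
  then show "kernel_op k f \<in> L2 (- s')" by (simp add: L2_def)
  have "(LINT x|lborel. (japanese x powr (- s') * norm (kernel_op k f x))\<^sup>2)
    \<le> (LINT x|lborel. (LINT y|lborel. w2 x y) * (norm_L2 s f)\<^sup>2)"
    by (intro integral_mono I w kernel_op_pointwise(2)[OF f])
  also have "\<dots> = HS * (norm_L2 s f)\<^sup>2"
    using lborel_pair.integral_fst'[OF w2_integrable] by (simp add: HS_def)
  finally have "norm_L2 (- s') (kernel_op k f) \<le> sqrt (HS * (norm_L2 s f)\<^sup>2)"
    unfolding norm_L2_def[of "- s'"] by (rule real_sqrt_le_mono)
  then show "norm_L2 (- s') (kernel_op k f) \<le> sqrt HS * norm_L2 s f"
    by (simp add: real_sqrt_mult)
qed

end

text \<open>
  Schur's test: a kernel that decays exponentially off the diagonal is bounded on \<open>L\<^sup>2\<close>.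
\<close>

locale exponential_kernel = measurable_kernel +
  fixes C \<alpha> :: real
  assumes k_le: "\<And>x y. norm (k x y) \<le> C * exp (- \<alpha> * \<bar>x - y\<bar>)"
    and alpha: "\<alpha> > 0"
begin

lemma C_nonneg: "0 \<le> C"
  using order_trans[OF norm_ge_zero k_le[of 0 0]] by simp

lemma exp_integrable: "integrable lborel (\<lambda>y. exp (- \<alpha> * \<bar>x - y\<bar>))"
proof -
  have 1: "integrable lborel (\<lambda>t. indicator {0..} t * exp (- \<alpha> * t))"
  proof -
    have "(\<lambda>t. exp (- \<alpha> * t)) absolutely_integrable_on {0..}"
      by (rule nonnegative_absolutely_integrable_1[OF integrable_on_exp_minus_to_infinity[OF alpha]]) simp
    then have "integrable lebesgue (\<lambda>t. indicator {0..} t * exp (- \<alpha> * t))"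
      by (simp add: set_integrable_def)
    then show ?thesis by (subst (asm) integrable_completion) auto
  qed
  let ?F = "\<lambda>t::real. indicator {0..} t * exp (- \<alpha> * t)"
  have "integrable lborel (\<lambda>y. ?F (x + (-1) * y))" "integrable lborel (\<lambda>y. ?F (- x + 1 * y))"
    using lborel_integrable_real_affine[OF 1, of "-1" x] lborel_integrable_real_affine[OF 1, of 1 "-x"] by simp_all
  then have "integrable lborel (\<lambda>y. ?F (x + (-1) * y) + ?F (- x + 1 * y))"
    by (rule Bochner_Integration.integrable_add)
  then show ?thesis
    by (rule Bochner_Integration.integrable_bound) (auto intro!: AE_I2 simp: indicator_def abs_if)
qed

definition I where "I = (LINT y|lborel. exp (- \<alpha> * \<bar>y\<bar>))"

lemma exp_integral: "(LINT y|lborel. exp (- \<alpha> * \<bar>x - y\<bar>)) = I" "(LINT x|lborel. exp (- \<alpha> * \<bar>x - y\<bar>)) = I"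
  using lborel_integral_real_affine[of "-1" "\<lambda>y. exp (- \<alpha> * \<bar>y\<bar>)" x]
    lborel_integral_real_affine[of 1 "\<lambda>y. exp (- \<alpha> * \<bar>y\<bar>)" "- y"] by (simp_all add: I_def)

lemma exp_nn_integral: "(\<integral>\<^sup>+x. ennreal (exp (- \<alpha> * \<bar>x - y\<bar>)) \<partial>lborel) = ennreal I"
  using nn_integral_eq_integral[OF exp_integrable[of y]] exp_integral(1)[of y]
  by (simp add: abs_minus_commute)

lemma I_nonneg: "0 \<le> I" by (simp add: I_def)

lemma kernel_op_pointwise:
  assumes f: "f \<in> L2 0"
  shows "integrable lborel (\<lambda>y. exp (- \<alpha> * \<bar>x - y\<bar>) * norm (f y))"
    and "integrable lborel (\<lambda>y. k x y * f y)"
    and "integrable lborel (\<lambda>y. exp (- \<alpha> * \<bar>x - y\<bar>) * (norm (f y))\<^sup>2)"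
    and "(LINT y|lborel. exp (- \<alpha> * \<bar>x - y\<bar>) * norm (f y))\<^sup>2 \<le> I * (LINT y|lborel. exp (- \<alpha> * \<bar>x - y\<bar>) * (norm (f y))\<^sup>2)"
    and "norm (kernel_op k f x) \<le> C * (LINT y|lborel. exp (- \<alpha> * \<bar>x - y\<bar>) * norm (f y))"
proof -
  have [measurable]: "f \<in> borel_measurable borel" using f by (rule L2_measurable)
  let ?h = "\<lambda>y. exp (- \<alpha> / 2 * \<bar>x - y\<bar>)"
  let ?e = "\<lambda>y. exp (- \<alpha> * \<bar>x - y\<bar>)"
  have h2: "(?h y)\<^sup>2 = ?e y" for y by (simp flip: exp_double)
  have f2: "integrable lborel (\<lambda>y. (norm (f y))\<^sup>2)" using f by (simp add: L2_0)
  have ef2: "integrable lborel (\<lambda>y. ?e y * (norm (f y))\<^sup>2)"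
    by (rule Bochner_Integration.integrable_bound[OF f2])
      (use alpha in \<open>auto intro!: AE_I2 mult_left_le_one_le\<close>)
  then show "integrable lborel (\<lambda>y. ?e y * (norm (f y))\<^sup>2)" .
  have *: "?h y * (?h y * norm (f y)) = ?e y * norm (f y)" for y
    by (simp only: h2[symmetric] power2_eq_square mult.assoc)
  have h: "integrable lborel (\<lambda>y. (?h y)\<^sup>2)" unfolding h2 by (rule exp_integrable)
  have hf: "integrable lborel (\<lambda>y. (?h y * norm (f y))\<^sup>2)" unfolding power_mult_distrib h2 by (rule ef2)
  have 1: "integrable lborel (\<lambda>y. ?h y * (?h y * norm (f y)))"
    and 2: "(LINT y|lborel. ?h y * (?h y * norm (f y)))\<^sup>2
      \<le> (LINT y|lborel. (?h y)\<^sup>2) * (LINT y|lborel. (?h y * norm (f y))\<^sup>2)"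
    by (rule Cauchy_Schwarz_integral[OF _ _ h hf]; measurable)+
  show ef: "integrable lborel (\<lambda>y. ?e y * norm (f y))" using 1 unfolding * .
  show "(LINT y|lborel. ?e y * norm (f y))\<^sup>2 \<le> I * (LINT y|lborel. ?e y * (norm (f y))\<^sup>2)"
    using 2 unfolding * power_mult_distrib h2 exp_integral .
  have le: "norm (k x y * f y) \<le> C * (?e y * norm (f y))" for y
    using mult_right_mono[OF k_le[of x y], of "norm (f y)"] by (simp add: norm_mult mult.assoc)
  show kf: "integrable lborel (\<lambda>y. k x y * f y)"
    by (rule integrable_norm_le[OF _ integrable_mult_right[OF ef] le]) measurable
  have "norm (kernel_op k f x) \<le> (LINT y|lborel. norm (k x y * f y))"
    unfolding kernel_op_def by (rule integral_norm_bound)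
  also have "\<dots> \<le> (LINT y|lborel. C * (?e y * norm (f y)))"
    by (intro integral_mono integrable_norm kf integrable_mult_right ef le)
  finally show "norm (kernel_op k f x) \<le> C * (LINT y|lborel. ?e y * norm (f y))" by simp
qed

lemma kernel_op_bound:
  assumes f: "f \<in> L2 0"
  shows "kernel_op k f \<in> L2 0" and "norm_L2 0 (kernel_op k f) \<le> C * I * norm_L2 0 f"
proof -
  have [measurable]: "f \<in> borel_measurable borel" using f by (rule L2_measurable)
  let ?e = "\<lambda>x y. exp (- \<alpha> * \<bar>x - y\<bar>)"
  have f2: "integrable lborel (\<lambda>y. (norm (f y))\<^sup>2)" using f by (simp add: L2_0)
  have "(norm (kernel_op k f x))\<^sup>2 \<le> C\<^sup>2 * (I * (LINT y|lborel. ?e x y * (norm (f y))\<^sup>2))" for x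
  proof -
    have "(norm (kernel_op k f x))\<^sup>2 \<le> (C * (LINT y|lborel. ?e x y * norm (f y)))\<^sup>2"
      by (intro power_mono kernel_op_pointwise f) auto
    also have "\<dots> \<le> C\<^sup>2 * (I * (LINT y|lborel. ?e x y * (norm (f y))\<^sup>2))"
      unfolding power_mult_distrib by (intro mult_left_mono kernel_op_pointwise f) auto
    finally show ?thesis .
  qed
  then have "(\<integral>\<^sup>+x. ennreal ((norm (kernel_op k f x))\<^sup>2) \<partial>lborel)
    \<le> (\<integral>\<^sup>+x. ennreal (C\<^sup>2 * (I * (LINT y|lborel. ?e x y * (norm (f y))\<^sup>2))) \<partial>lborel)"
    by (intro nn_integral_mono ennreal_leI)
  also have "\<dots> = (\<integral>\<^sup>+x. ennreal (C\<^sup>2 * I) * (\<integral>\<^sup>+y. ennreal (?e x y * (norm (f y))\<^sup>2) \<partial>lborel) \<partial>lborel)"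
    by (subst nn_integral_eq_integral[OF kernel_op_pointwise(3)[OF f]])
      (auto simp: I_nonneg simp flip: ennreal_mult mult.assoc)
  also have "\<dots> = ennreal (C\<^sup>2 * I) * (\<integral>\<^sup>+x. (\<integral>\<^sup>+y. ennreal (?e x y * (norm (f y))\<^sup>2) \<partial>lborel) \<partial>lborel)"
    by (rule nn_integral_cmult) measurable
  also have "(\<integral>\<^sup>+x. (\<integral>\<^sup>+y. ennreal (?e x y * (norm (f y))\<^sup>2) \<partial>lborel) \<partial>lborel)
     = (\<integral>\<^sup>+y. (\<integral>\<^sup>+x. ennreal (?e x y * (norm (f y))\<^sup>2) \<partial>lborel) \<partial>lborel)"
    by (rule lborel_pair.Fubini'[symmetric]) measurable
  also have "\<dots> = (\<integral>\<^sup>+y. ennreal I * ennreal ((norm (f y))\<^sup>2) \<partial>lborel)"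
    by (simp add: ennreal_mult nn_integral_multc exp_nn_integral[simplified])
  also have "\<dots> = ennreal I * ennreal (LINT y|lborel. (norm (f y))\<^sup>2)"
    using nn_integral_eq_integral[OF f2] by (simp add: nn_integral_cmult)
  also have "ennreal (C\<^sup>2 * I) * (ennreal I * ennreal (LINT y|lborel. (norm (f y))\<^sup>2))
     = ennreal ((C * I)\<^sup>2 * (LINT y|lborel. (norm (f y))\<^sup>2))"
  proof -
    have "0 \<le> C\<^sup>2 * I" using I_nonneg by simp
    note mult = ennreal_mult'[OF this, symmetric] ennreal_mult'[OF I_nonneg, symmetric]
    show ?thesis unfolding mult by (simp add: power2_eq_square ac_simps)
  qed
  finally have le: "(\<integral>\<^sup>+x. ennreal ((norm (kernel_op k f x))\<^sup>2) \<partial>lborel)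
    \<le> ennreal ((C * I)\<^sup>2 * (LINT y|lborel. (norm (f y))\<^sup>2))" .
  have int: "integrable lborel (\<lambda>x. (norm (kernel_op k f x))\<^sup>2)"
    by (rule integrableI_bounded) (use le in \<open>auto simp: less_top[symmetric] top_unique\<close>)
  then show "kernel_op k f \<in> L2 0" by (simp add: L2_0)
  have "(LINT x|lborel. (norm (kernel_op k f x))\<^sup>2) \<le> (C * I)\<^sup>2 * (LINT y|lborel. (norm (f y))\<^sup>2)"
    using le nn_integral_eq_integral[OF int] by (simp add: ennreal_le_iff)
  then have "norm_L2 0 (kernel_op k f) \<le> sqrt ((C * I)\<^sup>2 * (LINT y|lborel. (norm (f y))\<^sup>2))"
    unfolding norm_L2_0 by (rule real_sqrt_le_mono)
  also have "\<dots> = C * I * norm_L2 0 f"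
    using C_nonneg I_nonneg by (simp add: real_sqrt_mult norm_L2_0 abs_mult)
  finally show "norm_L2 0 (kernel_op k f) \<le> C * I * norm_L2 0 f" .
qed

text \<open>
  Fubini's theorem moves a test function onto the kernel. Integrability over the plane holds because
  \<open>\<integral> \<bar>k(x, y) f(y)\<bar> dy\<close> is bounded in \<open>x\<close>.
\<close>

lemma kernel_op_pairing:
  assumes f: "f \<in> L2 0" and \<psi>: "integrable lborel \<psi>"
  shows "(LINT x|lborel. kernel_op k f x * \<psi> x) = (LINT y|lborel. (LINT x|lborel. k x y * \<psi> x) * f y)"
    and "integrable lborel (\<lambda>y. (LINT x|lborel. k x y * \<psi> x) * f y)"
proof -
  have [measurable]: "f \<in> borel_measurable borel" "\<psi> \<in> borel_measurable borel"
    using f \<psi> L2_measurable by auto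
  let ?e = "\<lambda>x y. exp (- \<alpha> * \<bar>x - y\<bar>)"
  let ?N = "LINT y|lborel. (norm (f y))\<^sup>2"
  have f2: "integrable lborel (\<lambda>y. (norm (f y))\<^sup>2)" using f by (simp add: L2_0)
  have bound: "(LINT y|lborel. norm (k x y * f y)) \<le> C * sqrt (I * ?N)" for x
  proof -
    have le: "norm (k x y * f y) \<le> C * (?e x y * norm (f y))" for y
      using mult_right_mono[OF k_le[of x y], of "norm (f y)"] by (simp add: norm_mult mult.assoc)
    have "(LINT y|lborel. norm (k x y * f y)) \<le> (LINT y|lborel. C * (?e x y * norm (f y)))"
      by (intro integral_mono integrable_norm integrable_mult_right kernel_op_pointwise f le)
    also have "\<dots> = C * (LINT y|lborel. ?e x y * norm (f y))" by simp
    also have "\<dots> \<le> C * sqrt (I * ?N)"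
    proof (intro mult_left_mono C_nonneg real_le_rsqrt)
      have "(LINT y|lborel. ?e x y * norm (f y))\<^sup>2 \<le> I * (LINT y|lborel. ?e x y * (norm (f y))\<^sup>2)"
        by (rule kernel_op_pointwise(4)[OF f])
      also have "\<dots> \<le> I * ?N"
        using alpha by (intro mult_left_mono integral_mono f2 kernel_op_pointwise(3)[OF f] I_nonneg) 
          (auto intro!: mult_left_le_one_le)
      finally show "(LINT y|lborel. ?e x y * norm (f y))\<^sup>2 \<le> I * ?N" .
    qed
    finally show ?thesis .
  qed
  have int: "integrable (lborel \<Otimes>\<^sub>M lborel) (\<lambda>(x, y). k x y * f y * \<psi> x)"
  proof (rule lborel_pair.Fubini_integrable)
    show "(\<lambda>(x, y). k x y * f y * \<psi> x) \<in> borel_measurable (lborel \<Otimes>\<^sub>M lborel)" by measurable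
    show "integrable lborel (\<lambda>x. LINT y|lborel. norm (case (x, y) of (x, y) \<Rightarrow> k x y * f y * \<psi> x))"
    proof (rule Bochner_Integration.integrable_bound)
      show "integrable lborel (\<lambda>x. C * sqrt (I * ?N) * norm (\<psi> x))" using \<psi> by simp
      show "AE x in lborel. norm (LINT y|lborel. norm (case (x, y) of (x, y) \<Rightarrow> k x y * f y * \<psi> x))
        \<le> norm (C * sqrt (I * ?N) * norm (\<psi> x))"
      proof (rule AE_I2)
        fix x
        have "(LINT y|lborel. norm (k x y * f y * \<psi> x)) = (LINT y|lborel. norm (k x y * f y)) * norm (\<psi> x)"
          by (simp add: norm_mult)
        also have "\<dots> \<le> C * sqrt (I * ?N) * norm (\<psi> x)" by (intro mult_right_mono bound) simp
        finally show "norm (LINT y|lborel. norm (case (x, y) of (x, y) \<Rightarrow> k x y * f y * \<psi> x))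
          \<le> norm (C * sqrt (I * ?N) * norm (\<psi> x))" by simp
      qed
    qed measurable
    show "AE x in lborel. integrable lborel (\<lambda>y. case (x, y) of (x, y) \<Rightarrow> k x y * f y * \<psi> x)"
      using kernel_op_pointwise(2)[OF f] by simp
  qed
  have "(LINT x|lborel. kernel_op k f x * \<psi> x) = (LINT x|lborel. LINT y|lborel. k x y * f y * \<psi> x)"
    by (simp add: kernel_op_def)
  also have "\<dots> = (LINT y|lborel. LINT x|lborel. k x y * f y * \<psi> x)"
    using lborel_pair.Fubini_integral[OF int] by simp
  finally have pair: "(LINT x|lborel. kernel_op k f x * \<psi> x) = (LINT y|lborel. LINT x|lborel. k x y * f y * \<psi> x)" .
  have eq: "(LINT x|lborel. k x y * f y * \<psi> x) = (LINT x|lborel. k x y * \<psi> x) * f y" for y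
  proof -
    have "k x y * f y * \<psi> x = (k x y * \<psi> x) * f y" for x by simp
    then show ?thesis
      by (simp only: integral_mult_left_zero)
  qed
  show "(LINT x|lborel. kernel_op k f x * \<psi> x) = (LINT y|lborel. (LINT x|lborel. k x y * \<psi> x) * f y)"
    using pair unfolding eq .
  show "integrable lborel (\<lambda>y. (LINT x|lborel. k x y * \<psi> x) * f y)"
    using lborel_pair.integrable_snd[OF int] unfolding eq .
qed

end

section \<open>Test functions\<close>

lemma vderiv_0 [simp]: "vderiv 0 f = f"
  by (simp add: vderiv_def)

lemma vderiv_Suc: "vderiv (Suc k) f = (\<lambda>x. vector_derivative (vderiv k f) (at x))"
  by (simp add: vderiv_def)

lemma vderiv_add: "vderiv j (vderiv k f) = vderiv (j + k) f"
  by (simp add: vderiv_def funpow_add)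

definition smooth :: "(real \<Rightarrow> complex) \<Rightarrow> bool" where
  "smooth f \<longleftrightarrow> (\<forall>k. times_differentiable k f)"

lemma smooth_iff: "smooth f \<longleftrightarrow> (\<forall>k x. vderiv k f differentiable (at x))"
  unfolding smooth_def times_differentiable_def by (metis lessI)

lemma smooth_has_vector_derivative:
  assumes "smooth f"
  shows "(vderiv k f has_vector_derivative vderiv (Suc k) f x) (at x)"
  using assms unfolding smooth_iff vderiv_Suc by (simp add: vector_derivative_works)

lemma smooth_vderiv: "smooth f \<Longrightarrow> smooth (vderiv k f)"
  by (simp add: smooth_iff vderiv_add)

text \<open>
  Smoothness is proved coinductively: a class of functions that is closed under differentiation
  consists of smooth functions.
\<close>

lemma smoothI_class:
  assumes "f \<in> \<S>" and step: "\<And>g. g \<in> \<S> \<Longrightarrow> \<exists>g'\<in>\<S>. \<forall>x. (g has_vector_derivative g' x) (at x)"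
  shows "smooth f"
proof -
  have *: "vderiv k f \<in> \<S>" for k
  proof (induction k)
    case (Suc k)
    from step[OF Suc] obtain g' where g': "g' \<in> \<S>" "\<And>x. (vderiv k f has_vector_derivative g' x) (at x)" by blast
    then have "vderiv (Suc k) f = g'" unfolding vderiv_Suc by (auto intro: vector_derivative_at)
    with g' show ?case by simp
  qed (simp add: assms)
  show ?thesis unfolding smooth_iff
  proof (intro allI)
    fix k x
    from step[OF *[of k]] show "vderiv k f differentiable (at x)"
      by (blast intro: differentiableI_vector)
  qed
qed

lemma test_function_iff: "test_function \<phi> \<longleftrightarrow> smooth \<phi> \<and> (\<exists>L. \<forall>x. L < \<bar>x\<bar> \<longrightarrow> \<phi> x = 0)"
proof
  assume t: "test_function \<phi>"
  then have "bounded (closure {x. \<phi> x \<noteq> 0})"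
    unfolding test_function_def compactly_supported_def by (simp add: compact_imp_bounded)
  then obtain L where "\<forall>x\<in>closure {x. \<phi> x \<noteq> 0}. \<bar>x\<bar> \<le> L" by (auto simp: bounded_iff)
  then have "\<forall>x. L < \<bar>x\<bar> \<longrightarrow> \<phi> x = 0" using closure_subset[of "{x. \<phi> x \<noteq> 0}"] by force
  with t show "smooth \<phi> \<and> (\<exists>L. \<forall>x. L < \<bar>x\<bar> \<longrightarrow> \<phi> x = 0)" by (auto simp: test_function_def smooth_def)
next
  assume "smooth \<phi> \<and> (\<exists>L. \<forall>x. L < \<bar>x\<bar> \<longrightarrow> \<phi> x = 0)"
  then obtain L where s: "smooth \<phi>" and L: "\<And>x. L < \<bar>x\<bar> \<Longrightarrow> \<phi> x = 0" by blast
  have "{x. \<phi> x \<noteq> 0} \<subseteq> {- L..L}" using L by force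
  then have "bounded {x. \<phi> x \<noteq> 0}" using bounded_closed_interval bounded_subset by blast
  then show "test_function \<phi>"
    using s by (simp add: test_function_def smooth_def compactly_supported_def compact_closure)
qed

lemma test_function_support:
  assumes "test_function \<phi>"
  obtains L where "0 < L" "\<And>k x. L \<le> \<bar>x\<bar> \<Longrightarrow> vderiv k \<phi> x = 0"
proof -
  from assms obtain L where L: "\<And>x. L < \<bar>x\<bar> \<Longrightarrow> \<phi> x = 0" by (auto simp: test_function_iff)
  have *: "vderiv k \<phi> x = 0" if "L < \<bar>x\<bar>" for k x
    using that
  proof (induction k arbitrary: x)
    case (Suc k)
    have "open {x. L < \<bar>x::real\<bar>}" by (intro open_Collect_less continuous_intros)
    moreover have "((\<lambda>_. 0) has_vector_derivative (0::complex)) (at x)" by simp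
    ultimately have "(vderiv k \<phi> has_vector_derivative 0) (at x)"
      using Suc has_vector_derivative_transform_within_open[of "\<lambda>_. 0" 0 x "{x. L < \<bar>x\<bar>}" "vderiv k \<phi>"] by simp
    then show ?case by (simp add: vderiv_Suc vector_derivative_at)
  qed (use L in auto)
  show ?thesis by (rule that[of "\<bar>L\<bar> + 1"]) (use * in auto)
qed

lemma test_function_vderiv: "test_function \<phi> \<Longrightarrow> test_function (vderiv k \<phi>)"
  by (meson linorder_not_less order_less_imp_le smooth_vderiv test_function_iff test_function_support)

lemma test_function_continuous:
  assumes "test_function \<phi>" shows "continuous_on S (vderiv k \<phi>)"
proof -
  have "smooth \<phi>" using assms by (simp add: test_function_iff)
  then show ?thesis
    using has_vector_derivative_continuous[OF smooth_has_vector_derivative]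
    by (intro continuous_at_imp_continuous_on) blast
qed

lemma test_function_measurable:
  assumes "test_function \<phi>" shows "vderiv k \<phi> \<in> borel_measurable borel"
  by (rule borel_measurable_continuous_onI[OF test_function_continuous[OF assms]])

lemma test_function_bounded:
  assumes "test_function \<phi>"
  obtains B where "\<And>x. norm (vderiv k \<phi> x) \<le> B" "0 \<le> B"
proof -
  obtain L where L: "0 < L" "\<And>k x. L \<le> \<bar>x\<bar> \<Longrightarrow> vderiv k \<phi> x = 0"
    by (rule test_function_support[OF assms]) blast
  have "bounded (vderiv k \<phi> ` {- L..L})"
    by (intro compact_imp_bounded compact_continuous_image test_function_continuous assms) auto
  then obtain B where "\<forall>z\<in>vderiv k \<phi> ` {- L..L}. norm z \<le> B" unfolding bounded_iff by blast
  then have B: "\<And>x. x \<in> {- L..L} \<Longrightarrow> norm (vderiv k \<phi> x) \<le> B" by blast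
  have "norm (vderiv k \<phi> x) \<le> \<bar>B\<bar>" for x
    using B[of x] L(2)[of x k] by (cases "x \<in> {- L..L}") auto
  then show ?thesis by (rule that) simp
qed

lemma locally_integrable_mult_test:
  assumes u: "locally_integrable u" and \<phi>: "test_function \<phi>" and [measurable]: "u \<in> borel_measurable borel"
  shows "integrable lborel (\<lambda>x. u x * vderiv k \<phi> x)"
proof -
  obtain L where L: "0 < L" "\<And>k x. L \<le> \<bar>x\<bar> \<Longrightarrow> vderiv k \<phi> x = 0"
    by (rule test_function_support[OF \<phi>]) blast
  obtain B where B: "\<And>x. norm (vderiv k \<phi> x) \<le> B" "0 \<le> B" by (rule test_function_bounded[OF \<phi>, of k]) blast
  have [measurable]: "vderiv k \<phi> \<in> borel_measurable borel" by (rule test_function_measurable[OF \<phi>])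
  have "integrable lborel (\<lambda>x. indicator {- L..L} x *\<^sub>R u x)"
    using u unfolding locally_integrable_def set_integrable_def by simp
  then have "integrable lborel (\<lambda>x. B * norm (indicator {- L..L} x *\<^sub>R u x))"
    by (intro integrable_mult_right integrable_norm)
  then show ?thesis
  proof (rule Bochner_Integration.integrable_bound)
    show "AE x in lborel. norm (u x * vderiv k \<phi> x) \<le> norm (B * norm (indicator {- L..L} x *\<^sub>R u x))"
    proof (rule AE_I2)
      fix x
      have "norm (u x) * norm (vderiv k \<phi> x) \<le> norm (u x) * B" by (intro mult_left_mono B) auto
      then show "norm (u x * vderiv k \<phi> x) \<le> norm (B * norm (indicator {- L..L} x *\<^sub>R u x))"
        using L(2)[of x k] B(2) by (cases "x \<in> {- L..L}") (auto simp: norm_mult abs_mult mult.commute)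
    qed
  qed measurable
qed

text \<open>
  The derivatives of \<open>e\<^bsup>-c / ((x - a)(b - x))\<^esup>\<close> on \<open>(a, b)\<close>, extended by zero, are all of this form with a
  polynomial \<open>P\<close>. As \<open>c\<close> tends to zero these functions increase to the indicator of \<open>(a, b)\<close>.
\<close>

definition bump_class where
  "bump_class a b c P k x =
     (if a < x \<and> x < b then complex_of_real (poly P x * inverse ((x - a) * (b - x)) ^ k * exp (- c * inverse ((x - a) * (b - x)))) else 0)"

lemma exp_neg_inverse_le:
  fixes q c :: real
  assumes "0 < q" "0 < c"
  shows "exp (- c * inverse q) \<le> fact m * (q / c) ^ m"
proof -
  have "(c / q) ^ m / fact m \<le> exp (c / q)"
  proof -
    have "(\<Sum>n\<in>{m}. (c / q) ^ n /\<^sub>R fact n) \<le> (\<Sum>n. (c / q) ^ n /\<^sub>R fact n)"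
      using assms by (intro sum_le_suminf) (auto simp: summable_exp)
    then show ?thesis by (simp add: exp_def divide_inverse mult.commute)
  qed
  then have "inverse (exp (c / q)) \<le> inverse ((c / q) ^ m / fact m)"
    using assms by (intro le_imp_inverse_le) auto
  then show ?thesis using assms by (simp add: exp_minus field_simps power_divide)
qed

lemma has_vector_derivative_0_quadratic:
  fixes f :: "real \<Rightarrow> complex"
  assumes "\<And>x. norm (f x) \<le> C * (x - x0)\<^sup>2"
  shows "(f has_vector_derivative 0) (at x0)"
proof -
  have f0: "f x0 = 0" using assms[of x0] by simp
  have "((\<lambda>x. norm (f x) / \<bar>x - x0\<bar>) \<longlongrightarrow> 0) (at x0)"
  proof (rule Lim_null_comparison)
    show "\<forall>\<^sub>F x in at x0. norm (norm (f x) / \<bar>x - x0\<bar>) \<le> C * \<bar>x - x0\<bar>"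
    proof (rule eventually_mono[OF eventually_neq_at_within[of x0]])
      fix x assume "x \<noteq> x0"
      then show "norm (norm (f x) / \<bar>x - x0\<bar>) \<le> C * \<bar>x - x0\<bar>"
        using assms[of x] by (simp add: divide_le_eq power2_eq_square mult.assoc flip: abs_mult)
    qed
    have "((\<lambda>x. C * \<bar>x - x0\<bar>) \<longlongrightarrow> C * \<bar>x0 - x0\<bar>) (at x0)" by (intro tendsto_intros)
    then show "((\<lambda>x. C * \<bar>x - x0\<bar>) \<longlongrightarrow> 0) (at x0)" by simp
  qed
  then show ?thesis
    unfolding has_vector_derivative_def has_derivative_iff_norm using f0 by simp
qed

text \<open>
  Inside \<open>(a, b)\<close> this is calculus; at the endpoints the exponential beats every power of
  \<open>(x - a)(b - x)\<close>, so that the function is bounded by the square of the distance to the endpoint.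
\<close>

lemma bump_class_derivative:
  assumes "a < b" "0 < c"
  shows "\<exists>P'. \<forall>x. (bump_class a b c P k has_vector_derivative bump_class a b c P' (k + 2) x) (at x)"
proof -
  define Q where "Q = [:- a * b, a + b, - 1:]"
  have Q: "poly Q x = (x - a) * (b - x)" for x by (simp add: Q_def algebra_simps)
  define P' where "P' = pderiv P * Q^2 - smult (of_nat k) (P * pderiv Q * Q) + smult c (P * pderiv Q)"
  have "(bump_class a b c P k has_vector_derivative bump_class a b c P' (k + 2) x) (at x)" for x
  proof -
    consider "a < x" "x < b" | "x = a \<or> x = b" | "x < a \<or> b < x" by linarith
    then show ?thesis
    proof cases
      case 1
      let ?r = "\<lambda>x. inverse (poly Q x)"
      let ?f = "\<lambda>x. poly P x * ?r x ^ k * exp (- c * ?r x)"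
      have "poly Q x \<noteq> 0" using 1 by (simp add: Q)
      then have q: "poly Q x * ?r x = 1" by simp
      have r: "(?r has_real_derivative - poly (pderiv Q) x * ?r x ^ 2) (at x)"
        using DERIV_inverse_fun[OF poly_DERIV[of Q x]] 1 by (simp add: Q power2_eq_square)
      have rk: "of_nat k * ?r x ^ (k - 1) * ?r x ^ 2 = of_nat k * ?r x ^ (k + 1)"
        by (cases k) (simp_all add: power2_eq_square)
      have "(?f has_real_derivative (poly (pderiv P) x * ?r x ^ k
          + poly P x * (of_nat k * ?r x ^ (k - 1) * (- poly (pderiv Q) x * ?r x ^ 2))) * exp (- c * ?r x)
          + poly P x * ?r x ^ k * (exp (- c * ?r x) * (- c * (- poly (pderiv Q) x * ?r x ^ 2)))) (at x)"
        by (rule derivative_eq_intros poly_DERIV r refl | simp add: algebra_simps)+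
      also have "(poly (pderiv P) x * ?r x ^ k
          + poly P x * (of_nat k * ?r x ^ (k - 1) * (- poly (pderiv Q) x * ?r x ^ 2))) * exp (- c * ?r x)
          + poly P x * ?r x ^ k * (exp (- c * ?r x) * (- c * (- poly (pderiv Q) x * ?r x ^ 2)))
        = (poly (pderiv P) x * ?r x ^ k - poly P x * poly (pderiv Q) x * (of_nat k * ?r x ^ (k - 1) * ?r x ^ 2)
          + c * poly P x * poly (pderiv Q) x * (?r x ^ k * ?r x ^ 2)) * exp (- c * ?r x)"
        by (simp add: algebra_simps)
      also have "\<dots> = (poly (pderiv P) x * ((poly Q x * ?r x)\<^sup>2 * ?r x ^ k)
          - poly P x * poly (pderiv Q) x * (of_nat k * ?r x ^ (k + 1) * (poly Q x * ?r x))
          + c * poly P x * poly (pderiv Q) x * (?r x ^ k * ?r x ^ 2)) * exp (- c * ?r x)"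
        unfolding rk q by simp
      also have "\<dots> = poly P' x * ?r x ^ (k + 2) * exp (- c * ?r x)"
        by (simp add: P'_def power_mult_distrib algebra_simps power2_eq_square)
      finally have "(?f has_real_derivative poly P' x * ?r x ^ (k + 2) * exp (- c * ?r x)) (at x)" .
      then have "((\<lambda>x. complex_of_real (?f x)) has_vector_derivative complex_of_real (poly P' x * ?r x ^ (k + 2) * exp (- c * ?r x))) (at x)"
        by (rule has_vector_derivative_of_real)
      then have "(bump_class a b c P k has_vector_derivative complex_of_real (poly P' x * ?r x ^ (k + 2) * exp (- c * ?r x))) (at x)"
        by (rule has_vector_derivative_transform_within_open[of _ _ x "{a<..<b}"]) (use 1 in \<open>auto simp: bump_class_def Q\<close>)
      then show ?thesis using 1 by (simp add: bump_class_def Q)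
    next
      case 2
      have "bounded (poly P ` {a..b})"
        by (intro compact_imp_bounded compact_continuous_image continuous_on_poly continuous_on_id) auto
      then obtain B where "\<forall>z\<in>poly P ` {a..b}. \<bar>z\<bar> \<le> B" unfolding bounded_iff real_norm_def by blast
      then have B: "\<And>x. x \<in> {a..b} \<Longrightarrow> \<bar>poly P x\<bar> \<le> B" by blast
      have B0: "0 \<le> B" using B[of a] \<open>a < b\<close> by simp
      define C where "C = B * fact (k + 2) / c ^ (k + 2)"
      have C0: "0 \<le> C" using B0 \<open>0 < c\<close> by (simp add: C_def)
      have le: "norm (bump_class a b c P k t) \<le> C * ((t - a) * (b - t))\<^sup>2" if "a < t" "t < b" for t
      proof -
        let ?q = "(t - a) * (b - t)"
        have q: "0 < ?q" using that by simp
        have "norm (bump_class a b c P k t) = \<bar>poly P t * inverse ?q ^ k * exp (- c * inverse ?q)\<bar>"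
          using that by (simp only: bump_class_def norm_of_real if_True simp_thms)
        also have "\<dots> = \<bar>poly P t\<bar> * inverse ?q ^ k * exp (- c * inverse ?q)"
        proof -
          have "\<bar>A * inverse z ^ k * exp e\<bar> = \<bar>A\<bar> * inverse z ^ k * exp e" if "0 < z" for A z e :: real
            using that by (simp add: abs_mult power_abs)
          then show ?thesis using q .
        qed
        also have "\<dots> \<le> B * inverse ?q ^ k * (fact (k + 2) * (?q / c) ^ (k + 2))"
          using that q B[of t] B0 \<open>0 < c\<close> by (intro mult_mono exp_neg_inverse_le) auto
        also have "\<dots> = C * ?q\<^sup>2"
        proof -
          have "B * inverse z ^ k * (fact (k + 2) * (z / c) ^ (k + 2)) = B * fact (k + 2) / c ^ (k + 2) * z\<^sup>2"
            if "0 < z" for z :: real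
          proof -
            have "inverse z ^ k * z ^ k = 1" using that by (simp flip: power_mult_distrib)
            then have "inverse z ^ k * z ^ (k + 2) = z\<^sup>2" by (simp only: power_add mult.assoc[symmetric] mult_1_left)
            moreover have "B * inverse z ^ k * (fact (k + 2) * (z / c) ^ (k + 2))
              = B * fact (k + 2) / c ^ (k + 2) * (inverse z ^ k * z ^ (k + 2))"
              unfolding power_divide by (simp only: divide_inverse ac_simps)
            ultimately show ?thesis by (simp only:)
          qed
          then show ?thesis using q unfolding C_def .
        qed
        finally show ?thesis .
      qed
      have "norm (bump_class a b c P k t) \<le> (C * (b - a)\<^sup>2) * (t - x)\<^sup>2" for t
      proof (cases "a < t \<and> t < b")
        case True
        have "((t - a) * (b - t))\<^sup>2 \<le> ((b - a) * \<bar>t - x\<bar>)\<^sup>2"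
        proof (rule power_mono)
          show "(t - a) * (b - t) \<le> (b - a) * \<bar>t - x\<bar>"
            using 2 True mult_mono[of "t - a" "b - a" "b - t" "b - t"] mult_mono[of "b - t" "b - a" "t - a" "t - a"]
            by (auto simp: abs_if mult.commute)
        qed (use True in auto)
        then have "C * ((t - a) * (b - t))\<^sup>2 \<le> C * ((b - a) * \<bar>t - x\<bar>)\<^sup>2" by (intro mult_left_mono C0)
        then show ?thesis using le[of t] True by (simp add: power_mult_distrib)
      qed (use C0 in \<open>auto simp: bump_class_def\<close>)
      then have "(bump_class a b c P k has_vector_derivative 0) (at x)"
        by (rule has_vector_derivative_0_quadratic)
      then show ?thesis using 2 by (auto simp: bump_class_def)
    next
      case 3
      have op: "open ({..<a} \<union> {b<..})" by auto
      have zero: "0 = bump_class a b c P k y" if "y \<in> {..<a} \<union> {b<..}" for y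
        using that by (auto simp: bump_class_def)
      have "(bump_class a b c P k has_vector_derivative 0) (at x)"
        by (rule has_vector_derivative_transform_within_open[OF has_vector_derivative_const op _ zero]) (use 3 in auto)
      then show ?thesis using 3 by (auto simp: bump_class_def)
    qed
  qed
  then show ?thesis by blast
qed

definition bump where "bump a b c = bump_class a b c 1 0"

lemma bump_test_function:
  assumes "a < b" "0 < c" shows "test_function (bump a b c)"
  unfolding test_function_iff
proof
  show "smooth (bump a b c)"
  proof (rule smoothI_class)
    show "bump a b c \<in> {bump_class a b c P k |P k. True}" by (auto simp: bump_def)
    fix g assume "g \<in> {bump_class a b c P k |P k. True}"
    then obtain P k where g: "g = bump_class a b c P k" by blast
    from bump_class_derivative[OF assms, of P k]
    show "\<exists>g'\<in>{bump_class a b c P k |P k. True}. \<forall>x. (g has_vector_derivative g' x) (at x)"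
      unfolding g by blast
  qed
  show "\<exists>L. \<forall>x. L < \<bar>x\<bar> \<longrightarrow> bump a b c x = 0"
    by (intro exI[of _ "\<bar>a\<bar> + \<bar>b\<bar>"]) (auto simp: bump_def bump_class_def)
qed

lemma bump_eq: "bump a b c x = of_real (indicator {a<..<b} x * exp (- c * inverse ((x - a) * (b - x))))"
  by (simp add: bump_def bump_class_def indicator_def)

lemma bump_integral_ne_0:
  assumes "a < b" "0 < c"
  shows "(LINT x|lborel. bump a b c x) \<noteq> 0"
proof
  let ?f = "\<lambda>x. indicator {a<..<b} x * exp (- c * inverse ((x - a) * (b - x))) :: real"
  assume 0: "(LINT x|lborel. bump a b c x) = 0"
  have t: "test_function (bump a b c)" by (rule bump_test_function[OF assms])
  have "locally_integrable (\<lambda>_. 1)"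
    unfolding locally_integrable_def set_integrable_def by (auto intro!: borel_integrable_compact)
  from locally_integrable_mult_test[OF this t, of 0]
  have "integrable lborel (bump a b c)" by simp
  then have i: "integrable lborel (\<lambda>x. complex_of_real (?f x))" unfolding bump_eq[abs_def] .
  then have i': "integrable lborel ?f" by (simp only: complex_of_real_integrable_eq)
  have "(LINT x|lborel. ?f x) = 0" using 0 unfolding bump_eq by (simp only: integral_complex_of_real of_real_eq_0_iff)
  then have "AE x in lborel. ?f x = 0"
    using integral_nonneg_eq_0_iff_AE[OF i'] by simp
  then have "AE x in lborel. x \<notin> {a<..<b}" by eventually_elim (auto simp: indicator_def split: if_splits)
  then have "emeasure lborel {a<..<b} = 0" by (subst (asm) AE_iff_null_sets[symmetric]) (auto simp: null_sets_def)
  then show False using assms by simp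
qed

section \<open>Weak derivatives\<close>

lemma locally_integrableD:
  assumes "locally_integrable u"
  shows "integrable lborel (\<lambda>x. indicator {l..r} x *\<^sub>R u x)"
  using assms unfolding locally_integrable_def set_integrable_def by simp

lemma locally_integrable_measurable:
  assumes "locally_integrable u" shows "u \<in> borel_measurable borel"
proof (rule borel_measurable_LIMSEQ_metric)
  show "(\<lambda>x. indicator {- real n..real n} x *\<^sub>R u x) \<in> borel_measurable borel" for n
    using borel_measurable_integrable[OF locally_integrableD[OF assms]] by simp
  fix x :: real
  obtain n0 :: nat where n0: "\<bar>x\<bar> \<le> real n0" using real_arch_simple by blast
  have "\<forall>\<^sub>F n in sequentially. indicator {- real n..real n} x *\<^sub>R u x = u x"
    using eventually_ge_at_top[of n0] by eventually_elim (use n0 in \<open>auto simp: indicator_def\<close>)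
  then show "(\<lambda>n. indicator {- real n..real n} x *\<^sub>R u x) \<longlonglongrightarrow> u x"
    by (rule tendsto_eventually)
qed

lemma locally_integrable_diff:
  assumes "locally_integrable u" "locally_integrable v"
  shows "locally_integrable (\<lambda>x. u x - v x)"
  using assms unfolding locally_integrable_def by (auto intro: set_integral_diff)

lemma locally_integrable_cmult:
  assumes "locally_integrable u"
  shows "locally_integrable (\<lambda>x. c * u x)"
  using assms unfolding locally_integrable_def by (auto intro: set_integrable_mult_right)

lemma locally_integrable_continuous:
  assumes "continuous_on UNIV u" shows "locally_integrable u"
  unfolding locally_integrable_def set_integrable_def
  using assms by (auto intro!: borel_integrable_compact intro: continuous_on_subset)

lemma sets_borel_intervals: "sets (borel :: real measure) = sigma_sets UNIV (range (\<lambda>(l, r). {l<..<r}))"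
proof -
  have "(\<lambda>(l::real, r). box l r) = (\<lambda>(l, r). {l<..<r})" by (simp add: fun_eq_iff box_real)
  moreover have "sets (borel :: real measure) = sets (sigma UNIV (range (\<lambda>(l, r). box l r)))"
    using borel_eq_box[where 'a = real] by (rule arg_cong)
  ultimately show ?thesis by simp
qed

text \<open>
  The sets over which \<open>f\<close> integrates to zero form a Dynkin system, and the open intervals are a generator of
  the Borel sets that is stable under intersection.
\<close>

lemma ae_zero_if_interval_integrals_vanish:
  fixes f :: "real \<Rightarrow> complex"
  assumes f: "integrable lborel f" and UNIV: "(LINT x|lborel. f x) = 0"
    and 0: "\<And>l r. l < r \<Longrightarrow> (LINT x|lborel. indicator {l<..<r} x *\<^sub>R f x) = 0"
  shows "AE x in lborel. f x = 0"
proof (rule sigma_finite_measure.density_zero[OF lborel.sigma_finite_measure_axioms f])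
  fix A :: "real set" assume "A \<in> sets lborel"
  then have "A \<in> sigma_sets UNIV (range (\<lambda>(l::real, r). {l<..<r}))"
    using sets_borel_intervals by simp
  note A = this
  have "Int_stable (range (\<lambda>(l::real, r). {l<..<r}))"
    unfolding Int_stable_def
  proof safe
    fix l r l' r' :: real
    have "{l<..<r} \<inter> {l'<..<r'} = {max l l'<..<min r r'}" by auto
    then show "{l<..<r} \<inter> {l'<..<r'} \<in> range (\<lambda>(l, r). {l<..<r})" by auto
  qed
  moreover have "range (\<lambda>(l::real, r). {l<..<r}) \<subseteq> Pow UNIV" by simp
  ultimately show "set_lebesgue_integral lborel A f = 0"
    using A
  proof (induction rule: sigma_sets_induct_disjoint)
    case (basic A)
    then obtain l r where A: "A = {l<..<r}" by auto
    show ?case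
      using 0[of l r] by (cases "l < r") (auto simp: A set_lebesgue_integral_def)
  next
    case (compl A)
    have A: "A \<in> sets lborel" using compl sets_borel_intervals by simp
    have i: "set_integrable lborel A f" if "A \<in> sets lborel" for A
      using integrable_mult_indicator[OF that f] by (simp add: set_integrable_def)
    have "set_lebesgue_integral lborel (A \<union> (UNIV - A)) f
      = set_lebesgue_integral lborel A f + set_lebesgue_integral lborel (UNIV - A) f"
      using A by (intro set_integral_Un i) auto
    then show ?case using compl UNIV by (simp add: set_lebesgue_integral_def)
  next
    case (union A)
    have A: "A i \<in> sets lborel" for i using union sets_borel_intervals by auto
    have "set_integrable lborel (\<Union>i. A i) f"
      using integrable_mult_indicator[of "\<Union>i. A i" lborel f] A f by (simp add: set_integrable_def)
    then have "set_lebesgue_integral lborel (\<Union>i. A i) f = (\<Sum>i. set_lebesgue_integral lborel (A i) f)"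
      using union A by (intro lebesgue_integral_countable_add) (auto simp: disjoint_family_on_def)
    then show ?case using union by simp
  qed (simp add: set_lebesgue_integral_def)
qed

text \<open>
  Bump functions converge boundedly to indicators of intervals, so all interval integrals of \<open>w\<close>
  vanish.
\<close>

lemma fundamental_lemma:
  assumes w: "locally_integrable w" and 0: "\<And>\<phi>. test_function \<phi> \<Longrightarrow> (LINT x|lborel. w x * \<phi> x) = 0"
  shows "AE x in lborel. w x = 0"
proof -
  have [measurable]: "w \<in> borel_measurable borel" by (rule locally_integrable_measurable[OF w])
  have int0: "(LINT x|lborel. indicator {l<..<r} x *\<^sub>R w x) = 0" if "l < r" for l r
  proof -
    have "(\<lambda>n. LINT x|lborel. w x * bump l r (inverse (real (Suc n))) x)
       \<longlonglongrightarrow> (LINT x|lborel. indicator {l<..<r} x *\<^sub>R w x)"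
    proof (rule integral_dominated_convergence[where w = "\<lambda>x. norm (indicator {l..r} x *\<^sub>R w x)"])
      show "integrable lborel (\<lambda>x. norm (indicator {l..r} x *\<^sub>R w x))"
        by (intro integrable_norm locally_integrableD w)
      show "(\<lambda>x. w x * bump l r (inverse (real (Suc n))) x) \<in> borel_measurable lborel" for n
        unfolding bump_eq by measurable
      show "AE x in lborel. norm (w x * bump l r (inverse (real (Suc n))) x) \<le> norm (indicator {l..r} x *\<^sub>R w x)" for n
      proof (rule AE_I2)
        fix x
        have "exp (- inverse (real (Suc n)) * inverse ((x - l) * (r - x))) \<le> 1" if "l < x" "x < r"
          using that by (simp add: mult_nonneg_nonneg del: of_nat_Suc)
        then show "norm (w x * bump l r (inverse (real (Suc n))) x) \<le> norm (indicator {l..r} x *\<^sub>R w x)"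
          unfolding bump_eq norm_mult norm_of_real
          by (auto simp: indicator_def norm_mult intro!: mult_left_le simp del: of_nat_Suc)
      qed
      show "AE x in lborel. (\<lambda>n. w x * bump l r (inverse (real (Suc n))) x) \<longlonglongrightarrow> indicator {l<..<r} x *\<^sub>R w x"
      proof (rule AE_I2)
        fix x
        have "(\<lambda>n. exp (- inverse (real (Suc n)) * inverse ((x - l) * (r - x)))) \<longlonglongrightarrow> exp (- 0 * inverse ((x - l) * (r - x)))"
          by (intro tendsto_intros LIMSEQ_inverse_real_of_nat)
        then have "(\<lambda>n. exp (- inverse (real (Suc n)) * inverse ((x - l) * (r - x)))) \<longlonglongrightarrow> 1"
          by (simp only: minus_zero mult_zero_left exp_zero)
        then have "(\<lambda>n. indicator {l<..<r} x * exp (- inverse (real (Suc n)) * inverse ((x - l) * (r - x)))) \<longlonglongrightarrow> indicator {l<..<r} x * 1"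
          by (rule tendsto_mult_left)
        then have "(\<lambda>n. w x * of_real (indicator {l<..<r} x * exp (- inverse (real (Suc n)) * inverse ((x - l) * (r - x)))))
           \<longlonglongrightarrow> w x * of_real (indicator {l<..<r} x * 1)"
          by (rule tendsto_mult_left[OF tendsto_of_real])
        then show "(\<lambda>n. w x * bump l r (inverse (real (Suc n))) x) \<longlonglongrightarrow> indicator {l<..<r} x *\<^sub>R w x"
          unfolding bump_eq by (simp only: scaleR_conv_of_real mult_1_right mult.commute[of "w x"])
      qed
    qed measurable
    moreover have "(LINT x|lborel. w x * bump l r (inverse (real (Suc n))) x) = 0" for n
      using that by (intro 0 bump_test_function) auto
    ultimately show ?thesis by (simp add: LIMSEQ_const_iff)
  qed
  have "AE x in lborel. indicator {- real n<..<real n} x *\<^sub>R w x = 0" for n :: nat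
  proof (rule ae_zero_if_interval_integrals_vanish)
    have "integrable lborel (\<lambda>x. indicator {- real n<..<real n} x *\<^sub>R (indicator {- real n..real n} x *\<^sub>R w x))"
      by (rule integrable_mult_indicator[OF _ locally_integrableD[OF w]]) simp
    then show "integrable lborel (\<lambda>x. indicator {- real n<..<real n} x *\<^sub>R w x)"
      by (rule back_subst[of "integrable lborel"]) (auto simp: fun_eq_iff indicator_def)
    show "(LINT x|lborel. indicator {- real n<..<real n} x *\<^sub>R w x) = 0"
      using int0[of "- real n" "real n"] by (cases "n = 0") auto
    fix l r :: real assume "l < r"
    have e: "indicator {l<..<r} x *\<^sub>R indicator {- real n<..<real n} x *\<^sub>R w x
      = indicator {max l (- real n)<..<min r (real n)} x *\<^sub>R w x" for x
      by (auto simp: indicator_def)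
    show "(LINT x|lborel. indicator {l<..<r} x *\<^sub>R indicator {- real n<..<real n} x *\<^sub>R w x) = 0"
      unfolding e using int0[of "max l (- real n)" "min r (real n)"]
      by (cases "max l (- real n) < min r (real n)") (simp_all del: max_less_iff_conj min_less_iff_conj)
  qed
  then have "AE x in lborel. \<forall>n::nat. indicator {- real n<..<real n} x *\<^sub>R w x = 0"
    unfolding AE_all_countable by blast
  then show ?thesis
  proof eventually_elim
    case (elim x)
    obtain n :: nat where "\<bar>x\<bar> < real n" using reals_Archimedean2 by blast
    then show ?case using elim[rule_format, of n] by (auto simp: indicator_def split: if_splits)
  qed
qed

lemma weak_deriv_unique:
  assumes "is_weak_deriv k u v" "is_weak_deriv k u v'"
  shows "AE x in lborel. v x = v' x"
proof -
  have l: "locally_integrable v" "locally_integrable v'" using assms by (simp_all add: is_weak_deriv_def)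
  have "AE x in lborel. v x - v' x = 0"
  proof (rule fundamental_lemma[OF locally_integrable_diff[OF l]])
    fix \<phi> assume t: "test_function \<phi>"
    have i: "integrable lborel (\<lambda>x. v x * \<phi> x)" "integrable lborel (\<lambda>x. v' x * \<phi> x)"
      using locally_integrable_mult_test[OF l(1) t locally_integrable_measurable[OF l(1)], of 0]
        locally_integrable_mult_test[OF l(2) t locally_integrable_measurable[OF l(2)], of 0] by simp_all
    have "(- 1) ^ k * (LINT x|lborel. v x * \<phi> x) = (- 1) ^ k * (LINT x|lborel. v' x * \<phi> x)"
      using assms t unfolding is_weak_deriv_def by metis
    then have "(LINT x|lborel. v x * \<phi> x) = (LINT x|lborel. v' x * \<phi> x)" by simp
    then show "(LINT x|lborel. (v x - v' x) * \<phi> x) = 0"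
      using i by (simp add: left_diff_distrib)
  qed
  then show ?thesis by simp
qed

lemma integrate_by_parts_right:
  assumes S: "\<And>x. (S has_vector_derivative S' x) (at x)" and S'c: "continuous_on UNIV S'"
    and \<phi>: "test_function \<phi>"
  shows "(LINT x|lborel. (if t < x then S x else 0) * vderiv 1 \<phi> x)
    = - (LINT x|lborel. (if t < x then S' x else 0) * \<phi> x) - S t * \<phi> t"
proof -
  obtain L0 where L0: "0 < L0" "\<And>k x. L0 \<le> \<bar>x\<bar> \<Longrightarrow> vderiv k \<phi> x = 0"
    by (rule test_function_support[OF \<phi>]) blast
  define L where "L = max L0 \<bar>t\<bar>"
  have L: "t \<le> L" "\<And>x. L \<le> x \<Longrightarrow> \<phi> x = 0" "\<And>x. L \<le> x \<Longrightarrow> vderiv 1 \<phi> x = 0"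
    using L0(2)[of _ 0] L0(2)[of _ 1] by (auto simp: L_def)
  have sm: "smooth \<phi>" using \<phi> by (simp add: test_function_iff)
  have d\<phi>: "(\<phi> has_vector_derivative vderiv 1 \<phi> x) (at x)" for x
    using smooth_has_vector_derivative[OF sm, of 0] by simp
  have Sc: "continuous_on UNIV S"
    using has_vector_derivative_continuous[OF S] by (intro continuous_at_imp_continuous_on) blast
  have c: "continuous_on A S" "continuous_on A S'" "continuous_on A \<phi>" "continuous_on A (vderiv 1 \<phi>)" for A
    using continuous_on_subset[OF Sc] continuous_on_subset[OF S'c] test_function_continuous[OF \<phi>, of _ 0]
      test_function_continuous[OF \<phi>, of _ 1] by simp_all
  let ?I = "\<lambda>x::real. indicator {t..L} x :: real"
  have "(LINT x|lborel. ?I x *\<^sub>R (S x * vderiv 1 \<phi> x + S' x * \<phi> x)) = S L * \<phi> L - S t * \<phi> t"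
  proof (rule integral_FTC_atLeastAtMost[OF L(1)])
    show "((\<lambda>x. S x * \<phi> x) has_vector_derivative S x * vderiv 1 \<phi> x + S' x * \<phi> x) (at x within {t..L})" for x
      using has_vector_derivative_mult[OF S d\<phi>] by (rule has_vector_derivative_at_within)
    show "continuous_on {t..L} (\<lambda>x. S x * vderiv 1 \<phi> x + S' x * \<phi> x)" by (intro continuous_intros c)
  qed
  moreover have i: "integrable lborel (\<lambda>x. ?I x *\<^sub>R (S x * vderiv 1 \<phi> x))" "integrable lborel (\<lambda>x. ?I x *\<^sub>R (S' x * \<phi> x))"
    by (intro borel_integrable_compact continuous_intros c; simp)+
  ultimately have *: "(LINT x|lborel. ?I x *\<^sub>R (S x * vderiv 1 \<phi> x)) + (LINT x|lborel. ?I x *\<^sub>R (S' x * \<phi> x)) = - S t * \<phi> t"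
    using L(2)[of L] by (simp add: scaleR_right_distrib)
  have ne: "AE x in lborel. x \<noteq> t" by (rule AE_lborel_singleton)
  have [measurable]: "S \<in> borel_measurable borel" "S' \<in> borel_measurable borel" "\<phi> \<in> borel_measurable borel" "vderiv 1 \<phi> \<in> borel_measurable borel"
    by (intro borel_measurable_continuous_onI c)+
  have "(LINT x|lborel. (if t < x then S x else 0) * vderiv 1 \<phi> x) = (LINT x|lborel. ?I x *\<^sub>R (S x * vderiv 1 \<phi> x))"
  proof (rule integral_cong_AE)
    show "AE x in lborel. (if t < x then S x else 0) * vderiv 1 \<phi> x = ?I x *\<^sub>R (S x * vderiv 1 \<phi> x)"
      using ne
    proof eventually_elim
      case (elim x)
      then show ?case using L(2,3)[of x] by (cases "t < x"; cases "x \<le> L") (auto simp: indicator_def)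
    qed
  qed measurable
  moreover have "(LINT x|lborel. (if t < x then S' x else 0) * \<phi> x) = (LINT x|lborel. ?I x *\<^sub>R (S' x * \<phi> x))"
  proof (rule integral_cong_AE)
    show "AE x in lborel. (if t < x then S' x else 0) * \<phi> x = ?I x *\<^sub>R (S' x * \<phi> x)"
      using ne
    proof eventually_elim
      case (elim x)
      then show ?case using L(2,3)[of x] by (cases "t < x"; cases "x \<le> L") (auto simp: indicator_def)
    qed
  qed measurable
  ultimately show ?thesis using * by (simp add: algebra_simps eq_neg_iff_add_eq_0)
qed

lemma integrate_by_parts:
  assumes g: "\<And>x. (g has_vector_derivative g' x) (at x)" and g'c: "continuous_on UNIV g'"
    and \<phi>: "test_function \<phi>"
  shows "(LINT x|lborel. g x * vderiv 1 \<phi> x) = - (LINT x|lborel. g' x * \<phi> x)"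
proof -
  obtain L where L: "0 < L" "\<And>k x. L \<le> \<bar>x\<bar> \<Longrightarrow> vderiv k \<phi> x = 0"
    by (rule test_function_support[OF \<phi>]) blast
  have e: "(if - L < x then v else 0) * vderiv 1 \<phi> x = v * vderiv 1 \<phi> x"
    "(if - L < x then v else 0) * \<phi> x = v * \<phi> x" for x v
    using L(2)[of x 1] L(2)[of x 0] by auto
  show ?thesis
    using integrate_by_parts_right[OF assms, of "- L"] L(1) L(2)[of "- L" 0] unfolding e by simp
qed

lemma smooth_diff_cmult:
  assumes "smooth f" "smooth g" shows "smooth (\<lambda>x. f x - c * g x)"
proof (rule smoothI_class)
  let ?S = "{(\<lambda>x. vderiv k f x - c * vderiv k g x) | k. True}"
  have "(\<lambda>x. f x - c * g x) = (\<lambda>x. vderiv 0 f x - c * vderiv 0 g x)" by simp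
  then show "(\<lambda>x. f x - c * g x) \<in> ?S" by blast
  fix h assume "h \<in> ?S"
  then obtain k where h: "h = (\<lambda>x. vderiv k f x - c * vderiv k g x)" by blast
  have "\<forall>x. (h has_vector_derivative vderiv (Suc k) f x - c * vderiv (Suc k) g x) (at x)"
    unfolding h by (intro allI has_vector_derivative_diff has_vector_derivative_mult_right
        smooth_has_vector_derivative assms)
  then show "\<exists>h'\<in>?S. \<forall>x. (h has_vector_derivative h' x) (at x)"
    by (intro bexI[of _ "\<lambda>x. vderiv (Suc k) f x - c * vderiv (Suc k) g x"]) blast+
qed

lemma test_function_diff_cmult:
  assumes "test_function f" "test_function g" shows "test_function (\<lambda>x. f x - c * g x)"
proof -
  obtain L where L: "\<And>k x. L \<le> \<bar>x\<bar> \<Longrightarrow> vderiv k f x = 0"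
    by (rule test_function_support[OF assms(1)]) blast
  obtain L' where L': "\<And>k x. L' \<le> \<bar>x\<bar> \<Longrightarrow> vderiv k g x = 0"
    by (rule test_function_support[OF assms(2)]) blast
  have "f x - c * g x = 0" if "max L L' < \<bar>x\<bar>" for x
    using L[of x 0] L'[of x 0] that by simp
  then show ?thesis using assms smooth_diff_cmult unfolding test_function_iff by blast
qed

lemma integrable_test_function: "test_function \<phi> \<Longrightarrow> integrable lborel (vderiv k \<phi>)"
  using locally_integrable_mult_test[OF locally_integrable_continuous[of "\<lambda>_. 1"], of \<phi> k] by simp

text \<open>
  Integrating from the left of the support gives a smooth function that is constant on both sides of
  the support; the vanishing integral makes both constants zero.
\<close>

lemma test_function_antiderivative:
  assumes \<eta>: "test_function \<eta>" and 0: "(LINT x|lborel. \<eta> x) = 0"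
  obtains \<phi> where "test_function \<phi>" "vderiv 1 \<phi> = \<eta>"
proof -
  obtain L where L: "0 < L" "\<And>k x. L \<le> \<bar>x\<bar> \<Longrightarrow> vderiv k \<eta> x = 0"
    by (rule test_function_support[OF \<eta>]) blast
  have \<eta>0: "\<eta> x = 0" if "L \<le> \<bar>x\<bar>" for x using L(2)[OF that, of 0] by simp
  have \<eta>c: "continuous_on A \<eta>" for A using test_function_continuous[OF \<eta>, of _ 0] by simp
  from exists_antiderivative[OF \<eta>c, of "- L"]
  obtain \<phi> where \<phi>: "\<phi> (- L) = 0" "\<And>x. (\<phi> has_vector_derivative \<eta> x) (at x)" by blast
  have v1: "vderiv 1 \<phi> = \<eta>"
    using \<phi>(2) by (auto simp: vderiv_Suc[of 0, simplified] intro: vector_derivative_at)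
  have left: "\<phi> x = 0" if "x \<le> - L" for x
  proof -
    have "(\<phi> has_vector_derivative 0) (at y within {..- L})" if "y \<in> {..- L}" for y
      using \<phi>(2)[of y] \<eta>0[of y] that L(1) by (auto intro: has_vector_derivative_at_within)
    then obtain c where "\<And>y. y \<in> {..- L} \<Longrightarrow> \<phi> y = c"
      using has_vector_derivative_zero_constant[of "{..- L}" \<phi>] by (metis convex_real_interval(2))
    then show ?thesis using that \<phi>(1) by (metis atMost_iff order_refl)
  qed
  have "(LINT x|lborel. indicator {- L..L} x *\<^sub>R \<eta> x) = \<phi> L - \<phi> (- L)"
    using L(1) \<phi>(2) \<eta>c by (intro integral_FTC_atLeastAtMost) (auto intro: has_vector_derivative_at_within)
  moreover have "(LINT x|lborel. indicator {- L..L} x *\<^sub>R \<eta> x) = (LINT x|lborel. \<eta> x)"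
    using \<eta>0 by (intro Bochner_Integration.integral_cong) (auto simp: indicator_def)
  ultimately have \<phi>L: "\<phi> L = 0" using 0 \<phi>(1) by simp
  have right: "\<phi> x = 0" if "L \<le> x" for x
  proof -
    have "(\<phi> has_vector_derivative 0) (at y within {L..})" if "y \<in> {L..}" for y
      using \<phi>(2)[of y] \<eta>0[of y] that L(1) by (auto intro: has_vector_derivative_at_within)
    then obtain c where "\<And>y. y \<in> {L..} \<Longrightarrow> \<phi> y = c"
      using has_vector_derivative_zero_constant[of "{L..}" \<phi>] by (metis convex_real_interval(1))
    then show ?thesis using that \<phi>L by (metis atLeast_iff order_refl)
  qed
  have sm: "smooth \<eta>" using \<eta> by (simp add: test_function_iff)
  have "smooth \<phi>"
  proof (rule smoothI_class)
    show "\<phi> \<in> insert \<phi> {vderiv k \<eta> | k. True}" by simp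
    fix g assume "g \<in> insert \<phi> {vderiv k \<eta> | k. True}"
    then consider "g = \<phi>" | k where "g = vderiv k \<eta>" by blast
    then show "\<exists>g'\<in>insert \<phi> {vderiv k \<eta> | k. True}. \<forall>x. (g has_vector_derivative g' x) (at x)"
    proof cases
      case 1
      have "\<eta> = vderiv 0 \<eta>" by simp
      then have "\<eta> \<in> insert \<phi> {vderiv k \<eta> | k. True}" by blast
      then show ?thesis using 1 \<phi>(2) by blast
    next
      case 2
      then show ?thesis using smooth_has_vector_derivative[OF sm, of k] by blast
    qed
  qed
  moreover have "\<phi> x = 0" if "L < \<bar>x\<bar>" for x using left[of x] right[of x] that by linarith
  ultimately have "test_function \<phi>" unfolding test_function_iff by blast
  then show ?thesis using v1 by (rule that)
qed

text \<open>
  Fix a test function \<open>b\<close> with nonzero integral \<open>B\<close>. Every test function \<open>\<psi>\<close> differs from a multiple of \<open>b\<close> by the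
  derivative of a test function, hence \<open>\<integral> D \<psi> = c \<integral> \<psi>\<close> with \<open>c = \<integral> D b / B\<close>.
\<close>

lemma weak_deriv_zero_imp_constant:
  assumes D: "locally_integrable D" and 0: "\<And>\<phi>. test_function \<phi> \<Longrightarrow> (LINT x|lborel. D x * vderiv 1 \<phi> x) = 0"
  shows "\<exists>c. AE x in lborel. D x = c"
proof -
  have Dm: "D \<in> borel_measurable borel" by (rule locally_integrable_measurable[OF D])
  define b where "b = bump (- 1) 1 1"
  have b: "test_function b" unfolding b_def by (rule bump_test_function) auto
  define B where "B = (LINT x|lborel. b x)"
  have B: "B \<noteq> 0" unfolding B_def b_def by (rule bump_integral_ne_0) auto
  define c where "c = (LINT x|lborel. D x * b x) / B"
  have i: "integrable lborel (\<lambda>x. u x * \<phi> x)" if "locally_integrable u" "test_function \<phi>" for u \<phi>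
    using locally_integrable_mult_test[OF that locally_integrable_measurable[OF that(1)], of 0] by simp
  have ib: "integrable lborel \<phi>" if "test_function \<phi>" for \<phi>
    using integrable_test_function[OF that, of 0] by simp
  have "AE x in lborel. D x - c = 0"
  proof (rule fundamental_lemma)
    show "locally_integrable (\<lambda>x. D x - c)"
      by (intro locally_integrable_diff D locally_integrable_continuous) simp
    fix \<psi> assume \<psi>: "test_function \<psi>"
    define e where "e = (LINT x|lborel. \<psi> x) / B"
    have t: "test_function (\<lambda>x. \<psi> x - e * b x)" by (rule test_function_diff_cmult[OF \<psi> b])
    have "(LINT x|lborel. \<psi> x - e * b x) = 0"
      using ib[OF \<psi>] ib[OF b] B by (simp add: e_def B_def)
    then obtain \<phi> where \<phi>: "test_function \<phi>" "vderiv 1 \<phi> = (\<lambda>x. \<psi> x - e * b x)"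
      by (rule test_function_antiderivative[OF t])
    have "0 = (LINT x|lborel. D x * (\<psi> x - e * b x))" using 0[OF \<phi>(1)] unfolding \<phi>(2) by simp
    also have "\<dots> = (LINT x|lborel. D x * \<psi> x - e * (D x * b x))"
      by (intro Bochner_Integration.integral_cong) (auto simp: algebra_simps)
    also have "\<dots> = (LINT x|lborel. D x * \<psi> x) - e * (LINT x|lborel. D x * b x)"
      using i[OF D \<psi>] i[OF D b] by simp
    finally have "(LINT x|lborel. D x * \<psi> x) = c * (LINT x|lborel. \<psi> x)"
      by (simp add: e_def c_def)
    then show "(LINT x|lborel. (D x - c) * \<psi> x) = 0"
      using i[OF D \<psi>] ib[OF \<psi>] by (simp add: left_diff_distrib)
  qed
  then show ?thesis by auto
qed

text \<open>
  The oriented indicator of the interval between \<open>0\<close> and \<open>x\<close>. It makes the primitive from \<open>0\<close> a single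
  integral with a kernel, to which Fubini's theorem applies for both signs of \<open>x\<close>.
\<close>

definition orient :: "real \<Rightarrow> real \<Rightarrow> real" where
  "orient x y = of_bool (0 \<le> y \<and> y \<le> x) - of_bool (x < y \<and> y < 0)"

definition primitive :: "(real \<Rightarrow> complex) \<Rightarrow> real \<Rightarrow> complex" where
  "primitive v x = (LINT y|lborel. orient x y *\<^sub>R v y)"

lemma orient_measurable [measurable]: "(\<lambda>(x, y). orient x y) \<in> borel_measurable (borel \<Otimes>\<^sub>M borel)"
  unfolding orient_def by measurable

lemma orient_measurable2 [measurable]: "orient x \<in> borel_measurable borel"
  unfolding orient_def[abs_def] by measurable

lemma orient_le: "\<bar>x\<bar> \<le> L \<Longrightarrow> \<bar>orient x y\<bar> \<le> indicator {- L..L} y"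
  by (auto simp: orient_def indicator_def)

lemma orient_norm_le: "\<bar>x\<bar> \<le> L \<Longrightarrow> norm (orient x y *\<^sub>R v y) \<le> norm (indicator {- L..L} y *\<^sub>R (v y :: complex))"
  using mult_right_mono[OF orient_le[of x L y], of "norm (v y)"] by simp

lemma orient_integrable:
  assumes v: "locally_integrable v" shows "integrable lborel (\<lambda>y. orient x y *\<^sub>R v y)"
proof (rule Bochner_Integration.integrable_bound[OF locally_integrableD[OF v, of "- \<bar>x\<bar>" "\<bar>x\<bar>"]])
  note [measurable] = locally_integrable_measurable[OF v]
  show "(\<lambda>y. orient x y *\<^sub>R v y) \<in> borel_measurable lborel" by measurable
qed (auto intro!: AE_I2 orient_norm_le simp del: norm_scaleR)

lemma primitive_continuous:
  assumes v: "locally_integrable v" shows "continuous_on UNIV (primitive v)"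
proof -
  note [measurable] = locally_integrable_measurable[OF v]
  have "(\<lambda>n. primitive v (X n)) \<longlonglongrightarrow> primitive v x" if X: "X \<longlonglongrightarrow> x" for X :: "nat \<Rightarrow> real" and x
  proof -
    have "bounded (range X)" using X by (rule convergent_imp_bounded)
    then obtain L where L: "\<And>n. \<bar>X n\<bar> \<le> L" by (auto simp: bounded_iff)
    show ?thesis unfolding primitive_def
    proof (rule integral_dominated_convergence[where w = "\<lambda>y. norm (indicator {- L..L} y *\<^sub>R v y)"])
      show "integrable lborel (\<lambda>y. norm (indicator {- L..L} y *\<^sub>R v y))"
        by (intro integrable_norm locally_integrableD v)
      show "AE y in lborel. (\<lambda>n. orient (X n) y *\<^sub>R v y) \<longlonglongrightarrow> orient x y *\<^sub>R v y"
        using AE_lborel_singleton[of x]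
      proof eventually_elim
        case (elim y)
        have "\<forall>\<^sub>F n in sequentially. orient (X n) y = orient x y"
        proof (cases "y < x")
          case True
          then have "\<forall>\<^sub>F n in sequentially. y < X n" using X by (simp add: order_tendsto_iff)
          then show ?thesis by eventually_elim (use True in \<open>auto simp: orient_def\<close>)
        next
          case False
          with elim have "x < y" by simp
          then have "\<forall>\<^sub>F n in sequentially. X n < y" using X by (simp add: order_tendsto_iff)
          then show ?thesis by eventually_elim (use \<open>x < y\<close> in \<open>auto simp: orient_def\<close>)
        qed
        then have "\<forall>\<^sub>F n in sequentially. orient (X n) y *\<^sub>R v y = orient x y *\<^sub>R v y" by eventually_elim simp
        then show ?case by (rule tendsto_eventually)
      qed
      show "AE y in lborel. norm (orient (X n) y *\<^sub>R v y) \<le> norm (indicator {- L..L} y *\<^sub>R v y)" for n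
        by (intro AE_I2 orient_norm_le L)
    qed measurable
  qed
  then show ?thesis by (auto simp: continuous_on_sequentially o_def)
qed

lemma primitive_has_vector_derivative:
  assumes v: "continuous_on UNIV v" shows "(primitive v has_vector_derivative v x) (at x)"
proof -
  from exists_antiderivative[OF v, of 0] obtain F where
    F: "F 0 = 0" "\<And>x. (F has_vector_derivative v x) (at x)" by blast
  have FTC: "(LINT y|lborel. indicator {l..r} y *\<^sub>R v y) = F r - F l" if "l \<le> r" for l r
    using that F(2) v by (intro integral_FTC_atLeastAtMost) (auto intro: has_vector_derivative_at_within continuous_on_subset)
  have "primitive v x = F x" for x
  proof (cases "0 \<le> x")
    case True
    then have "orient x y = indicator {0..x} y" for y by (auto simp: orient_def indicator_def)
    then show ?thesis using FTC[OF True] F(1) by (simp add: primitive_def)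
  next
    case False
    have [measurable]: "v \<in> borel_measurable borel" by (rule borel_measurable_continuous_onI[OF v])
    have "(LINT y|lborel. orient x y *\<^sub>R v y) = (LINT y|lborel. - (indicator {x..0} y *\<^sub>R v y))"
    proof (rule integral_cong_AE)
      show "AE y in lborel. orient x y *\<^sub>R v y = - (indicator {x..0} y *\<^sub>R v y)"
        using AE_lborel_singleton[of x] AE_lborel_singleton[of 0]
        by eventually_elim (use False in \<open>auto simp: orient_def indicator_def\<close>)
    qed measurable
    then show ?thesis using FTC[of x 0] False F(1) by (simp add: primitive_def)
  qed
  then have "primitive v = F" by (simp add: fun_eq_iff)
  then show ?thesis using F(2) by simp
qed

lemma primitive_weak_deriv:
  assumes v: "locally_integrable v" and \<phi>: "test_function \<phi>"
  shows "(LINT x|lborel. primitive v x * vderiv 1 \<phi> x) = - (LINT y|lborel. v y * \<phi> y)"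
proof -
  note [measurable] = locally_integrable_measurable[OF v] test_function_measurable[OF \<phi>, of 1]
  obtain L where L: "0 < L" "\<And>k x. L \<le> \<bar>x\<bar> \<Longrightarrow> vderiv k \<phi> x = 0"
    by (rule test_function_support[OF \<phi>]) blast
  define N where "N = (LINT y|lborel. norm (indicator {- L..L} y *\<^sub>R v y))"
  have int: "integrable (lborel \<Otimes>\<^sub>M lborel) (\<lambda>(x, y). orient x y *\<^sub>R v y * vderiv 1 \<phi> x)"
  proof (rule lborel_pair.Fubini_integrable)
    show "(\<lambda>(x, y). orient x y *\<^sub>R v y * vderiv 1 \<phi> x) \<in> borel_measurable (lborel \<Otimes>\<^sub>M lborel)" by measurable
    show "AE x in lborel. integrable lborel (\<lambda>y. case (x, y) of (x, y) \<Rightarrow> orient x y *\<^sub>R v y * vderiv 1 \<phi> x)"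
      using integrable_mult_left[OF orient_integrable[OF v]] by (intro AE_I2) (simp only: prod.case)
    show "integrable lborel (\<lambda>x. LINT y|lborel. norm (case (x, y) of (x, y) \<Rightarrow> orient x y *\<^sub>R v y * vderiv 1 \<phi> x))"
    proof (rule Bochner_Integration.integrable_bound)
      show "integrable lborel (\<lambda>x. N * norm (vderiv 1 \<phi> x))"
        by (intro integrable_mult_right integrable_norm integrable_test_function[OF \<phi>])
      show "AE x in lborel. norm (LINT y|lborel. norm (case (x, y) of (x, y) \<Rightarrow> orient x y *\<^sub>R v y * vderiv 1 \<phi> x))
        \<le> norm (N * norm (vderiv 1 \<phi> x))"
      proof (rule AE_I2)
        fix x
        have "(LINT y|lborel. norm (orient x y *\<^sub>R v y)) * norm (vderiv 1 \<phi> x) \<le> N * norm (vderiv 1 \<phi> x)"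
        proof (cases "\<bar>x\<bar> \<le> L")
          case True
          show ?thesis unfolding N_def
            by (intro mult_right_mono integral_mono integrable_norm orient_integrable v locally_integrableD orient_norm_le True) auto
        qed (use L(2)[of x 1] in auto)
        moreover have "(LINT y|lborel. norm (orient x y *\<^sub>R v y * vderiv 1 \<phi> x))
          = (LINT y|lborel. norm (orient x y *\<^sub>R v y)) * norm (vderiv 1 \<phi> x)"
          unfolding norm_mult by (rule integral_mult_left_zero)
        moreover have "0 \<le> (LINT y|lborel. norm (orient x y *\<^sub>R v y * vderiv 1 \<phi> x))" by simp
        ultimately show "norm (LINT y|lborel. norm (case (x, y) of (x, y) \<Rightarrow> orient x y *\<^sub>R v y * vderiv 1 \<phi> x))
          \<le> norm (N * norm (vderiv 1 \<phi> x))" by simp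
      qed
    qed measurable
  qed
  have c1: "(LINT x|lborel. vderiv 1 \<phi> x) = 0"
    using integrate_by_parts[of "\<lambda>_. 1" "\<lambda>_. 0" \<phi>, OF _ _ \<phi>] by simp
  have inner: "(LINT x|lborel. orient x y *\<^sub>R v y * vderiv 1 \<phi> x) = - (v y * \<phi> y)" for y
  proof -
    have c2: "(LINT x|lborel. (if y < x then 1 else 0) * vderiv 1 \<phi> x) = - \<phi> y"
      using integrate_by_parts_right[of "\<lambda>_. 1" "\<lambda>_. 0" \<phi> y, OF _ _ \<phi>] by simp
    have meas: "(\<lambda>x. (if y < x then 1 else 0) * vderiv 1 \<phi> x) \<in> borel_measurable lborel" by measurable
    have i2: "integrable lborel (\<lambda>x. (if y < x then 1 else 0) * vderiv 1 \<phi> x)"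
      by (rule Bochner_Integration.integrable_bound[OF integrable_test_function[OF \<phi>, of 1] meas]) (auto intro!: AE_I2)
    have "(LINT x|lborel. orient x y *\<^sub>R v y * vderiv 1 \<phi> x)
      = (LINT x|lborel. v y * ((if y < x then 1 else 0) * vderiv 1 \<phi> x - of_bool (y < 0) * vderiv 1 \<phi> x))"
    proof (rule integral_cong_AE)
      show "AE x in lborel. orient x y *\<^sub>R v y * vderiv 1 \<phi> x
          = v y * ((if y < x then 1 else 0) * vderiv 1 \<phi> x - of_bool (y < 0) * vderiv 1 \<phi> x)"
        using AE_lborel_singleton[of y] by eventually_elim (auto simp: orient_def)
    qed measurable
    also have "\<dots> = v y * (- \<phi> y - of_bool (y < 0) * 0)"
      using i2 integrable_test_function[OF \<phi>, of 1] c1 c2 by simp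
    finally show ?thesis by simp
  qed
  have "(LINT x|lborel. primitive v x * vderiv 1 \<phi> x) = (LINT x|lborel. LINT y|lborel. orient x y *\<^sub>R v y * vderiv 1 \<phi> x)"
    by (simp only: primitive_def integral_mult_left_zero)
  also have "\<dots> = (LINT y|lborel. LINT x|lborel. orient x y *\<^sub>R v y * vderiv 1 \<phi> x)"
    using lborel_pair.Fubini_integral[OF int] by simp
  also have "\<dots> = - (LINT y|lborel. v y * \<phi> y)" unfolding inner by simp
  finally show ?thesis .
qed

text \<open>
  The lemma of du Bois-Reymond: \<open>u\<close> minus the primitive of \<open>v\<close> has weak derivative zero.
\<close>

lemma weak_deriv_imp_primitive:
  assumes "is_weak_deriv 1 u v"
  shows "\<exists>c. AE x in lborel. u x = c + primitive v x"
proof -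
  have l: "locally_integrable u" "locally_integrable v" using assms by (simp_all add: is_weak_deriv_def)
  have lp: "locally_integrable (primitive v)" by (rule locally_integrable_continuous[OF primitive_continuous[OF l(2)]])
  have "\<exists>c. AE x in lborel. u x - primitive v x = c"
  proof (rule weak_deriv_zero_imp_constant[OF locally_integrable_diff[OF l(1) lp]])
    fix \<phi> assume \<phi>: "test_function \<phi>"
    have i: "integrable lborel (\<lambda>x. w x * vderiv 1 \<phi> x)" if "locally_integrable w" for w
      by (rule locally_integrable_mult_test[OF that \<phi> locally_integrable_measurable[OF that]])
    have "(LINT x|lborel. u x * vderiv 1 \<phi> x) = - (LINT x|lborel. v x * \<phi> x)"
      using assms \<phi> unfolding is_weak_deriv_def by simp
    then show "(LINT x|lborel. (u x - primitive v x) * vderiv 1 \<phi> x) = 0"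
      using i[OF l(1)] i[OF lp] primitive_weak_deriv[OF l(2) \<phi>] by (simp add: left_diff_distrib)
  qed
  then show ?thesis by (auto simp: diff_eq_eq)
qed

section \<open>Sobolev functions\<close>

lemma L2_cong_AE:
  assumes "u \<in> L2 s" "AE x in lborel. u x = v x" "v \<in> borel_measurable borel"
  shows "v \<in> L2 s"
proof -
  note [measurable] = L2_measurable[OF assms(1)] assms(3)
  have "AE x in lborel. (japanese x powr s * norm (u x))\<^sup>2 = (japanese x powr s * norm (v x))\<^sup>2"
    using assms(2) by eventually_elim simp
  moreover have "integrable lborel (\<lambda>x. (japanese x powr s * norm (u x))\<^sup>2)" using assms(1) by (simp add: L2_def)
  moreover have "(\<lambda>x. (japanese x powr s * norm (u x))\<^sup>2) \<in> borel_measurable lborel"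
    "(\<lambda>x. (japanese x powr s * norm (v x))\<^sup>2) \<in> borel_measurable lborel" by measurable
  ultimately have "integrable lborel (\<lambda>x. (japanese x powr s * norm (v x))\<^sup>2)"
    using integrable_cong_AE by blast
  then show ?thesis using assms(3) by (simp add: L2_def)
qed

lemma norm_L2_cong_AE:
  assumes "AE x in lborel. u x = v x" "u \<in> borel_measurable borel" "v \<in> borel_measurable borel"
  shows "norm_L2 s u = norm_L2 s v"
proof -
  note [measurable] = assms(2,3)
  have "(LINT x|lborel. (japanese x powr s * norm (u x))\<^sup>2) = (LINT x|lborel. (japanese x powr s * norm (v x))\<^sup>2)"
  proof (rule integral_cong_AE)
    show "AE x in lborel. (japanese x powr s * norm (u x))\<^sup>2 = (japanese x powr s * norm (v x))\<^sup>2"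
      using assms(1) by eventually_elim simp
  qed measurable
  then show ?thesis by (simp add: norm_L2_def)
qed

lemma L2_add:
  assumes "u \<in> L2 s" "v \<in> L2 s" shows "(\<lambda>x. u x + v x) \<in> L2 s"
proof -
  note [measurable] = L2_measurable[OF assms(1)] L2_measurable[OF assms(2)]
  have "integrable lborel (\<lambda>x. 2 * (japanese x powr s * norm (u x))\<^sup>2 + 2 * (japanese x powr s * norm (v x))\<^sup>2)"
    using assms by (auto simp: L2_def)
  then have "integrable lborel (\<lambda>x. (japanese x powr s * norm (u x + v x))\<^sup>2)"
  proof (rule Bochner_Integration.integrable_bound)
    show "AE x in lborel. norm ((japanese x powr s * norm (u x + v x))\<^sup>2)
        \<le> norm (2 * (japanese x powr s * norm (u x))\<^sup>2 + 2 * (japanese x powr s * norm (v x))\<^sup>2)"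
    proof (rule AE_I2)
      fix x
      let ?a = "norm (u x)" and ?b = "norm (v x)" and ?j = "(japanese x powr s)\<^sup>2"
      have "(norm (u x + v x))\<^sup>2 \<le> (?a + ?b)\<^sup>2" by (intro power_mono norm_triangle_ineq) auto
      also have "\<dots> \<le> 2 * ?a\<^sup>2 + 2 * ?b\<^sup>2"
        using sum_squares_bound[of ?a ?b] by (simp add: power2_sum)
      finally have "?j * (norm (u x + v x))\<^sup>2 \<le> ?j * (2 * ?a\<^sup>2 + 2 * ?b\<^sup>2)" by (intro mult_left_mono) auto
      then show "norm ((japanese x powr s * norm (u x + v x))\<^sup>2)
        \<le> norm (2 * (japanese x powr s * norm (u x))\<^sup>2 + 2 * (japanese x powr s * norm (v x))\<^sup>2)"
        by (simp add: power_mult_distrib algebra_simps)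
    qed
  qed measurable
  then show ?thesis by (simp add: L2_def)
qed

lemma L2_mult_bounded:
  assumes u: "u \<in> L2 s" and [measurable]: "b \<in> borel_measurable borel" and le: "\<And>x. norm (b x) \<le> B"
  shows "(\<lambda>x. b x * u x) \<in> L2 s"
proof -
  note [measurable] = L2_measurable[OF u]
  have "integrable lborel (\<lambda>x. B\<^sup>2 * (japanese x powr s * norm (u x))\<^sup>2)" using u by (simp add: L2_def)
  then have "integrable lborel (\<lambda>x. (japanese x powr s * norm (b x * u x))\<^sup>2)"
  proof (rule Bochner_Integration.integrable_bound)
    show "AE x in lborel. norm ((japanese x powr s * norm (b x * u x))\<^sup>2) \<le> norm (B\<^sup>2 * (japanese x powr s * norm (u x))\<^sup>2)"
    proof (rule AE_I2)
      fix x
      have "(norm (b x))\<^sup>2 \<le> B\<^sup>2" by (intro power_mono le) auto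
      then have "(norm (b x))\<^sup>2 * (japanese x powr s * norm (u x))\<^sup>2 \<le> B\<^sup>2 * (japanese x powr s * norm (u x))\<^sup>2"
        by (rule mult_right_mono) simp
      then show "norm ((japanese x powr s * norm (b x * u x))\<^sup>2) \<le> norm (B\<^sup>2 * (japanese x powr s * norm (u x))\<^sup>2)"
        by (simp add: norm_mult power_mult_distrib ac_simps)
    qed
  qed measurable
  then show ?thesis by (simp add: L2_def)
qed

lemma L2_cmult: "u \<in> L2 s \<Longrightarrow> (\<lambda>x. c * u x) \<in> L2 s"
  by (rule L2_mult_bounded[where B = "norm c"]) auto

lemma L2_diff: "u \<in> L2 s \<Longrightarrow> v \<in> L2 s \<Longrightarrow> (\<lambda>x. u x - v x) \<in> L2 s"
  using L2_add[OF _ L2_cmult[of v s "-1"], of u] by simp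

lemma L2_subset_L2_0:
  assumes u: "u \<in> L2 s" and s: "0 \<le> s" shows "u \<in> L2 0"
proof -
  note [measurable] = L2_measurable[OF u]
  have "integrable lborel (\<lambda>x. (japanese x powr s * norm (u x))\<^sup>2)" using u by (simp add: L2_def)
  then have "integrable lborel (\<lambda>x. (norm (u x))\<^sup>2)"
  proof (rule Bochner_Integration.integrable_bound)
    show "AE x in lborel. norm ((norm (u x))\<^sup>2) \<le> norm ((japanese x powr s * norm (u x))\<^sup>2)"
    proof (rule AE_I2)
      fix x
      have "1 * norm (u x) \<le> japanese x powr s * norm (u x)"
        using japanese_ge(1)[of x] s by (intro mult_right_mono ge_one_powr_ge_zero) auto
      then have "(norm (u x))\<^sup>2 \<le> (japanese x powr s * norm (u x))\<^sup>2" by (intro power_mono) auto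
      then show "norm ((norm (u x))\<^sup>2) \<le> norm ((japanese x powr s * norm (u x))\<^sup>2)" by simp
    qed
  qed measurable
  then show ?thesis by (simp add: L2_0)
qed

lemma L2_locally_integrable:
  assumes u: "u \<in> L2 0" shows "locally_integrable u"
  unfolding locally_integrable_def set_integrable_def
proof safe
  note [measurable] = L2_measurable[OF u]
  fix A :: "real set" assume A: "compact A"
  then have [measurable]: "A \<in> sets borel" by (rule borel_compact)
  have "integrable lborel (\<lambda>x. indicator A x *\<^sub>R (1::real))"
    by (rule borel_integrable_compact[OF A]) simp
  then have 1: "integrable lborel (\<lambda>x. (indicator A x)\<^sup>2 :: real)"
    by (rule back_subst[of "integrable lborel"]) (auto simp: fun_eq_iff indicator_def)
  have 2: "integrable lborel (\<lambda>x. (norm (u x))\<^sup>2)" using u by (simp add: L2_0)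
  have "integrable lborel (\<lambda>x. indicator A x * norm (u x))"
    by (rule Cauchy_Schwarz_integral(1)[OF _ _ 1 2]) measurable
  then show "integrable lborel (\<lambda>x. indicator A x *\<^sub>R u x)"
    by (rule Bochner_Integration.integrable_bound) (auto intro!: AE_I2)
qed

lemma is_weak_deriv_lincomb:
  assumes "is_weak_deriv k u v" "is_weak_deriv k u' v'"
  shows "is_weak_deriv k (\<lambda>x. u x - c * u' x) (\<lambda>x. v x - c * v' x)"
proof -
  have l: "locally_integrable u" "locally_integrable v" "locally_integrable u'" "locally_integrable v'"
    using assms by (simp_all add: is_weak_deriv_def)
  have i: "integrable lborel (\<lambda>x. w x * vderiv j \<phi> x)" if "locally_integrable w" "test_function \<phi>" for w \<phi> j
    by (rule locally_integrable_mult_test[OF that locally_integrable_measurable[OF that(1)]])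
  show ?thesis unfolding is_weak_deriv_def
  proof (intro conjI allI impI)
    show "locally_integrable (\<lambda>x. u x - c * u' x)" "locally_integrable (\<lambda>x. v x - c * v' x)"
      by (intro locally_integrable_diff locally_integrable_cmult l)+
    fix \<phi> assume \<phi>: "test_function \<phi>"
    have *: "(LINT x|lborel. (w x - c * w' x) * vderiv j \<phi> x)
      = (LINT x|lborel. w x * vderiv j \<phi> x) - c * (LINT x|lborel. w' x * vderiv j \<phi> x)"
      if "locally_integrable w" "locally_integrable w'" for w w' j
      using i[OF that(1) \<phi>, of j] i[OF that(2) \<phi>, of j] by (simp add: left_diff_distrib mult.assoc)
    show "(LINT x|lborel. (u x - c * u' x) * vderiv k \<phi> x) = (- 1) ^ k * (LINT x|lborel. (v x - c * v' x) * \<phi> x)"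
    proof -
      have "(LINT x|lborel. u x * vderiv k \<phi> x) = (- 1) ^ k * (LINT x|lborel. v x * \<phi> x)"
        "(LINT x|lborel. u' x * vderiv k \<phi> x) = (- 1) ^ k * (LINT x|lborel. v' x * \<phi> x)"
        using assms \<phi> unfolding is_weak_deriv_def by blast+
      then show ?thesis
        unfolding *[OF l(1,3), of k] *[OF l(2,4), of 0, unfolded vderiv_0]
        by (simp only: right_diff_distrib mult.left_commute)
    qed
  qed
qed

lemma is_weak_deriv_0: "u \<in> L2 0 \<Longrightarrow> is_weak_deriv 0 u u"
  using L2_locally_integrable by (simp add: is_weak_deriv_def)

lemma is_weak_deriv_cmult:
  assumes "is_weak_deriv k u v" shows "is_weak_deriv k (\<lambda>x. c * u x) (\<lambda>x. c * v x)"
proof -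
  have "locally_integrable (\<lambda>_. 0 :: complex)" by (rule locally_integrable_continuous) simp
  then have "is_weak_deriv k (\<lambda>_. 0) (\<lambda>_. 0)" by (simp add: is_weak_deriv_def)
  from is_weak_deriv_lincomb[OF this assms, of "- c"] show ?thesis by simp
qed

lemma Sobolev_H_lincomb:
  assumes "u \<in> Sobolev_H N" "u' \<in> Sobolev_H N"
  shows "(\<lambda>x. u x - c * u' x) \<in> Sobolev_H N"
  unfolding Sobolev_H_def
proof (intro CollectI conjI allI impI)
  show "(\<lambda>x. u x - c * u' x) \<in> L2 0" using assms by (intro L2_diff L2_cmult) (auto simp: Sobolev_H_def)
  fix k assume "k \<le> N"
  then obtain v v' where v: "v \<in> L2 0" "is_weak_deriv k u v" "v' \<in> L2 0" "is_weak_deriv k u' v'"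
    using assms unfolding Sobolev_H_def by blast
  then show "\<exists>v\<in>L2 0. is_weak_deriv k (\<lambda>x. u x - c * u' x) v"
    using is_weak_deriv_lincomb[OF v(2,4), of c] by (intro bexI[of _ "\<lambda>x. v x - c * v' x"] L2_diff L2_cmult) auto
qed

lemma weak_deriv_is_weak_deriv: "is_weak_deriv k u v \<Longrightarrow> is_weak_deriv k u (weak_deriv k u)"
  unfolding weak_deriv_def by (rule someI[of "is_weak_deriv k u"])

lemma primitive_cong_AE:
  assumes "AE x in lborel. v x = v' x" "v \<in> borel_measurable borel" "v' \<in> borel_measurable borel"
  shows "primitive v = primitive v'"
proof
  fix x
  note [measurable] = assms(2,3)
  show "primitive v x = primitive v' x" unfolding primitive_def
  proof (rule integral_cong_AE)
    show "AE y in lborel. orient x y *\<^sub>R v y = orient x y *\<^sub>R v' y" using assms(1) by eventually_elim simp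
  qed measurable
qed

lemma weak_deriv_chain:
  assumes "is_weak_deriv k u v" "is_weak_deriv (Suc k) u w"
  shows "is_weak_deriv 1 v w"
  unfolding is_weak_deriv_def
proof (intro conjI allI impI)
  show "locally_integrable v" "locally_integrable w" using assms by (simp_all add: is_weak_deriv_def)
  fix \<phi> assume \<phi>: "test_function \<phi>"
  have "(LINT x|lborel. u x * vderiv k (vderiv 1 \<phi>) x) = (- 1) ^ k * (LINT x|lborel. v x * vderiv 1 \<phi> x)"
    using assms(1) test_function_vderiv[OF \<phi>] unfolding is_weak_deriv_def by blast
  moreover have "(LINT x|lborel. u x * vderiv (Suc k) \<phi> x) = (- 1) ^ Suc k * (LINT x|lborel. w x * \<phi> x)"
    using assms(2) \<phi> unfolding is_weak_deriv_def by blast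
  moreover have "vderiv k (vderiv 1 \<phi>) = vderiv (Suc k) \<phi>" by (simp add: vderiv_add)
  ultimately have "(- 1) ^ k * (LINT x|lborel. v x * vderiv 1 \<phi> x) = (- 1) ^ k * (- (LINT x|lborel. w x * \<phi> x))"
    by simp
  then have "(LINT x|lborel. v x * vderiv 1 \<phi> x) = - (LINT x|lborel. w x * \<phi> x)"
    by (metis mult_cancel_left power_not_zero zero_neq_neg_one)
  then show "(LINT x|lborel. v x * vderiv 1 \<phi> x) = (- 1) ^ 1 * (LINT x|lborel. w x * \<phi> x)"
    by simp
qed

text \<open>
  The weak derivatives of order \<open>1, 2, 3\<close> are successive weak derivatives of each other, so
  integrating three times expresses \<open>u\<close> as an iterated primitive of \<open>q u\<close>. This representative is
  continuous, which makes \<open>q u\<close> continuous up to a null set, and then all three integrations are classical.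
\<close>

lemma continuous_representative:
  assumes u: "u \<in> Sobolev_H 3" and v: "is_weak_deriv 3 u v" and eq: "AE x in lborel. v x = q x * u x"
    and q: "continuous_on UNIV q"
  obtains g g1 g2 where "jet_sol q g g1 g2" "AE x in lborel. u x = g x" "g \<in> L2 0" "g1 \<in> L2 0" "g2 \<in> L2 0"
proof -
  from u have "\<exists>v\<in>L2 0. is_weak_deriv 1 u v" "\<exists>v\<in>L2 0. is_weak_deriv 2 u v"
    unfolding Sobolev_H_def by auto
  then obtain w1 w2 where w: "w1 \<in> L2 0" "is_weak_deriv 1 u w1" "w2 \<in> L2 0" "is_weak_deriv 2 u w2"
    by blast
  have u0: "u \<in> L2 0" using u by (simp add: Sobolev_H_def)
  have u1: "is_weak_deriv 1 w1 w2" using weak_deriv_chain[OF w(2)] w(4) by (simp add: numeral_2_eq_2)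
  have u2: "is_weak_deriv 1 w2 v" using weak_deriv_chain[OF w(4)] v by (simp add: numeral_2_eq_2 numeral_3_eq_3)
  obtain c0 c1 c2 where c: "AE x in lborel. u x = c0 + primitive w1 x" "AE x in lborel. w1 x = c1 + primitive w2 x"
    "AE x in lborel. w2 x = c2 + primitive v x"
    using weak_deriv_imp_primitive[OF w(2)] weak_deriv_imp_primitive[OF u1] weak_deriv_imp_primitive[OF u2] by blast
  have lv: "locally_integrable v" using v by (simp add: is_weak_deriv_def)
  \<comment> \<open>replace each derivative by its continuous representative, starting with the highest\<close>
  define g2 where "g2 x = c2 + primitive v x" for x
  have g2c: "continuous_on UNIV g2" unfolding g2_def[abs_def] by (intro continuous_intros primitive_continuous lv)
  define g1 where "g1 x = c1 + primitive g2 x" for x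
  have g1c: "continuous_on UNIV g1" unfolding g1_def[abs_def]
    by (intro continuous_intros primitive_continuous locally_integrable_continuous g2c)
  define g where "g x = c0 + primitive g1 x" for x
  have gc: "continuous_on UNIV g" unfolding g_def[abs_def]
    by (intro continuous_intros primitive_continuous locally_integrable_continuous g1c)
  note m = borel_measurable_continuous_onI
  have w2g: "AE x in lborel. w2 x = g2 x" using c(3) by (simp add: g2_def)
  have "primitive w2 = primitive g2" by (rule primitive_cong_AE[OF w2g L2_measurable[OF w(3)] m[OF g2c]])
  then have w1g: "AE x in lborel. w1 x = g1 x" using c(2) by (simp add: g1_def)
  have "primitive w1 = primitive g1" by (rule primitive_cong_AE[OF w1g L2_measurable[OF w(1)] m[OF g1c]])
  then have ug: "AE x in lborel. u x = g x" using c(1) by (simp add: g_def)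
  have qg: "continuous_on UNIV (\<lambda>x. q x * g x)" by (intro continuous_intros q gc)
  have "AE x in lborel. v x = q x * g x" using eq ug by eventually_elim simp
  then have "primitive v = primitive (\<lambda>x. q x * g x)"
    by (rule primitive_cong_AE[OF _ locally_integrable_measurable[OF lv] m[OF qg]])
  then have g2': "g2 = (\<lambda>x. c2 + primitive (\<lambda>x. q x * g x) x)" by (simp add: g2_def fun_eq_iff)
  have d: "((\<lambda>x. k + primitive f x) has_vector_derivative f x) (at x)" if "continuous_on UNIV f" for k f x
    using has_vector_derivative_add[OF has_vector_derivative_const[of k] primitive_has_vector_derivative[OF that]] by simp
  have "jet_sol q g g1 g2"
    unfolding jet_sol_def
  proof (intro conjI allI)
    show "(g has_vector_derivative g1 x) (at x)" "(g1 has_vector_derivative g2 x) (at x)" for x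
      using d[OF g1c, of c0 x] d[OF g2c, of c1 x] by (simp_all add: g_def[abs_def] g1_def[abs_def])
    show "(g2 has_vector_derivative q x * g x) (at x)" for x
      unfolding g2' using d[OF qg, of c2 x] .
  qed
  then show ?thesis
    using ug L2_cong_AE[OF u0 ug m[OF gc]] L2_cong_AE[OF w(1) w1g m[OF g1c]] L2_cong_AE[OF w(3) w2g m[OF g2c]]
    by (rule that)
qed

lemma square_integrable_not_bounded_below:
  fixes h :: "real \<Rightarrow> complex"
  assumes h: "h \<in> L2 0" and le: "(\<forall>x\<ge>l. c \<le> norm (h x)) \<or> (\<forall>x\<le>l. c \<le> norm (h x))"
  shows "c \<le> 0"
proof (rule ccontr)
  assume "\<not> c \<le> 0"
  then have c: "c > 0" by simp
  note [measurable] = L2_measurable[OF h]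
  have i: "integrable lborel (\<lambda>x. (norm (h x))\<^sup>2)" using h by (simp add: L2_0)
  define I where "I = (LINT x|lborel. (norm (h x))\<^sup>2)"
  have "real n * c\<^sup>2 \<le> I" for n :: nat
  proof -
    have "\<exists>b. \<forall>x\<in>{b..b + real n}. c \<le> norm (h x)"
      using le by (rule disjE) (auto intro: exI[of _ l] exI[of _ "l - real n"])
    then obtain b where b: "\<And>x. x \<in> {b..b + real n} \<Longrightarrow> c \<le> norm (h x)" by blast
    have i2: "integrable lborel (\<lambda>x. indicator {b..b + real n} x *\<^sub>R c\<^sup>2)"
      by (rule borel_integrable_compact) auto
    have "real n * c\<^sup>2 = (LINT x|lborel. indicator {b..b + real n} x *\<^sub>R c\<^sup>2)" by simp
    also have "\<dots> \<le> I" unfolding I_def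
    proof (rule integral_mono[OF i2 i])
      fix x
      show "indicator {b..b + real n} x *\<^sub>R c\<^sup>2 \<le> (norm (h x))\<^sup>2"
        using b[of x] c by (auto simp: indicator_def intro!: power_mono)
    qed
    finally show ?thesis .
  qed
  moreover obtain n :: nat where "I / c\<^sup>2 < real n" using reals_Archimedean2 by blast
  moreover have "0 < c\<^sup>2" using c by simp
  ultimately show False by (smt (verit) divide_less_eq)
qed

section \<open>The resolvent\<close>

lemma op_AV_eq: "op_AV 3 V u x = \<i> * weak_deriv 3 u x + V x * u x"
  by (simp add: op_AV_def power3_eq_cube)

lemma Sobolev_weak_deriv: "u \<in> Sobolev_H 3 \<Longrightarrow> is_weak_deriv 3 u (weak_deriv 3 u)"
  unfolding Sobolev_H_def using weak_deriv_is_weak_deriv by blast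

lemma piecewise_by_parts:
  assumes g: "\<And>x. (g has_vector_derivative g' x) (at x)" and g'c: "continuous_on UNIV g'"
    and S: "\<And>x. (S has_vector_derivative S' x) (at x)" and S'c: "continuous_on UNIV S'"
    and \<phi>: "test_function \<phi>"
  shows "(LINT x|lborel. (g x - (if t < x then S x else 0)) * vderiv 1 \<phi> x)
    = - (LINT x|lborel. (g' x - (if t < x then S' x else 0)) * \<phi> x) + S t * \<phi> t"
proof -
  have c: "continuous_on UNIV g" "continuous_on UNIV S"
    using has_vector_derivative_continuous[OF g] has_vector_derivative_continuous[OF S]
    by (auto intro!: continuous_at_imp_continuous_on)
  have i: "integrable lborel (\<lambda>x. h x * vderiv k \<phi> x)" if "continuous_on UNIV h" for h k
    using locally_integrable_continuous[OF that] by (intro locally_integrable_mult_test[OF _ \<phi>] locally_integrable_measurable)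
  have ii: "integrable lborel (\<lambda>x. (if t < x then h x else 0) * vderiv k \<phi> x)" if h: "continuous_on UNIV h" for h k
  proof (rule Bochner_Integration.integrable_bound[OF i[OF h, of k]])
    have [measurable]: "h \<in> borel_measurable borel" "vderiv k \<phi> \<in> borel_measurable borel"
      by (rule borel_measurable_continuous_onI[OF h], rule test_function_measurable[OF \<phi>])
    show "(\<lambda>x. (if t < x then h x else 0) * vderiv k \<phi> x) \<in> borel_measurable lborel" by measurable
  qed (auto intro!: AE_I2)
  have *: "(LINT x|lborel. (h x - (if t < x then h' x else 0)) * vderiv k \<phi> x)
    = (LINT x|lborel. h x * vderiv k \<phi> x) - (LINT x|lborel. (if t < x then h' x else 0) * vderiv k \<phi> x)"
    if "continuous_on UNIV h" "continuous_on UNIV h'" for h h' k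
    using i[OF that(1), of k] ii[OF that(2), of k] by (simp only: left_diff_distrib Bochner_Integration.integral_diff)
  show ?thesis
    unfolding *[OF c] *[OF g'c S'c, of 0, unfolded vderiv_0]
      integrate_by_parts[OF g g'c \<phi>] integrate_by_parts_right[OF S S'c \<phi>] by simp
qed

context cubic_problem
begin

text \<open>
  \<open>K(\<cdot>, t)\<close> and its first derivative are continuous across the diagonal while the second derivative
  drops by one; this jump is the term \<open>\<phi> t\<close>.
\<close>

lemma kernel_by_parts:
  assumes \<phi>: "test_function \<phi>"
  shows "(LINT x|lborel. K \<mu> x t * vderiv 1 \<phi> x) = - (LINT x|lborel. K' \<mu> x t * \<phi> x)"
    and "(LINT x|lborel. K' \<mu> x t * vderiv 1 \<phi> x) = - (LINT x|lborel. K'' \<mu> x t * \<phi> x)"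
    and "(LINT x|lborel. K'' \<mu> x t * vderiv 1 \<phi> x) = - (LINT x|lborel. K \<mu> x t * (q \<mu> x * \<phi> x)) + \<phi> t"
proof -
  let ?c = "\<delta> \<mu> t / W \<mu>"
  have g: "jet_sol (q \<mu>) (\<lambda>x. \<gamma> \<mu> x * ?c) (\<lambda>x. \<gamma>' \<mu> x * ?c) (\<lambda>x. \<gamma>'' \<mu> x * ?c)"
    using jet_sol_cmult[OF gamma_sol[of \<mu>], of ?c] by (simp only: mult.commute)
  note gd = jet_solD[OF g] and gc = jet_sol_continuous[OF g]
  note Sd = jet_solD[OF S_sol[of \<mu> t]] and Sc = jet_sol_continuous[OF S_sol[of \<mu> t]]
  have qc: "continuous_on UNIV (\<lambda>x. q \<mu> x * (\<gamma> \<mu> x * ?c))" "continuous_on UNIV (\<lambda>x. q \<mu> x * S \<mu> t x)"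
    by (intro continuous_intros q_cont gc Sc)+
  show "(LINT x|lborel. K \<mu> x t * vderiv 1 \<phi> x) = - (LINT x|lborel. K' \<mu> x t * \<phi> x)"
    using piecewise_by_parts[OF gd(1) gc(2) Sd(1) Sc(2) \<phi>, of t] by (simp only: K_def K'_def S_diag mult_zero_left add_0_right)
  show "(LINT x|lborel. K' \<mu> x t * vderiv 1 \<phi> x) = - (LINT x|lborel. K'' \<mu> x t * \<phi> x)"
    using piecewise_by_parts[OF gd(2) gc(3) Sd(2) Sc(3) \<phi>, of t] by (simp only: K'_def K''_def S_diag mult_zero_left add_0_right)
  have "(q \<mu> x * (\<gamma> \<mu> x * ?c) - (if t < x then q \<mu> x * S \<mu> t x else 0)) * \<phi> x = K \<mu> x t * (q \<mu> x * \<phi> x)" for x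
    unfolding K_def by (simp add: algebra_simps)
  then show "(LINT x|lborel. K'' \<mu> x t * vderiv 1 \<phi> x) = - (LINT x|lborel. K \<mu> x t * (q \<mu> x * \<phi> x)) + \<phi> t"
    using piecewise_by_parts[OF gd(3) qc(1) Sd(3) qc(2) \<phi>, of t] by (simp only: K''_def S_diag mult_1_left)
qed

lemma q_measurable [measurable]: "q \<mu> \<in> borel_measurable borel"
  by (rule borel_measurable_continuous_onI[OF q_cont])

lemma V_measurable [measurable]: "V \<in> borel_measurable borel"
  by (rule borel_measurable_continuous_onI[OF V_cont])

end

text \<open>
  A point of the upper half plane at which \<open>W\<close> does not vanish. The decay rate \<open>\<alpha>\<close> is positive but
  depends on \<open>z\<close>; it only serves to construct the resolvent.
\<close>

locale resolvent_point = kernel_bounds V a M y y' y'' \<mu> \<alpha> w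
  for V a M y y' y'' \<mu> \<alpha> w +
  fixes z :: complex
  assumes alpha_pos: "\<alpha> > 0" and mu_z: "\<mu> ^ 3 = - \<i> * z"
begin

definition CE where "CE = CK w * (1 + 1 / \<alpha>)\<^sup>2"

lemma exponential_kernels:
  "exponential_kernel (K \<mu>) CE \<alpha>" "exponential_kernel (K' \<mu>) CE \<alpha>" "exponential_kernel (K'' \<mu>) CE \<alpha>"
proof -
  have "jet_le (\<lambda>x. K \<mu> x t) (\<lambda>x. K' \<mu> x t) (\<lambda>x. K'' \<mu> x t) x (CE * exp (- \<alpha> * \<bar>x - t\<bar>))" for x t
  proof (rule jet_le_mono[OF kernel_le])
    have "p \<bar>x\<bar> * p \<bar>t\<bar> \<le> (1 + 1 / \<alpha>) * (1 + 1 / \<alpha>)"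
      using moderate_le[OF alpha_pos] p_nonneg alpha_pos by (intro mult_mono) auto
    then show "CK w * (p \<bar>x\<bar> * p \<bar>t\<bar>) * exp (- \<alpha> * \<bar>x - t\<bar>) \<le> CE * exp (- \<alpha> * \<bar>x - t\<bar>)"
      unfolding CE_def power2_eq_square by (intro mult_right_mono mult_left_mono CK_nonneg) auto
  qed
  then show "exponential_kernel (K \<mu>) CE \<alpha>" "exponential_kernel (K' \<mu>) CE \<alpha>" "exponential_kernel (K'' \<mu>) CE \<alpha>"
    using kernel_measurable alpha_pos by (unfold_locales; simp add: jet_le_def)+
qed

text \<open>
  The factor \<open>\<i>\<close> arises since \<open>(A + V - z) u = f\<close> reads \<open>u''' = q u - \<i> f\<close>.
\<close>

definition R where "R f x = \<i> * kernel_op (K \<mu>) f x"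

lemma kernel_op_weak_derivs:
  assumes f: "f \<in> L2 0"
  shows "is_weak_deriv 1 (kernel_op (K \<mu>) f) (kernel_op (K' \<mu>) f)"
    and "is_weak_deriv 2 (kernel_op (K \<mu>) f) (kernel_op (K'' \<mu>) f)"
    and "is_weak_deriv 3 (kernel_op (K \<mu>) f) (\<lambda>x. q \<mu> x * kernel_op (K \<mu>) f x - f x)"
proof -
  interpret k: exponential_kernel "K \<mu>" CE \<alpha> by (rule exponential_kernels)
  interpret k': exponential_kernel "K' \<mu>" CE \<alpha> by (rule exponential_kernels)
  interpret k'': exponential_kernel "K'' \<mu>" CE \<alpha> by (rule exponential_kernels)
  let ?u = "kernel_op (K \<mu>) f" and ?u1 = "kernel_op (K' \<mu>) f" and ?u2 = "kernel_op (K'' \<mu>) f"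
  have L2: "?u \<in> L2 0" "?u1 \<in> L2 0" "?u2 \<in> L2 0"
    using k.kernel_op_bound k'.kernel_op_bound k''.kernel_op_bound f by auto
  have L3: "(\<lambda>x. q \<mu> x * ?u x - f x) \<in> L2 0"
    using q_le[OF mu_le] by (intro L2_diff L2_mult_bounded[of _ 0 _ "M + 1"] L2 f) auto
  note l = L2_locally_integrable[OF L2(1)] L2_locally_integrable[OF L2(2)] L2_locally_integrable[OF L2(3)]
    L2_locally_integrable[OF L3]
  have D1: "(LINT x|lborel. ?u x * vderiv 1 \<phi> x) = - (LINT x|lborel. ?u1 x * \<phi> x)"
    and D2: "(LINT x|lborel. ?u1 x * vderiv 1 \<phi> x) = - (LINT x|lborel. ?u2 x * \<phi> x)"
    and D3: "(LINT x|lborel. ?u2 x * vderiv 1 \<phi> x) = - (LINT x|lborel. (q \<mu> x * ?u x - f x) * \<phi> x)"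
    if \<phi>: "test_function \<phi>" for \<phi>
  proof -
    have i: "integrable lborel \<phi>" "integrable lborel (vderiv 1 \<phi>)"
      using integrable_test_function[OF \<phi>, of 0] integrable_test_function[OF \<phi>, of 1] by simp_all
    show "(LINT x|lborel. ?u x * vderiv 1 \<phi> x) = - (LINT x|lborel. ?u1 x * \<phi> x)"
      unfolding k.kernel_op_pairing(1)[OF f i(2)] k'.kernel_op_pairing(1)[OF f i(1)] kernel_by_parts[OF \<phi>]
      by simp
    show "(LINT x|lborel. ?u1 x * vderiv 1 \<phi> x) = - (LINT x|lborel. ?u2 x * \<phi> x)"
      unfolding k'.kernel_op_pairing(1)[OF f i(2)] k''.kernel_op_pairing(1)[OF f i(1)] kernel_by_parts[OF \<phi>]
      by simp
    have iq: "integrable lborel (\<lambda>x. q \<mu> x * \<phi> x)"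
      using locally_integrable_mult_test[OF locally_integrable_continuous[OF q_cont] \<phi> q_measurable, of \<mu> 0] by simp
    have i\<phi>: "integrable lborel (\<lambda>x. \<phi> x * f x)"
      using locally_integrable_mult_test[OF L2_locally_integrable[OF f] \<phi> L2_measurable[OF f], of 0]
      by (simp add: mult.commute)
    have iu: "integrable lborel (\<lambda>x. ?u x * (q \<mu> x * \<phi> x))"
    proof -
      have "(\<lambda>x. q \<mu> x * ?u x) \<in> L2 0"
        using q_le[OF mu_le] by (intro L2_mult_bounded[of _ 0 _ "M + 1"] L2) auto
      then have "locally_integrable (\<lambda>x. q \<mu> x * ?u x)" by (rule L2_locally_integrable)
      from locally_integrable_mult_test[OF this \<phi> locally_integrable_measurable[OF this], of 0]
      show ?thesis by (simp add: ac_simps)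
    qed
    have "(LINT x|lborel. ?u2 x * vderiv 1 \<phi> x)
      = (LINT t|lborel. - ((LINT x|lborel. K \<mu> x t * (q \<mu> x * \<phi> x)) * f t) + \<phi> t * f t)"
      unfolding k''.kernel_op_pairing(1)[OF f i(2)] kernel_by_parts[OF \<phi>]
      by (simp only: distrib_right mult_minus_left)
    also have "\<dots> = - (LINT x|lborel. ?u x * (q \<mu> x * \<phi> x)) + (LINT t|lborel. \<phi> t * f t)"
      using k.kernel_op_pairing[OF f iq] i\<phi> by simp
    also have "\<dots> = - (LINT x|lborel. ?u x * (q \<mu> x * \<phi> x) - \<phi> x * f x)"
      using iu i\<phi> by simp
    also have "(LINT x|lborel. ?u x * (q \<mu> x * \<phi> x) - \<phi> x * f x) = (LINT x|lborel. (q \<mu> x * ?u x - f x) * \<phi> x)"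
      by (intro Bochner_Integration.integral_cong) (auto simp: algebra_simps)
    finally show "(LINT x|lborel. ?u2 x * vderiv 1 \<phi> x) = - (LINT x|lborel. (q \<mu> x * ?u x - f x) * \<phi> x)" .
  qed
  have v: "vderiv 2 \<phi> = vderiv 1 (vderiv 1 \<phi>)" "vderiv 3 \<phi> = vderiv 1 (vderiv 1 (vderiv 1 \<phi>))" for \<phi>
    by (simp_all add: vderiv_add numeral_2_eq_2 numeral_3_eq_3)
  note t = test_function_vderiv
  show "is_weak_deriv 1 ?u ?u1" using l D1 by (simp add: is_weak_deriv_def)
  show "is_weak_deriv 2 ?u ?u2" using l D1[OF t] D2 unfolding is_weak_deriv_def v by simp
  show "is_weak_deriv 3 ?u (\<lambda>x. q \<mu> x * ?u x - f x)"
    using l D1[OF t[OF t]] D2[OF t] D3 unfolding is_weak_deriv_def v by simp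
qed

lemma R_Sobolev:
  assumes f: "f \<in> L2 0"
  shows "R f \<in> Sobolev_H 3" and "is_weak_deriv 3 (R f) (\<lambda>x. q \<mu> x * R f x - \<i> * f x)"
proof -
  interpret k: exponential_kernel "K \<mu>" CE \<alpha> by (rule exponential_kernels)
  interpret k': exponential_kernel "K' \<mu>" CE \<alpha> by (rule exponential_kernels)
  interpret k'': exponential_kernel "K'' \<mu>" CE \<alpha> by (rule exponential_kernels)
  let ?u = "kernel_op (K \<mu>) f" and ?u1 = "kernel_op (K' \<mu>) f" and ?u2 = "kernel_op (K'' \<mu>) f"
  have L2: "?u \<in> L2 0" "?u1 \<in> L2 0" "?u2 \<in> L2 0"
    using k.kernel_op_bound k'.kernel_op_bound k''.kernel_op_bound f by auto
  have L3: "(\<lambda>x. q \<mu> x * ?u x - f x) \<in> L2 0"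
    using q_le[OF mu_le] by (intro L2_diff L2_mult_bounded[of _ 0 _ "M + 1"] L2 f) auto
  have Rf: "R f = (\<lambda>x. \<i> * ?u x)" by (simp add: R_def fun_eq_iff)
  have "\<exists>v\<in>L2 0. is_weak_deriv k (R f) v" if "k \<le> 3" for k
  proof -
    have "k = 0 \<or> k = 1 \<or> k = 2 \<or> k = 3" using that by arith
    then have "\<exists>v\<in>L2 0. is_weak_deriv k ?u v"
      using kernel_op_weak_derivs[OF f] is_weak_deriv_0[OF L2(1)] L2 L3 by blast
    then obtain v where "v \<in> L2 0" "is_weak_deriv k ?u v" by blast
    then show ?thesis unfolding Rf using is_weak_deriv_cmult L2_cmult by blast
  qed
  moreover have "R f \<in> L2 0" unfolding Rf by (rule L2_cmult[OF L2(1)])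
  ultimately show "R f \<in> Sobolev_H 3" by (simp add: Sobolev_H_def)
  show "is_weak_deriv 3 (R f) (\<lambda>x. q \<mu> x * R f x - \<i> * f x)"
    using is_weak_deriv_cmult[OF kernel_op_weak_derivs(3)[OF f], of \<i>] unfolding Rf by (simp add: algebra_simps)
qed

text \<open>
  The component along an exponential that grows on a half-line must vanish there, as otherwise \<open>g''\<close>,
  \<open>g'\<close>, \<open>g\<close> could not all be square integrable. On the left this leaves a multiple of \<open>\<gamma>\<close>, and on
  the right it says that this multiple of \<open>W\<close> is zero.
\<close>

lemma no_square_integrable_solution:
  assumes g: "jet_sol (q \<mu>) g g1 g2" and L2: "g \<in> L2 0" "g1 \<in> L2 0" "g2 \<in> L2 0"
  shows "g x = 0"
proof -
  have mu0: "Re \<mu> > 0" using kappa alpha_pos by linarith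
  have r1: "Re l1 < 0" "Re l2 < 0" using rate1 rate2 alpha_pos by linarith+
  have l12: "l1 * l2 = \<mu>\<^sup>2" "l1 = - \<mu> - l2" "l2 = - \<mu> - l1"
    using roots(2,3) by (simp_all add: algebra_simps eq_neg_iff_add_eq_0)
  have right: "g2 a + \<mu> * g1 a + \<mu>\<^sup>2 * g a = 0"
  proof -
    let ?h = "\<lambda>x. g2 x + \<mu> * g1 x + \<mu>\<^sup>2 * g x"
    have "?h \<in> L2 0" by (intro L2_add L2_cmult L2)
    moreover have "norm (?h a) \<le> norm (?h x)" if "a \<le> x" for x
    proof -
      have "norm (?h x) = exp (Re \<mu> * (x - a)) * norm (?h a)"
        unfolding outgoing_propagates[OF g order_refl that] by (simp add: norm_mult)
      moreover have "1 \<le> exp (Re \<mu> * (x - a))" using mu0 that by simp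
      ultimately show ?thesis using mult_right_mono[of 1 "exp (Re \<mu> * (x - a))" "norm (?h a)"] by simp
    qed
    ultimately have "norm (?h a) \<le> 0" using square_integrable_not_bounded_below[of ?h a "norm (?h a)"] by blast
    then show ?thesis by simp
  qed
  have left: "g2 (- a) - (\<mu> + l) * g1 (- a) + \<mu> * l * g (- a) = 0"
    if l: "l' * l = \<mu>\<^sup>2" "l' = - \<mu> - l" "Re l' < 0" for l l'
  proof -
    let ?h = "\<lambda>x. g2 x - (\<mu> + l) * g1 x + \<mu> * l * g x"
    have "?h \<in> L2 0" by (intro L2_add L2_diff L2_cmult L2)
    moreover have "norm (?h (- a)) \<le> norm (?h x)" if "x \<le> - a" for x
    proof -
      have "?h (- a) = exp (l' * of_real (- a - x)) * ?h x"
      proof (rule first_order_homogeneous[of x "- a" ?h])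
        fix t assume "t \<in> {x..- a}"
        then have "a \<le> \<bar>t\<bar>" using a by auto
        note d = free_derivs[OF g this]
        have "(?h has_vector_derivative \<mu> ^ 3 * g t - (\<mu> + l) * g2 t + \<mu> * l * g1 t) (at t)"
          by (intro has_vector_derivative_add has_vector_derivative_diff has_vector_derivative_mult_right d)
        moreover have "\<mu> ^ 3 * g t - (\<mu> + l) * g2 t + \<mu> * l * g1 t = l' * ?h t"
          using l(1,2) by algebra
        ultimately show "(?h has_vector_derivative l' * ?h t) (at t)" by simp
      qed (use that in auto)
      then have "norm (?h (- a)) = exp (Re l' * (- a - x)) * norm (?h x)" by (simp add: norm_mult)
      moreover have "exp (Re l' * (- a - x)) \<le> 1" using l(3) that by (simp add: mult_nonpos_nonneg)
      ultimately show ?thesis using mult_right_mono[of "exp (Re l' * (- a - x))" 1 "norm (?h x)"] by simp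
    qed
    ultimately have "norm (?h (- a)) \<le> 0"
      using square_integrable_not_bounded_below[of ?h "- a" "norm (?h (- a))"] by blast
    then show ?thesis by simp
  qed
  have e1: "g2 (- a) - (\<mu> + l2) * g1 (- a) + \<mu> * l2 * g (- a) = 0"
    by (rule left[OF l12(1,2) r1(1)])
  have e2: "g2 (- a) - (\<mu> + l1) * g1 (- a) + \<mu> * l1 * g (- a) = 0"
    by (rule left[OF trans[OF mult.commute l12(1)] l12(3) r1(2)])
  have ne: "l1 \<noteq> l2"
  proof
    assume "l1 = l2"
    then have "\<mu> * (omega3 * (1 - omega3)) = 0" by (simp add: algebra_simps power2_eq_square)
    moreover have "omega3 \<noteq> 0" using omega3(2) by auto
    ultimately have "\<mu> = 0" using omega3(4) by simp
    then show False using mu0 by simp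
  qed
  \<comment> \<open>subtracting the two conditions at \<open>-a\<close>\<close>
  have "(l1 - l2) * (g1 (- a) - \<mu> * g (- a)) = 0" using e1 e2 by algebra
  then have g1: "g1 (- a) = \<mu> * g (- a)" using ne by simp
  then have g2: "g2 (- a) = \<mu>\<^sup>2 * g (- a)" using e1 by algebra
  have eq: "g x = g (- a) * \<gamma> \<mu> x" "g1 x = g (- a) * \<gamma>' \<mu> x" "g2 x = g (- a) * \<gamma>'' \<mu> x" for x
  proof -
    have zero: "g (- a) - g (- a) * \<gamma> \<mu> (- a) = 0" "g1 (- a) - g (- a) * \<gamma>' \<mu> (- a) = 0"
      "g2 (- a) - g (- a) * \<gamma>'' \<mu> (- a) = 0" unfolding gamma_initial g1 g2 by simp_all
    note d = sol_eq_comb[OF jet_sol_diff[OF g jet_sol_cmult[OF gamma_sol[of \<mu>], of "g (- a)"]], of x, unfolded zero]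
    have "g x - g (- a) * \<gamma> \<mu> x = 0" "g1 x - g (- a) * \<gamma>' \<mu> x = 0" "g2 x - g (- a) * \<gamma>'' \<mu> x = 0"
      using d unfolding comb_def by (simp_all only: if_cancel mult_zero_left add_0_right)
    then show "g x = g (- a) * \<gamma> \<mu> x" "g1 x = g (- a) * \<gamma>' \<mu> x" "g2 x = g (- a) * \<gamma>'' \<mu> x"
      by (simp_all only: right_minus_eq)
  qed
  have "g (- a) * W \<mu> = 0" using right unfolding eq[of a] W_def by (simp add: algebra_simps)
  then have "g (- a) = 0" using W_ne by simp
  then show ?thesis using eq(1)[of x] by simp
qed

lemma equation_iff:
  "\<i> * v + V x * u - z * u = h \<longleftrightarrow> v = q \<mu> x * u - \<i> * h" for u v h :: complex
proof -
  have "q \<mu> x * u - \<i> * h = \<i> * (V x - z) * u - \<i> * h" by (simp add: q_def mu_z algebra_simps)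
  moreover have "\<i> * v + V x * u - z * u = h \<longleftrightarrow> v = \<i> * (V x - z) * u - \<i> * h"
  proof
    assume "\<i> * v + V x * u - z * u = h"
    then have "\<i> * (V x - z) * u - \<i> * h = \<i> * (V x - z) * u - \<i> * (\<i> * v + V x * u - z * u)" by simp
    also have "\<dots> = v" by (simp add: algebra_simps)
    finally show "v = \<i> * (V x - z) * u - \<i> * h" by simp
  next
    assume v: "v = \<i> * (V x - z) * u - \<i> * h"
    show "\<i> * v + V x * u - z * u = h" unfolding v by (simp add: algebra_simps)
  qed
  ultimately show ?thesis by (simp only:)
qed

text \<open>
  The difference of two solutions is a square integrable weak solution of the homogeneous equation.
  This one statement gives the left inverse property of \<open>R\<close> and identifies the chosen \<open>resolvent\<close> with \<open>R\<close>
  up to null sets.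
\<close>

lemma equation_unique:
  assumes u: "u \<in> Sobolev_H 3" "u' \<in> Sobolev_H 3"
    and eq: "AE x in lborel. op_AV 3 V u x - z * u x = op_AV 3 V u' x - z * u' x"
  shows "AE x in lborel. u x = u' x"
proof -
  let ?w = "\<lambda>x. u x - 1 * u' x" and ?v = "\<lambda>x. weak_deriv 3 u x - 1 * weak_deriv 3 u' x"
  have w: "?w \<in> Sobolev_H 3" by (rule Sobolev_H_lincomb[OF u])
  have v: "is_weak_deriv 3 ?w ?v" by (rule is_weak_deriv_lincomb[OF Sobolev_weak_deriv[OF u(1)] Sobolev_weak_deriv[OF u(2)]])
  have "AE x in lborel. ?v x = q \<mu> x * ?w x"
    using eq
  proof eventually_elim
    case (elim x)
    then have "\<i> * ?v x + V x * ?w x - z * ?w x = 0" unfolding op_AV_eq by (simp add: algebra_simps)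
    then show ?case unfolding equation_iff by simp
  qed
  then obtain g g1 g2 where g: "jet_sol (q \<mu>) g g1 g2" "AE x in lborel. ?w x = g x" "g \<in> L2 0" "g1 \<in> L2 0" "g2 \<in> L2 0"
    by (rule continuous_representative[OF w v _ q_cont])
  from g(2) show ?thesis
  proof eventually_elim
    case (elim x)
    then show ?case using no_square_integrable_solution[OF g(1,3,4,5), of x] by simp
  qed
qed

lemma R_solves:
  assumes f: "f \<in> L2 0"
  shows "AE x in lborel. op_AV 3 V (R f) x - z * R f x = f x"
proof -
  have "AE x in lborel. weak_deriv 3 (R f) x = q \<mu> x * R f x - \<i> * f x"
    by (rule weak_deriv_unique[OF weak_deriv_is_weak_deriv R_Sobolev(2)[OF f]]) (rule R_Sobolev(2)[OF f])
  then show ?thesis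
  proof eventually_elim
    case (elim x)
    then show ?case unfolding op_AV_eq using equation_iff[of "weak_deriv 3 (R f) x" x "R f x" "f x"] by simp
  qed
qed

lemma R_bounded: "bounded_op 0 0 R"
  unfolding bounded_op_def
proof (intro conjI ballI allI)
  interpret k: exponential_kernel "K \<mu>" CE \<alpha> by (rule exponential_kernels)
  show "R f \<in> L2 0" if "f \<in> L2 0" for f
    using R_Sobolev(1)[OF that] by (simp add: Sobolev_H_def)
  show "AE x in lborel. R (\<lambda>y. c * f y + g y) x = c * R f x + R g x" if "f \<in> L2 0" "g \<in> L2 0" for f g c
  proof (rule AE_I2)
    fix x
    show "R (\<lambda>y. c * f y + g y) x = c * R f x + R g x"
      using k.kernel_op_pointwise(2)[OF that(1), of x] k.kernel_op_pointwise(2)[OF that(2), of x]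
      by (simp add: R_def kernel_op_def distrib_left mult.left_commute[of _ c])
  qed
  have "norm_L2 0 (R f) = norm_L2 0 (kernel_op (K \<mu>) f)" for f
    by (simp add: norm_L2_def R_def norm_mult)
  then show "\<exists>C. \<forall>f\<in>L2 0. norm_L2 0 (R f) \<le> C * norm_L2 0 f"
    using k.kernel_op_bound(2) by auto
qed

lemma op_AV_L2:
  assumes u: "u \<in> Sobolev_H 3" shows "(\<lambda>x. op_AV 3 V u x - z * u x) \<in> L2 0"
proof -
  from u obtain v where v: "v \<in> L2 0" "is_weak_deriv 3 u v" unfolding Sobolev_H_def by blast
  have "locally_integrable (weak_deriv 3 u)" using Sobolev_weak_deriv[OF u] by (simp add: is_weak_deriv_def)
  then have "weak_deriv 3 u \<in> L2 0"
    using L2_cong_AE[OF v(1) weak_deriv_unique[OF v(2) Sobolev_weak_deriv[OF u]]] locally_integrable_measurable by blast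
  moreover have "u \<in> L2 0" using u by (simp add: Sobolev_H_def)
  ultimately show ?thesis unfolding op_AV_eq using V_le
    by (intro L2_diff L2_add L2_cmult L2_mult_bounded[of u 0 V M]) auto
qed

lemma R_is_resolvent: "is_resolvent 3 V z R"
  unfolding is_resolvent_def
proof (intro conjI ballI R_bounded)
  show "R f \<in> Sobolev_H 3" "AE x in lborel. op_AV 3 V (R f) x - z * R f x = f x" if "f \<in> L2 0" for f
    using R_Sobolev(1)[OF that] R_solves[OF that] by auto
  show "AE x in lborel. R (\<lambda>y. op_AV 3 V u y - z * u y) x = u x" if u: "u \<in> Sobolev_H 3" for u
    by (rule equation_unique[OF R_Sobolev(1)[OF op_AV_L2[OF u]] u R_solves[OF op_AV_L2[OF u]]])
qed

lemma in_resolvent_set: "z \<in> resolvent_set 3 V"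
  using R_is_resolvent by (auto simp: resolvent_set_def)

lemma resolvent_ae_eq:
  assumes f: "f \<in> L2 0"
  shows "AE x in lborel. resolvent 3 V z f x = R f x" and "resolvent 3 V z f \<in> borel_measurable borel"
proof -
  have "is_resolvent 3 V z (resolvent 3 V z)"
    unfolding resolvent_def by (rule someI[of "is_resolvent 3 V z", OF R_is_resolvent])
  then have r: "resolvent 3 V z f \<in> Sobolev_H 3"
    "AE x in lborel. op_AV 3 V (resolvent 3 V z f) x - z * resolvent 3 V z f x = f x"
    using f by (auto simp: is_resolvent_def)
  have "AE x in lborel. op_AV 3 V (resolvent 3 V z f) x - z * resolvent 3 V z f x = op_AV 3 V (R f) x - z * R f x"
    using r(2) R_solves[OF f] by eventually_elim simp
  then show "AE x in lborel. resolvent 3 V z f x = R f x"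
    by (rule equation_unique[OF r(1) R_Sobolev(1)[OF f]])
  show "resolvent 3 V z f \<in> borel_measurable borel"
    using r(1) L2_measurable by (auto simp: Sobolev_H_def)
qed

end

section \<open>The limit at the threshold\<close>

text \<open>
  For \<open>z\<close> in the upper half plane, \<open>- \<i> z\<close> lies in the right half plane, and its principal cube root has
  argument between \<open>-\<pi>/6\<close> and \<open>\<pi>/6\<close>. This places the other two cube roots in the left half plane.
\<close>

definition cube_root_of :: "complex \<Rightarrow> complex" where
  "cube_root_of z = exp (Ln (- \<i> * z) / 3)"

lemma cube_root_of:
  assumes "Im z > 0"
  shows "cube_root_of z ^ 3 = - \<i> * z" "Re (cube_root_of z * omega3) < 0" "Re (cube_root_of z * omega3\<^sup>2) < 0"
    "cube_root_of z \<noteq> 0" "norm (cube_root_of z) = root 3 (norm z)"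
proof -
  have nz: "- \<i> * z \<noteq> 0" using assms by auto
  have "cube_root_of z ^ 3 = exp (of_nat 3 * (Ln (- \<i> * z) / 3))"
    unfolding cube_root_of_def by (rule exp_of_nat_mult[symmetric])
  then show cube: "cube_root_of z ^ 3 = - \<i> * z" using nz by simp
  then have "norm (cube_root_of z) ^ 3 = norm z" by (simp add: norm_mult flip: norm_power)
  then show "norm (cube_root_of z) = root 3 (norm z)" by (metis norm_ge_zero real_root_power_cancel zero_less_numeral)
  show "cube_root_of z \<noteq> 0" by (simp add: cube_root_of_def)
  define L where "L = Ln (- \<i> * z)"
  have "0 < Re (- \<i> * z)" using assms by simp
  then have im: "\<bar>Im L\<bar> < pi / 2" using Re_Ln_pos_lt[OF nz] by (simp add: L_def)
  have rot: "Re (cube_root_of z * cis t) = exp (Re L / 3) * cos (Im L / 3 + t)" for t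
  proof -
    have "cube_root_of z * cis t = exp (Complex (Re L / 3) (Im L / 3 + t))"
      unfolding cube_root_of_def L_def[symmetric] cis_conv_exp exp_add[symmetric]
      by (rule arg_cong[of _ _ exp]) (simp add: complex_eq_iff)
    then show ?thesis by (simp add: Re_exp)
  qed
  have neg: "cos x < 0" if "pi / 2 < x" "x < 3 * pi / 2" for x
  proof -
    have "0 < cos (x - pi)" using that by (intro cos_gt_zero_pi) auto
    then show ?thesis by simp
  qed
  have "cos (Im L / 3 + 2 * pi / 3) < 0" "cos (Im L / 3 + 2 * (2 * pi / 3)) < 0"
    using im by (intro neg; linarith)+
  moreover have "omega3\<^sup>2 = cis (2 * (2 * pi / 3))" by (simp add: omega3_def Complex.DeMoivre)
  ultimately show "Re (cube_root_of z * omega3) < 0" "Re (cube_root_of z * omega3\<^sup>2) < 0"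
    using rot[of "2 * pi / 3"] rot[of "2 * (2 * pi / 3)"] by (simp_all add: omega3_def mult_pos_neg)
qed

lemma filterlim_cube_root_of: "filterlim cube_root_of (at 0) (at 0 within upper_half_plane)"
  unfolding filterlim_at
proof
  have ev: "\<forall>\<^sub>F z in at 0 within upper_half_plane. Im z > 0"
    unfolding eventually_at_filter by (auto simp: upper_half_plane_def)
  then show "\<forall>\<^sub>F z in at 0 within upper_half_plane. cube_root_of z \<in> UNIV \<and> cube_root_of z \<noteq> 0"
    by eventually_elim (simp add: cube_root_of)
  show "(cube_root_of \<longlongrightarrow> 0) (at 0 within upper_half_plane)"
  proof (rule Lim_null_comparison)
    show "\<forall>\<^sub>F z in at 0 within upper_half_plane. norm (cube_root_of z) \<le> root 3 (norm z)"
      using ev by eventually_elim (simp add: cube_root_of)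
    have "((\<lambda>z::complex. root 3 (norm z)) \<longlongrightarrow> root 3 (norm (0::complex))) (at 0 within upper_half_plane)"
      by (intro tendsto_intros)
    then show "((\<lambda>z::complex. root 3 (norm z)) \<longlongrightarrow> 0) (at 0 within upper_half_plane)" by simp
  qed
qed

context cubic_problem
begin

lemma free_rates_0: "free_rates 0 0"
  by unfold_locales auto

text \<open>
  For \<open>\<mu> = 0\<close> the function \<open>\<gamma>\<close> equals \<open>1\<close> on the left, and \<open>W 0 = \<gamma>''(a) = 0\<close> makes it affine on the right.
\<close>

lemma resonance:
  assumes W: "W 0 = 0"
  shows "is_solution 3 V (\<gamma> 0)" "\<gamma> 0 (- a) = 1" "\<exists>C. \<forall>x. norm (\<gamma> 0 x) \<le> C * japanese x"
    "\<exists>C. \<forall>x\<le>0. norm (\<gamma> 0 x) \<le> C"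
proof -
  interpret free_rates 0 0 by (rule free_rates_0)
  note d = jet_solD[OF gamma_sol[of 0]]
  have v: "vderiv 1 (\<gamma> 0) = \<gamma>' 0" "vderiv 2 (\<gamma> 0) = \<gamma>'' 0" "vderiv 3 (\<gamma> 0) = (\<lambda>x. q 0 x * \<gamma> 0 x)"
    using vector_derivative_at[OF d(1)] vector_derivative_at[OF d(2)] vector_derivative_at[OF d(3)]
    by (simp_all add: vderiv_Suc numeral_2_eq_2 numeral_3_eq_3)
  have "vderiv j (\<gamma> 0) differentiable at x" if "j < 3" for j x
  proof -
    have "j = 0 \<or> j = 1 \<or> j = 2" using that by arith
    then show ?thesis using d[THEN differentiableI_vector] v(1,2) by (elim disjE) simp_all
  qed
  then show "is_solution 3 V (\<gamma> 0)"
    unfolding is_solution_def times_differentiable_def v(3) by (simp add: q_def power3_eq_cube flip: mult.assoc)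
  show "\<gamma> 0 (- a) = 1" by simp
  have unit: "jet_le (\<gamma> 0) (\<gamma>' 0) (\<gamma>'' 0) (- a) 1" by (simp add: jet_le_def)
  have middle: "jet_le (\<gamma> 0) (\<gamma>' 0) (\<gamma>'' 0) x CM" if "\<bar>x\<bar> \<le> a" for x
    using middle_bound[OF gamma_sol _ _ that unit] a by simp
  have left: "norm (\<gamma> 0 x) \<le> CM" if "x \<le> - a" for x using gamma_left(1)[OF that, of 0] CM_ge by simp
  have left': "norm (\<gamma> 0 x) \<le> CM" if "x \<le> a" for x
    using left[of x] middle[of x] that by (cases "x \<le> - a") (auto simp: jet_le_def)
  then show "\<exists>C. \<forall>x\<le>0. norm (\<gamma> 0 x) \<le> C" using a by (intro exI[of _ CM]) auto
  have right: "norm (\<gamma> 0 x) \<le> 3 * (CM + CM * (1 + (x - a)))" if x: "a \<le> x" for x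
  proof -
    have free: "a \<le> \<bar>t\<bar>" if "t \<in> {a..x}" for t using that a by auto
    have m: "norm (\<gamma> 0 a) \<le> CM" "norm (\<gamma>' 0 a) \<le> CM" using middle[of a] a by (auto simp: jet_le_def)
    have "jet_le (\<gamma> 0) (\<gamma>' 0) (\<gamma>'' 0) x (3 * (CM + CM * moderate 0 (x - a)) * exp (- 0 * (x - a)))"
      by (rule free_outgoing_bound[OF x free_derivs[OF gamma_sol free]]) (use W m in \<open>auto simp: W_def\<close>)
    then show ?thesis by (simp add: jet_le_def)
  qed
  show "\<exists>C. \<forall>x. norm (\<gamma> 0 x) \<le> C * japanese x"
  proof (intro exI allI)
    fix x
    have j: "1 \<le> japanese x" "\<bar>x\<bar> \<le> japanese x" by (rule japanese_ge)+
    show "norm (\<gamma> 0 x) \<le> (9 * CM) * japanese x"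
    proof (cases "x \<le> a")
      case True
      have "CM * 1 \<le> (9 * CM) * japanese x" using CM_ge j by (intro mult_mono) auto
      then show ?thesis using left'[OF True] by simp
    next
      case False
      then have "norm (\<gamma> 0 x) \<le> 3 * (CM + CM * (1 + (x - a)))" by (intro right) auto
      also have "\<dots> = 3 * CM * (2 + (x - a))" by (simp add: algebra_simps)
      also have "\<dots> \<le> 3 * CM * (3 * japanese x)" using j a CM_ge by (intro mult_left_mono) auto
      finally show ?thesis by simp
    qed
  qed
qed

lemma kernel_moderate_le:
  assumes "kernel_bounds V a M y y' y'' \<mu> 0 w"
  shows "norm (K \<mu> x t) \<le> 4 * CK w * japanese x * japanese t"
proof -
  interpret kernel_bounds V a M y y' y'' \<mu> 0 w by fact
  note CK_nonneg
  moreover have "(1 + \<bar>x\<bar>) * (1 + \<bar>t\<bar>) \<le> (2 * japanese x) * (2 * japanese t)"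
    using japanese_ge(1,3)[of x] japanese_ge(1,3)[of t] by (intro mult_mono) auto
  ultimately have "CK w * ((1 + \<bar>x\<bar>) * (1 + \<bar>t\<bar>)) \<le> CK w * ((2 * japanese x) * (2 * japanese t))"
    by (intro mult_left_mono)
  then show ?thesis using kernel_le[of t x] by (simp add: jet_le_def ac_simps)
qed

lemma resolvent_point_near_0:
  assumes z: "Im z > 0" and small: "norm (cube_root_of z) \<le> 1" and w: "w > 0" "w \<le> norm (W (cube_root_of z))"
  obtains \<alpha> where "resolvent_point V a M y y' y'' (cube_root_of z) \<alpha> w z"
    "kernel_bounds V a M y y' y'' (cube_root_of z) 0 w"
proof -
  let ?\<mu> = "cube_root_of z"
  \<comment> \<open>half of the smaller decay rate, as the estimates give away the other half\<close>
  define \<alpha> where "\<alpha> = min (- Re (?\<mu> * omega3)) (- Re (?\<mu> * omega3\<^sup>2)) / 2"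
  have \<alpha>: "\<alpha> > 0" using cube_root_of[OF z] by (simp add: \<alpha>_def)
  have "free_rates ?\<mu> \<alpha>" "free_rates ?\<mu> 0"
    using \<alpha> cube_root_of(2,3)[OF z] small by (unfold_locales; simp add: \<alpha>_def min_def; linarith)+
  then have kb: "kernel_bounds V a M y y' y'' ?\<mu> \<alpha> w" "kernel_bounds V a M y y' y'' ?\<mu> 0 w"
    using w cubic_problem_axioms by (simp_all add: kernel_bounds_def kernel_bounds_axioms_def)
  moreover have "resolvent_point V a M y y' y'' ?\<mu> \<alpha> w z"
    using kb(1) \<alpha> cube_root_of(1)[OF z] by (simp add: resolvent_point_def resolvent_point_axioms_def)
  ultimately show ?thesis using that by blast
qed

text \<open>
  The kernels are dominated, uniformly in \<open>z\<close>, by \<open>C \<langle>x\<rangle> \<langle>t\<rangle>\<close>, and converge pointwise. Dominated convergence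
  gives convergence of the weighted kernels in the Hilbert-Schmidt norm, which bounds the operator norm.
\<close>

lemma regular_case:
  assumes W: "W 0 \<noteq> 0" and s: "s > 3 / 2" and s': "s' > 3 / 2"
  shows "resolvent_converges 3 V upper_half_plane 0 s (- s')"
proof -
  define w where "w = norm (W 0) / 2"
  have w: "w > 0" using W by (simp add: w_def)
  define good where "good z \<longleftrightarrow> Im z > 0 \<and> norm (cube_root_of z) \<le> 1 \<and> w \<le> norm (W (cube_root_of z))" for z
  let ?F = "at 0 within upper_half_plane"
  note lim = filterlim_compose[OF _ filterlim_cube_root_of]
  have ev_good: "\<forall>\<^sub>F z in ?F. good z"
  proof -
    have "((\<lambda>z. norm (W (cube_root_of z))) \<longlongrightarrow> norm (W 0)) ?F"
      by (intro tendsto_norm lim[OF kernel_tendsto(1)[OF W]])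
    moreover have "w < norm (W 0)" using zero_less_norm_iff[of "W 0"] W by (simp add: w_def)
    ultimately have "\<forall>\<^sub>F z in ?F. w < norm (W (cube_root_of z))"
      by (rule order_tendstoD(1))
    moreover have "\<forall>\<^sub>F z in ?F. norm (cube_root_of z) < 1"
    proof -
      have "((\<lambda>z. norm (cube_root_of z)) \<longlongrightarrow> norm (0::complex)) ?F"
        using filterlim_cube_root_of by (intro tendsto_norm) (simp add: filterlim_at)
      then show ?thesis by (simp add: order_tendsto_iff)
    qed
    moreover have "\<forall>\<^sub>F z in ?F. Im z > 0"
      unfolding eventually_at_filter by (auto simp: upper_half_plane_def)
    ultimately show ?thesis by eventually_elim (simp add: good_def)
  qed
  have kb0: "kernel_bounds V a M y y' y'' 0 0 w"
    using free_rates_0 cubic_problem_axioms w by (simp add: kernel_bounds_def kernel_bounds_axioms_def w_def)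
  have goodD: "\<exists>\<alpha>. resolvent_point V a M y y' y'' (cube_root_of z) \<alpha> w z"
    "kernel_bounds V a M y y' y'' (cube_root_of z) 0 w" if "good z" for z
    using that resolvent_point_near_0[of z w] w unfolding good_def by blast+
  \<comment> \<open>The kernel of the difference, set to zero away from the threshold so that one dominating function serves all \<open>z\<close>.\<close>
  define k where "k z x t = (if good z then \<i> * (K (cube_root_of z) x t - K 0 x t) else 0)" for z x t
  define C where "C = 8 * CK w"
  have K0_le: "norm (K 0 x t) \<le> 4 * CK w * japanese x * japanese t" for x t
    by (rule kernel_moderate_le[OF kb0])
  have C_nonneg: "0 \<le> C"
    using order_trans[OF norm_ge_zero K0_le[of 0 0]] by (simp add: C_def japanese_def)
  have k_le: "norm (k z x t) \<le> C * japanese x * japanese t" for z x t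
  proof (cases "good z")
    case True
    have "norm (k z x t) \<le> norm (K (cube_root_of z) x t) + norm (K 0 x t)"
      using True by (simp add: k_def norm_mult norm_triangle_ineq4)
    also have "\<dots> \<le> 4 * CK w * japanese x * japanese t + 4 * CK w * japanese x * japanese t"
      by (intro add_mono K0_le kernel_moderate_le[OF goodD(2)[OF True]])
    finally show ?thesis by (simp add: C_def ac_simps)
  next
    case False
    then show ?thesis using C_nonneg japanese_ge(2)[of x] japanese_ge(2)[of t] by (simp add: k_def)
  qed
  have [measurable]: "(\<lambda>(x, t). K \<mu> x t) \<in> borel_measurable (borel \<Otimes>\<^sub>M borel)" for \<mu>
    using kernel_measurable(1)[of \<mu>] by (simp cong: measurable_cong_sets sets_pair_measure_cong)
  have k_meas: "(\<lambda>(x, t). k z x t) \<in> borel_measurable (lborel \<Otimes>\<^sub>M lborel)" for z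
    unfolding k_def by (cases "good z") (simp_all, measurable)
  have mk: "moderate_kernel (k z) C s s'" for z
    using k_meas k_le s s' by unfold_locales auto
  have mK: "moderate_kernel (\<lambda>x t. \<i> * K \<mu> x t) (4 * CK w) s s'" if "kernel_bounds V a M y y' y'' \<mu> 0 w" for \<mu>
  proof unfold_locales
    show "(\<lambda>(x, t). \<i> * K \<mu> x t) \<in> borel_measurable (lborel \<Otimes>\<^sub>M lborel)" by measurable
  qed (use kernel_moderate_le[OF that] s s' in \<open>auto simp: norm_mult\<close>)
  interpret K0: moderate_kernel "\<lambda>x t. \<i> * K 0 x t" "4 * CK w" s s' by (rule mK[OF kb0])
  define R0 where "R0 = kernel_op (\<lambda>x t. \<i> * K 0 x t)"
  have R0: "bounded_op s (- s') R0"
    unfolding bounded_op_def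
  proof (intro conjI ballI allI)
    show "R0 f \<in> L2 (- s')" if "f \<in> L2 s" for f
      unfolding R0_def by (rule K0.kernel_op_bound(1)[OF that])
    show "AE x in lborel. R0 (\<lambda>y. c * f y + g y) x = c * R0 f x + R0 g x" if "f \<in> L2 s" "g \<in> L2 s" for f g c
    proof (rule AE_I2)
      fix x
      have eq: "\<i> * K 0 x t * (c * f t + g t) = c * (\<i> * K 0 x t * f t) + \<i> * K 0 x t * g t" for t
        by (simp add: algebra_simps)
      show "R0 (\<lambda>y. c * f y + g y) x = c * R0 f x + R0 g x"
        unfolding R0_def kernel_op_def eq
        using K0.kernel_op_pointwise(1)[OF that(1), of x] K0.kernel_op_pointwise(1)[OF that(2), of x] by simp
    qed
    show "\<exists>C. \<forall>f\<in>L2 s. norm_L2 (- s') (R0 f) \<le> C * norm_L2 s f"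
      using K0.kernel_op_bound(2) unfolding R0_def by blast
  qed
  define \<Phi> where "\<Phi> z = (LINT p|(lborel \<Otimes>\<^sub>M lborel). (case p of (x, t) \<Rightarrow>
      (japanese x powr (- s') * norm (k z x t) * japanese t powr (- s))\<^sup>2))" for z
  have HS: "moderate_kernel.HS (k z) s s' = \<Phi> z" for z
    unfolding moderate_kernel.HS_def[OF mk] moderate_kernel.w2_def[OF mk] \<Phi>_def ..
  have \<Phi>_lim: "(\<Phi> \<longlongrightarrow> 0) ?F"
  proof -
    have k_lim: "((\<lambda>z. k z x t) \<longlongrightarrow> 0) ?F" for x t
    proof (rule Lim_null_comparison)
      show "\<forall>\<^sub>F z in ?F. norm (k z x t) \<le> norm (K (cube_root_of z) x t - K 0 x t)"
        by (auto simp: k_def norm_mult intro!: always_eventually)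
      have "((\<lambda>z. norm (K (cube_root_of z) x t - K 0 x t)) \<longlongrightarrow> norm (K 0 x t - K 0 x t)) ?F"
        by (intro tendsto_intros lim[OF kernel_tendsto(2)[OF W]])
      then show "((\<lambda>z. norm (K (cube_root_of z) x t - K 0 x t)) \<longlongrightarrow> 0) ?F" by simp
    qed
    show ?thesis unfolding tendsto_at_iff_sequentially
    proof (intro allI impI)
      fix X :: "nat \<Rightarrow> complex" assume X: "\<forall>i. X i \<in> upper_half_plane - {0}" "X \<longlonglongrightarrow> 0"
      have "(\<lambda>n. \<Phi> (X n)) \<longlonglongrightarrow> (LINT p|((lborel::real measure) \<Otimes>\<^sub>M (lborel::real measure)). 0)"
        unfolding \<Phi>_def
      proof (rule integral_dominated_convergence)
        show "integrable (lborel \<Otimes>\<^sub>M lborel) (\<lambda>(x, t). C\<^sup>2 * (japanese x powr (2 - 2 * s') * japanese t powr (2 - 2 * s)))"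
          by (rule moderate_kernel.dominating_integrable[OF mk])
        show "(\<lambda>(x, t). (japanese x powr (- s') * norm (k (X n) x t) * japanese t powr (- s))\<^sup>2)
            \<in> borel_measurable (lborel \<Otimes>\<^sub>M lborel)" for n
        proof -
          have [measurable]: "(\<lambda>(x, t). k (X n) x t) \<in> borel_measurable (borel \<Otimes>\<^sub>M borel)"
            using k_meas[of "X n"] by (simp cong: measurable_cong_sets sets_pair_measure_cong)
          show ?thesis by measurable
        qed
        show "AE p in lborel \<Otimes>\<^sub>M lborel. (\<lambda>n. case p of (x, t) \<Rightarrow>
            (japanese x powr (- s') * norm (k (X n) x t) * japanese t powr (- s))\<^sup>2) \<longlonglongrightarrow> 0"
        proof (rule AE_I2, clarify)
          fix x t
          have "(\<lambda>n. k (X n) x t) \<longlonglongrightarrow> 0"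
            using k_lim[of x t] X unfolding tendsto_at_iff_sequentially by (auto simp: o_def)
          then have "(\<lambda>n. (japanese x powr (- s') * norm (k (X n) x t) * japanese t powr (- s))\<^sup>2)
             \<longlonglongrightarrow> (japanese x powr (- s') * norm (0::complex) * japanese t powr (- s))\<^sup>2"
            by (intro tendsto_intros)
          then show "(\<lambda>n. (japanese x powr (- s') * norm (k (X n) x t) * japanese t powr (- s))\<^sup>2) \<longlonglongrightarrow> 0" by simp
        qed
        show "AE p in lborel \<Otimes>\<^sub>M lborel. norm (case p of (x, t) \<Rightarrow>
            (japanese x powr (- s') * norm (k (X n) x t) * japanese t powr (- s))\<^sup>2)
          \<le> (case p of (x, t) \<Rightarrow> C\<^sup>2 * (japanese x powr (2 - 2 * s') * japanese t powr (2 - 2 * s)))" for n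
          using moderate_kernel.w2_le[OF mk, of "X n"] unfolding moderate_kernel.w2_def[OF mk]
          by (intro AE_I2) auto
      qed auto
      then show "(\<Phi> \<circ> X) \<longlonglongrightarrow> 0" by (simp add: o_def)
    qed
  qed
  have op_le: "op_norm s (- s') (\<lambda>f x. resolvent 3 V z f x - R0 f x) \<le> ennreal (sqrt (\<Phi> z))" if z: "good z" for z
  proof -
    obtain \<alpha> where rp: "resolvent_point V a M y y' y'' (cube_root_of z) \<alpha> w z" using goodD(1)[OF z] by blast
    interpret resolvent_point V a M y y' y'' "cube_root_of z" \<alpha> w z by (rule rp)
    interpret kz: moderate_kernel "k z" C s s' by (rule mk)
    interpret Kz: moderate_kernel "\<lambda>x t. \<i> * K (cube_root_of z) x t" "4 * CK w" s s' by (rule mK[OF goodD(2)[OF z]])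
    have "norm_L2 (- s') (\<lambda>x. resolvent 3 V z f x - R0 f x) \<le> sqrt (\<Phi> z)" if f: "f \<in> L2 s" "norm_L2 s f \<le> 1" for f
    proof -
      have f0: "f \<in> L2 0" using L2_subset_L2_0[OF f(1)] s by simp
      have "AE x in lborel. resolvent 3 V z f x - R0 f x = kernel_op (k z) f x"
        using resolvent_ae_eq(1)[OF f0]
      proof eventually_elim
        case (elim x)
        have "R f x = kernel_op (\<lambda>x t. \<i> * K (cube_root_of z) x t) f x"
          by (simp add: R_def kernel_op_def mult.assoc)
        then have "R f x - R0 f x = (LINT t|lborel. \<i> * K (cube_root_of z) x t * f t - \<i> * K 0 x t * f t)"
          unfolding R0_def kernel_op_def
          using Kz.kernel_op_pointwise(1)[OF f(1), of x] K0.kernel_op_pointwise(1)[OF f(1), of x] by simp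
        also have "\<dots> = kernel_op (k z) f x"
          unfolding kernel_op_def k_def using z by (simp add: algebra_simps)
        finally show ?case using elim by simp
      qed
      then have "norm_L2 (- s') (\<lambda>x. resolvent 3 V z f x - R0 f x) = norm_L2 (- s') (kernel_op (k z) f)"
      proof (rule norm_L2_cong_AE)
        have [measurable]: "resolvent 3 V z f \<in> borel_measurable borel" "R0 f \<in> borel_measurable borel"
          using resolvent_ae_eq(2)[OF f0] R0 f(1) L2_measurable unfolding bounded_op_def by blast+
        show "(\<lambda>x. resolvent 3 V z f x - R0 f x) \<in> borel_measurable borel" by measurable
        show "kernel_op (k z) f \<in> borel_measurable borel" using kz.kernel_op_bound(1)[OF f(1)] by (rule L2_measurable)
      qed
      also have "\<dots> \<le> sqrt (\<Phi> z) * norm_L2 s f" using kz.kernel_op_bound(2)[OF f(1)] unfolding HS .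
      also have "\<dots> \<le> sqrt (\<Phi> z) * 1"
        using f(2) kz.HS_nonneg unfolding HS by (intro mult_left_mono) auto
      finally show ?thesis by simp
    qed
    then show ?thesis unfolding op_norm_def by (intro SUP_least ennreal_leI) auto
  qed
  have "((\<lambda>z. op_norm s (- s') (\<lambda>f x. resolvent 3 V z f x - R0 f x)) \<longlongrightarrow> 0) ?F"
  proof (rule tendsto_sandwich)
    show "\<forall>\<^sub>F z in ?F. 0 \<le> op_norm s (- s') (\<lambda>f x. resolvent 3 V z f x - R0 f x)" by simp
    show "\<forall>\<^sub>F z in ?F. op_norm s (- s') (\<lambda>f x. resolvent 3 V z f x - R0 f x) \<le> ennreal (sqrt (\<Phi> z))"
      using ev_good by eventually_elim (rule op_le)
    have "((\<lambda>z. ennreal (sqrt (\<Phi> z))) \<longlongrightarrow> ennreal (sqrt 0)) ?F"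
      by (intro tendsto_ennrealI tendsto_real_sqrt \<Phi>_lim)
    then show "((\<lambda>z. ennreal (sqrt (\<Phi> z))) \<longlongrightarrow> 0) ?F" by simp
  qed auto
  moreover have "\<forall>\<^sub>F z in ?F. z \<in> resolvent_set 3 V"
    using ev_good by eventually_elim (use goodD(1) resolvent_point.in_resolvent_set in blast)
  ultimately show ?thesis using R0 unfolding resolvent_converges_def by blast
qed

end

lemma C_comp_cubic_problem:
  assumes V: "V \<in> C_comp"
  shows "\<exists>a M y y' y''. cubic_problem V a M y y' y''"
proof -
  have Vc: "continuous_on UNIV V" and "compact (closure {x. V x \<noteq> 0})"
    using V by (simp_all add: C_comp_def compactly_supported_def)
  then have "bounded (closure {x. V x \<noteq> 0})" by (simp add: compact_imp_bounded)
  then obtain L where "\<forall>x\<in>closure {x. V x \<noteq> 0}. norm x \<le> L" unfolding bounded_iff by blast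
  then have L: "V x = 0" if "L < \<bar>x\<bar>" for x using that closure_subset[of "{x. V x \<noteq> 0}"] by force
  define a where "a = \<bar>L\<bar> + 1"
  have a: "a > 0" "\<And>x. a \<le> \<bar>x\<bar> \<Longrightarrow> V x = 0" using L by (auto simp: a_def)
  have "bounded (V ` {- a..a})"
    by (intro compact_imp_bounded compact_continuous_image continuous_on_subset[OF Vc]) auto
  then obtain B where "\<forall>v\<in>V ` {- a..a}. norm v \<le> B" unfolding bounded_iff by blast
  then have B: "norm (V x) \<le> B" if "\<bar>x\<bar> \<le> a" for x using that by (auto simp: abs_le_iff)
  have VB: "norm (V x) \<le> \<bar>B\<bar>" for x using B[of x] a(2)[of x] by (cases "\<bar>x\<bar> \<le> a") auto
  have ex: "\<exists>u. jet_sol (\<lambda>x. \<i> * V x + \<mu> ^ 3) (fst u) (fst (snd u)) (snd (snd u)) \<and>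
      fst u (- a) = of_bool (j = 0) \<and> fst (snd u) (- a) = of_bool (j = 1) \<and> snd (snd u) (- a) = of_bool (j = 2)"
    for \<mu> :: complex and j :: nat
  proof -
    have c: "continuous_on UNIV (\<lambda>x. \<i> * V x + \<mu> ^ 3)" by (intro continuous_intros Vc)
    have b: "norm (\<i> * V x + \<mu> ^ 3) \<le> \<bar>B\<bar> + norm (\<mu> ^ 3)" for x
      by (rule order_trans[OF norm_triangle_ineq]) (use VB in \<open>simp add: norm_mult\<close>)
    from jet_sol_exists[OF c b, of "- a" "of_bool (j = 0)" "of_bool (j = 1)" "of_bool (j = 2)"]
    obtain u u1 u2 where "jet_sol (\<lambda>x. \<i> * V x + \<mu> ^ 3) u u1 u2"
      "u (- a) = of_bool (j = 0)" "u1 (- a) = of_bool (j = 1)" "u2 (- a) = of_bool (j = 2)"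
      by blast
    then show ?thesis by (intro exI[of _ "(u, u1, u2)"]) simp
  qed
  define Y where "Y \<mu> j = (SOME u. jet_sol (\<lambda>x. \<i> * V x + \<mu> ^ 3) (fst u) (fst (snd u)) (snd (snd u)) \<and>
      fst u (- a) = of_bool (j = 0) \<and> fst (snd u) (- a) = of_bool (j = 1) \<and> snd (snd u) (- a) = of_bool (j = 2))"
    for \<mu> :: complex and j :: nat
  note Y = someI_ex[OF ex, folded Y_def]
  have "cubic_problem V a \<bar>B\<bar> (\<lambda>\<mu> j. fst (Y \<mu> j)) (\<lambda>\<mu> j. fst (snd (Y \<mu> j))) (\<lambda>\<mu> j. snd (snd (Y \<mu> j)))"
    using a Vc VB Y by unfold_locales blast+
  then show ?thesis by blast
qed

theorem theorem1p2:
  fixes N :: nat and s s' :: real and V :: "real \<Rightarrow> complex"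
  assumes "N = 3"
    and "s > real N - 3/2" and "s' > real N - 3/2"
    and "V \<in> C_comp"
  shows "resolvent_converges N V upper_half_plane 0 s (- s') \<or>
    (\<exists>\<Psi>. is_solution N V \<Psi> \<and> (\<exists>x. \<Psi> x \<noteq> 0) \<and>
         (\<lambda>x. complex_of_real (japanese x powr (- (real N - 2))) * \<Psi> x) \<in> L_infinity \<and>
         (\<exists>C. \<forall>x\<le>0. norm (\<Psi> x) \<le> C * japanese x powr (real N - 3)))"
proof -
  obtain a M y y' y'' where "cubic_problem V a M y y' y''" using C_comp_cubic_problem[OF assms(4)] by blast
  then interpret cubic_problem V a M y y' y'' .
  show ?thesis
  proof (cases "W 0 = 0")
    case False
    then show ?thesis using regular_case[OF False, of s s'] assms by simp
  next
    case True
    note r = resonance[OF True]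
    obtain C where C: "\<And>x. norm (\<gamma> 0 x) \<le> C * japanese x" using r(3) by blast
    have "(\<lambda>x. complex_of_real (japanese x powr (- 1)) * \<gamma> 0 x) \<in> L_infinity"
      unfolding L_infinity_def
    proof (intro CollectI conjI exI AE_I2)
      have [measurable]: "\<gamma> 0 \<in> borel_measurable borel"
        by (rule borel_measurable_continuous_onI[OF jet_sol_continuous(1)[OF gamma_sol]])
      show "(\<lambda>x. complex_of_real (japanese x powr (- 1)) * \<gamma> 0 x) \<in> borel_measurable lborel" by measurable
      show "norm (complex_of_real (japanese x powr (- 1)) * \<gamma> 0 x) \<le> C" for x
      proof -
        have "norm (complex_of_real (japanese x powr (- 1)) * \<gamma> 0 x) = norm (\<gamma> 0 x) / japanese x"
          using japanese_ge(2)[of x] by (simp add: norm_mult norm_inverse powr_minus divide_inverse mult.commute)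
        then show ?thesis using C[of x] japanese_ge(2)[of x] by (simp add: divide_le_eq)
      qed
    qed
    moreover have "\<exists>x. \<gamma> 0 x \<noteq> 0" using r(2) by (metis zero_neq_one)
    ultimately show ?thesis using r(1,4) \<open>N = 3\<close> by (intro disjI2 exI[of _ "\<gamma> 0"]) auto
  qed
qed

end
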